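(* Let $n\geqslant 1$ be an integer, $k\in[0,1)$, $\mu\geqslant 0$, and let $p$ satisfy $$1<p<\max\left\{p_0\big(k,n+\tfrac{\mu}{1-k}\big),\,p_1(k,n)\right\}.$$ Assume that $u_0\in H^1(\mathbb{R}^n)$ and $u_1\in L^2(\mathbb{R}^n)$ are nonnegative, nontrivial and compactly supported functions with supports contained in $B_R$ for some $R>0$. For $\varepsilon>0$, let $$u\in \mathcal{C}\big([1,T),H^1(\mathbb{R}^n)\big)\cap\mathcal{C}^1\big([1,T),L^2(\mathbb{R}^n)\big)\cap L^p_{\mathrm{loc}}\big([1,T)\times\mathbb{R}^n\big)$$ be an energy solution, with lifespan $T=T(\varepsilon)$, to the Cauchy problem $$u_{tt}-t^{-2k}\Delta u+\mu t^{-1}u_t=|u|^p \ \ (x\in\mathbb{R}^n,\ t\in(1,T)),\qquad u(1,x)=\varepsilon u_0(x),\quad u_t(1,x)=\varepsilon u_1(x),$$ satisfying the support condition $\mathrm{supp}\,u(t,\cdot)\subset B_{A_k(t)+R}$ for any $t\in(1,T)$. Then there exists a positive constant $\varepsilon_0=\varepsilon_0(u_0,u_1,n,p,k,\mu,R)$ such that for any $\varepsilon\in(0,\varepsilon_0]$ the energy solution $u$ blows up in finite time. Moreover, the upper bound estimate for the lifespan $$T(\varepsilon)\leqslant \begin{cases} C\varepsilon^{-\frac{p(p-1)}{\theta(n,k,\mu,p)}} & \text{if } p<p_0\big(k,n+\tfrac{\mu}{1-k}\big),\\[4pt] C\varepsilon^{-\left(\frac{2}{p-1}-(1-k)n\right)^{-1}}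 & \text{if } p<p_1(k,n),\end{cases}$$ holds, where the positive constant $C$ is independent of $\varepsilon$ and $$\theta(n,k,\mu,p)\doteq 1-k+\left((1-k)\tfrac{n+1}{2}+\tfrac{\mu+3k}{2}\right)p-\left((1-k)\tfrac{n-1}{2}+\tfrac{\mu-k}{2}\right)p^2.$$
   Context: Notation: $B_r$ is the ball of radius $r$ centred at the origin of $\mathbb{R}^n$; $A_k(t)\doteq\int_1^t\tau^{-k}\,\mathrm{d}\tau=\frac{t^{1-k}-1}{1-k}$. Exponents: $p_0\big(k,n+\tfrac{\mu}{1-k}\big)$ is the positive root of the quadratic equation in $p$ $$\left(\tfrac{n-1}{2}+\tfrac{\mu-k}{2(1-k)}\right)p^2-\left(\tfrac{n+1}{2}+\tfrac{\mu+3k}{2(1-k)}\right)p-1=0,$$ and it is set equal to $\infty$ when the coefficient of $p^2$ is not positive. Moreover $p_1(k,n)\doteq 1+\frac{2}{(1-k)n}$. Energy solution: $u\in \mathcal{C}([1,T),H^1(\mathbb{R}^n))\cap\mathcal{C}^1([1,T),L^2(\mathbb{R}^n))\cap L^p_{\mathrm{loc}}([1,T)\times\mathbb{R}^n)$ is an energy solution on $[1,T)$ of the Cauchy problem if $u(1,\cdot)=\varepsilon u_0$ in $H^1(\mathbb{R}^n)$ and $$\int_{\mathbb{R}^n}\partial_tu(t,x)\psi(t,x)\,\mathrm{d}x-\varepsilon\int_{\mathbb{R}^n}u_1(x)\psi(1,x)\,\mathrm{d}x-\int_1^t\!\!\int_{\mathbb{R}^n}\partial_tu(s,x)\psi_s(s,x)\,\mathrm{d}x\,\mathrm{d}s+\int_1^t\!\!\int_{\mathbb{R}^n}s^{-2k}\nabla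 u(s,x)\cdot\nabla\psi(s,x)\,\mathrm{d}x\,\mathrm{d}s+\int_1^t\!\!\int_{\mathbb{R}^n}\mu s^{-1}\partial_tu(s,x)\psi(s,x)\,\mathrm{d}x\,\mathrm{d}s=\int_1^t\!\!\int_{\mathbb{R}^n}|u(s,x)|^p\psi(s,x)\,\mathrm{d}x\,\mathrm{d}s$$ for any $\psi\in\mathcal{C}_0^\infty([1,T)\times\mathbb{R}^n)$ and any $t\in(1,T)$. The lifespan $T(\varepsilon)$ is the maximal time such that the solution exists on $[1,T(\varepsilon))$; blow-up in finite time means $T(\varepsilon)<\infty$. *)

theory Defs
  imports "HOL-Analysis.Analysis"
begin

text \<open>
  Elements of \<open>L\<^sup>2\<close>, \<open>H\<^sup>1\<close> and \<open>L\<^sup>p\<close> are represented by functions; every notion below depends on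
  a function only up to equality almost everywhere. The space \<open>\<real>\<^sup>n\<close> is a Euclidean space
  \<^typ>\<open>'a::euclidean_space\<close> and space-time is \<^typ>\<open>real \<times> 'a::euclidean_space\<close>.
\<close>

section \<open>Smooth functions and supports\<close>

definition grad :: "('a::euclidean_space \<Rightarrow> real) \<Rightarrow> 'a \<Rightarrow> 'a" where
  "grad \<phi> x = (THE D. GDERIV \<phi> x :> D)"

primrec Ck :: "nat \<Rightarrow> ('a::euclidean_space \<Rightarrow> real) \<Rightarrow> bool" where
  "Ck 0 \<phi> \<longleftrightarrow> continuous_on UNIV \<phi>"
| "Ck (Suc m) \<phi> \<longleftrightarrow>
     (\<exists>D. (\<forall>x. GDERIV \<phi> x :> D x) \<and> (\<forall>i\<in>Basis. Ck m (\<lambda>x. D x \<bullet> i)))"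

definition smooth :: "('a::euclidean_space \<Rightarrow> real) \<Rightarrow> bool" where
  "smooth \<phi> \<longleftrightarrow> (\<forall>m. Ck m \<phi>)"

definition test_function :: "'a::euclidean_space set \<Rightarrow> ('a \<Rightarrow> real) \<Rightarrow> bool" where
  "test_function \<Omega> \<phi> \<longleftrightarrow>
     smooth \<phi> \<and> compact (closure {x. \<phi> x \<noteq> 0}) \<and> closure {x. \<phi> x \<noteq> 0} \<subseteq> \<Omega>"

text \<open>The support of a class of functions modulo equality almost everywhere.\<close>

definition ess_support :: "('a::euclidean_space \<Rightarrow> real) \<Rightarrow> 'a set" where
  "ess_support f = - \<Union>{U. open U \<and> (AE x in lebesgue. x \<in> U \<longrightarrow> f x = 0)}"

section \<open>Lebesgue and Sobolev spaces\<close>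

definition in_L2 :: "('a::euclidean_space \<Rightarrow> 'b::euclidean_space) \<Rightarrow> bool" where
  "in_L2 f \<longleftrightarrow> f \<in> borel_measurable lebesgue \<and> integrable lebesgue (\<lambda>x. (norm (f x))\<^sup>2)"

definition L2_norm :: "('a::euclidean_space \<Rightarrow> 'b::euclidean_space) \<Rightarrow> real" where
  "L2_norm f = sqrt (LINT x|lebesgue. (norm (f x))\<^sup>2)"

definition is_weak_gradient :: "('a::euclidean_space \<Rightarrow> real) \<Rightarrow> ('a \<Rightarrow> 'a) \<Rightarrow> bool" where
  "is_weak_gradient f g \<longleftrightarrow>
     (\<forall>\<phi>. test_function UNIV \<phi> \<longrightarrow>
        (LINT x|lebesgue. f x *\<^sub>R grad \<phi> x) = - (LINT x|lebesgue. \<phi> x *\<^sub>R g x))"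

definition in_H1 :: "('a::euclidean_space \<Rightarrow> real) \<Rightarrow> bool" where
  "in_H1 f \<longleftrightarrow> in_L2 f \<and> (\<exists>g. in_L2 g \<and> is_weak_gradient f g)"

text \<open>For functions in \<open>H\<^sup>1\<close> the choice is unique up to a null set.\<close>

definition weak_grad :: "('a::euclidean_space \<Rightarrow> real) \<Rightarrow> 'a \<Rightarrow> 'a" where
  "weak_grad f = (SOME g. in_L2 g \<and> is_weak_gradient f g)"

definition H1_norm :: "('a::euclidean_space \<Rightarrow> real) \<Rightarrow> real" where
  "H1_norm f = sqrt ((L2_norm f)\<^sup>2 + (L2_norm (weak_grad f))\<^sup>2)"

definition in_Lp_loc :: "real \<Rightarrow> 'a::euclidean_space set \<Rightarrow> ('a \<Rightarrow> real) \<Rightarrow> bool" where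
  "in_Lp_loc p S f \<longleftrightarrow>
     f \<in> borel_measurable (lebesgue_on S) \<and>
     (\<forall>K. compact K \<and> K \<subseteq> S \<longrightarrow> set_integrable lebesgue K (\<lambda>z. \<bar>f z\<bar> powr p))"

section \<open>Curves in Lebesgue and Sobolev spaces\<close>

definition C_L2 :: "real set \<Rightarrow> (real \<Rightarrow> 'a::euclidean_space \<Rightarrow> real) \<Rightarrow> bool" where
  "C_L2 I u \<longleftrightarrow>
     (\<forall>t\<in>I. in_L2 (u t)) \<and>
     (\<forall>t\<in>I. ((\<lambda>s. L2_norm (\<lambda>x. u s x - u t x)) \<longlongrightarrow> 0) (at t within I))"

definition C_H1 :: "real set \<Rightarrow> (real \<Rightarrow> 'a::euclidean_space \<Rightarrow> real) \<Rightarrow> bool" where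
  "C_H1 I u \<longleftrightarrow>
     (\<forall>t\<in>I. in_H1 (u t)) \<and>
     (\<forall>t\<in>I. ((\<lambda>s. H1_norm (\<lambda>x. u s x - u t x)) \<longlongrightarrow> 0) (at t within I))"

definition has_L2_derivative ::
  "real set \<Rightarrow> (real \<Rightarrow> 'a::euclidean_space \<Rightarrow> real) \<Rightarrow> real \<Rightarrow> ('a \<Rightarrow> real) \<Rightarrow> bool" where
  "has_L2_derivative I u t w \<longleftrightarrow>
     in_L2 w \<and>
     ((\<lambda>s. L2_norm (\<lambda>x. (u s x - u t x) / (s - t) - w x)) \<longlongrightarrow> 0) (at t within I)"

definition dt :: "real set \<Rightarrow> (real \<Rightarrow> 'a::euclidean_space \<Rightarrow> real) \<Rightarrow> real \<Rightarrow> 'a \<Rightarrow> real" where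
  "dt I u t = (SOME w. has_L2_derivative I u t w)"

definition C1_L2 :: "real set \<Rightarrow> (real \<Rightarrow> 'a::euclidean_space \<Rightarrow> real) \<Rightarrow> bool" where
  "C1_L2 I u \<longleftrightarrow>
     (\<forall>t\<in>I. in_L2 (u t)) \<and> (\<forall>t\<in>I. \<exists>w. has_L2_derivative I u t w) \<and> C_L2 I (dt I u)"

section \<open>Energy solutions and lifespan\<close>

definition time_interval :: "ereal \<Rightarrow> real set" where
  "time_interval T = {t. 1 \<le> t \<and> ereal t < T}"

text \<open>
  A test function in \<open>C\<^sub>0\<^sup>\<infinity>([1,T) \<times> \<real>\<^sup>n)\<close> need not vanish at time 1; it is given as the restriction
  to \<open>[1,T) \<times> \<real>\<^sup>n\<close> of a smooth function with compact support in \<open>(-\<infinity>,T) \<times> \<real>\<^sup>n\<close>. The value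
  \<open>T = \<infinity>\<close> is allowed. The joint measurability of the representative \<open>u\<close> is part of
  \<^const>\<open>in_Lp_loc\<close>.
\<close>

definition energy_solution ::
  "real \<Rightarrow> real \<Rightarrow> real \<Rightarrow> real \<Rightarrow> ('a::euclidean_space \<Rightarrow> real) \<Rightarrow> ('a \<Rightarrow> real)
    \<Rightarrow> ereal \<Rightarrow> (real \<Rightarrow> 'a \<Rightarrow> real) \<Rightarrow> bool" where
  "energy_solution k \<mu> p \<epsilon> u0 u1 T u \<longleftrightarrow>
     (let I = time_interval T; ut = dt I u in
      1 < T \<and>
      C_H1 I u \<and> C1_L2 I u \<and> in_Lp_loc p (I \<times> UNIV) (\<lambda>(t, x). u t x) \<and>
      (AE x in lebesgue. u 1 x = \<epsilon> * u0 x) \<and>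
      (\<forall>\<psi>. test_function {z. ereal (fst z) < T} \<psi> \<longrightarrow>
        (\<forall>t. 1 < t \<and> ereal t < T \<longrightarrow>
          (LINT x|lebesgue. ut t x * \<psi> (t, x))
          - \<epsilon> * (LINT x|lebesgue. u1 x * \<psi> (1, x))
          - (LINT s:{1..t}|lebesgue. LINT x|lebesgue. ut s x * deriv (\<lambda>r. \<psi> (r, x)) s)
          + (LINT s:{1..t}|lebesgue. LINT x|lebesgue.
               s powr (- 2 * k) * (weak_grad (u s) x \<bullet> grad (\<lambda>y. \<psi> (s, y)) x))
          + (LINT s:{1..t}|lebesgue. LINT x|lebesgue. \<mu> / s * ut s x * \<psi> (s, x))
          = (LINT s:{1..t}|lebesgue. LINT x|lebesgue. \<bar>u s x\<bar> powr p * \<psi> (s, x)))))"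

text \<open>
  \<open>T\<close> is the lifespan of the solution \<open>u\<close>: it solves the problem on \<open>[1,T)\<close> and no energy solution
  on a strictly longer interval extends it. The solution blows up in finite time if \<open>T < \<infinity>\<close>.
\<close>

definition energy_solution_with_lifespan ::
  "real \<Rightarrow> real \<Rightarrow> real \<Rightarrow> real \<Rightarrow> ('a::euclidean_space \<Rightarrow> real) \<Rightarrow> ('a \<Rightarrow> real)
    \<Rightarrow> ereal \<Rightarrow> (real \<Rightarrow> 'a \<Rightarrow> real) \<Rightarrow> bool" where
  "energy_solution_with_lifespan k \<mu> p \<epsilon> u0 u1 T u \<longleftrightarrow>
     energy_solution k \<mu> p \<epsilon> u0 u1 T u \<and>
     \<not> (\<exists>T' v. T < T' \<and> energy_solution k \<mu> p \<epsilon> u0 u1 T' v \<and>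
          (\<forall>t\<in>time_interval T. AE x in lebesgue. v t x = u t x))"

section \<open>Propagation of the support and critical exponents\<close>

definition A_k :: "real \<Rightarrow> real \<Rightarrow> real" where
  "A_k k t = integral {1..t} (\<lambda>\<tau>. \<tau> powr (- k))"

text \<open>
  This is the exponent \<open>p\<^sub>0(k, n + \<mu>/(1-k))\<close>, as a function of \<open>k\<close>, \<open>n\<close>, \<open>\<mu>\<close>. When the leading
  coefficient is positive, the product of the roots is negative, so the positive root is unique.
\<close>

definition p0 :: "real \<Rightarrow> nat \<Rightarrow> real \<Rightarrow> ereal" where
  "p0 k n \<mu> =
     (let a = (real n - 1) / 2 + (\<mu> - k) / (2 * (1 - k));
          b = (real n + 1) / 2 + (\<mu> + 3 * k) / (2 * (1 - k))
      in if a \<le> 0 then \<infinity> else ereal (THE p. 0 < p \<and> a * p\<^sup>2 - b * p - 1 = 0))"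

definition p1 :: "real \<Rightarrow> nat \<Rightarrow> real" where
  "p1 k n = 1 + 2 / ((1 - k) * real n)"

definition \<theta> :: "nat \<Rightarrow> real \<Rightarrow> real \<Rightarrow> real \<Rightarrow> real" where
  "\<theta> n k \<mu> p =
     1 - k + ((1 - k) * ((real n + 1) / 2) + (\<mu> + 3 * k) / 2) * p
           - ((1 - k) * ((real n - 1) / 2) + (\<mu> - k) / 2) * p\<^sup>2"

end

theory Submission
  imports Defs
begin

text \<open>
  Testing the equation with \<open>s powr \<mu>\<close> times a radial function \<open>\<phi>(x)\<close> makes the damping term cancel. If
  \<open>\<Delta>\<phi> = \<phi>\<close>, the moment \<open>F t = \<integral> u t * \<phi>\<close> satisfies \<open>F'' + \<mu> / t F' \<ge> t powr (- 2 * k) F\<close>, hence grows at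
  least like \<open>\<epsilon> t powr ((k - \<mu>) / 2) exp (A_k k t)\<close>, and the Hoelder inequality on the support of \<open>u\<close> turns
  this into a lower bound of order \<open>\<epsilon> powr p\<close> for \<open>\<integral> \<bar>u\<bar> powr p\<close>. If \<open>\<phi> = 1\<close>, the mean \<open>U t = \<integral> u t\<close> is
  nondecreasing, and the Hoelder inequality gives \<open>U'' + \<mu> / t U' \<ge> c t powr (- \<alpha>) U powr p\<close> with
  \<open>\<alpha> = (1 - k) n (p - 1)\<close>. On a window \<open>[S, 2 S]\<close> this makes \<open>U\<close> double infinitely often unless
  \<open>S powr (2 - \<alpha>) * U S powr (p - 1)\<close> is bounded. The bound \<open>U S \<ge> \<epsilon> \<integral> u0\<close> gives the estimate for
  \<open>p < p1\<close>; the bound for \<open>U\<close> that follows from the growth of \<open>F\<close> gives the one for \<open>p < p0\<close>.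
\<close>

section \<open>Calculus of smooth functions\<close>

text \<open>The energy class gives one time derivative of a moment, so every comparison runs on the
  once integrated equation, where the derivative at time t contains an integral over the past;
  positivity is therefore carried along from time 1. Test functions have compact support, whereas
  the weights 1 and \<phi> do not: each weight is cut off outside the support of u and the cutoff is
  removed afterwards. As u is only locally p-integrable in space-time, lower bounds for the integral
  of \<open>\<bar>u\<bar> powr p\<close> hold for almost every time. The Hoelder step loses nothing
  exponential: on the ball of radius A_k + R the conjugate norm of \<phi> brings exp (- p A_k), the
  inverse of what F to the power p brings, and a power of t, say with exponent e, is left.
  Integrated twice over [S, 2 S] it makes the mean at least of order
  \<open>\<epsilon> powr p * S powr (e + 2)\<close>; put into the window bound on [2 S, 4 S] this
  yields the exponent \<open>\<theta>\<close>, and a finite p0 is the positive root of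
  \<open>\<theta>\<close> as a function of p.\<close>

lemma GDERIV_imp_continuous_on:
  assumes "\<And>x. GDERIV f x :> D x"
  shows "continuous_on UNIV f"
  using assms unfolding gderiv_def
  by (intro has_derivative_continuous_on) (blast intro: has_derivative_at_withinI)

lemma GDERIV_unique:
  assumes "GDERIV f x :> D" "GDERIV f x :> E"
  shows "D = E"
proof -
  have "(\<lambda>h. h \<bullet> D) = (\<lambda>h. h \<bullet> E)"
    using assms unfolding gderiv_def by (rule has_derivative_unique)
  then have "\<And>h. h \<bullet> D = h \<bullet> E" by metis
  then show ?thesis using vector_eq_ldot by blast
qed

lemma grad_eq:
  assumes "GDERIV f x :> D"
  shows "grad f x = D"
  unfolding grad_def using assms GDERIV_unique by blast

lemma Ck_SucI:
  assumes "\<And>x. GDERIV f x :> D x" "\<And>i. i \<in> Basis \<Longrightarrow> Ck m (\<lambda>x. D x \<bullet> i)"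
  shows "Ck (Suc m) f"
  using assms by auto

lemma Ck_SucE:
  assumes "Ck (Suc m) f"
  obtains D where "\<And>x. GDERIV f x :> D x" "\<And>i. i \<in> Basis \<Longrightarrow> Ck m (\<lambda>x. D x \<bullet> i)"
  using assms by (auto simp only: Ck.simps(2))

lemma Ck_Suc_imp_Ck: "Ck (Suc m) f \<Longrightarrow> Ck m f"
proof (induction m arbitrary: f)
  case 0
  then show ?case using GDERIV_imp_continuous_on by (metis Ck.simps(1) Ck_SucE)
next
  case (Suc m)
  obtain D where D: "\<And>x. GDERIV f x :> D x"
    "\<And>i. i \<in> Basis \<Longrightarrow> Ck (Suc m) (\<lambda>x. D x \<bullet> i)"
    using Ck_SucE[OF Suc.prems] by blast
  show ?case by (rule Ck_SucI[OF D(1)]) (use D Suc.IH in blast)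
qed

lemma Ck_imp_continuous_on: "Ck m f \<Longrightarrow> continuous_on UNIV f"
proof (induction m)
  case (Suc m)
  then show ?case using Ck_Suc_imp_Ck by blast
qed simp

lemma Ck_const: "Ck m (\<lambda>x. c)"
proof (induction m arbitrary: c)
  case (Suc m)
  show ?case by (rule Ck_SucI[OF GDERIV_const]) (use Suc in auto)
qed auto

lemma Ck_inner: "Ck m (\<lambda>x. x \<bullet> v)"
proof (cases m)
  case 0
  then show ?thesis by (auto intro!: continuous_intros)
next
  case (Suc l)
  have D: "GDERIV (\<lambda>x. x \<bullet> v) x :> v" for x
    unfolding gderiv_def by (auto intro!: derivative_eq_intros)
  show ?thesis unfolding Suc by (rule Ck_SucI[OF D]) (rule Ck_const)
qed

lemma Ck_add: "Ck m f \<Longrightarrow> Ck m g \<Longrightarrow> Ck m (\<lambda>x. f x + g x)"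
proof (induction m arbitrary: f g)
  case 0
  then show ?case by (auto intro!: continuous_intros)
next
  case (Suc m)
  obtain D where D: "\<And>x. GDERIV f x :> D x" "\<And>i. i \<in> Basis \<Longrightarrow> Ck m (\<lambda>x. D x \<bullet> i)"
    using Ck_SucE[OF Suc.prems(1)] by blast
  obtain E where E: "\<And>x. GDERIV g x :> E x" "\<And>i. i \<in> Basis \<Longrightarrow> Ck m (\<lambda>x. E x \<bullet> i)"
    using Ck_SucE[OF Suc.prems(2)] by blast
  show ?case
    by (rule Ck_SucI[OF GDERIV_add[OF D(1) E(1)]]) (simp add: inner_add_left D E Suc.IH)
qed

lemma Ck_mult: "Ck m f \<Longrightarrow> Ck m g \<Longrightarrow> Ck m (\<lambda>x. f x * g x)"
proof (induction m arbitrary: f g)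
  case 0
  then show ?case by (auto intro!: continuous_intros)
next
  case (Suc m)
  obtain D where D: "\<And>x. GDERIV f x :> D x" "\<And>i. i \<in> Basis \<Longrightarrow> Ck m (\<lambda>x. D x \<bullet> i)"
    using Ck_SucE[OF Suc.prems(1)] by blast
  obtain E where E: "\<And>x. GDERIV g x :> E x" "\<And>i. i \<in> Basis \<Longrightarrow> Ck m (\<lambda>x. E x \<bullet> i)"
    using Ck_SucE[OF Suc.prems(2)] by blast
  have "Ck m f" "Ck m g" using Suc.prems Ck_Suc_imp_Ck by blast+
  then show ?case
    by (intro Ck_SucI[OF GDERIV_mult[OF D(1) E(1)]]) (simp add: inner_add_left D E Suc.IH Ck_add)
qed

lemma Ck_sum: "(\<And>i. i \<in> A \<Longrightarrow> Ck m (f i)) \<Longrightarrow> Ck m (\<lambda>x. \<Sum>i\<in>A. f i x)"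
  by (induction A rule: infinite_finite_induct) (auto simp: Ck_const Ck_add)

lemma Ck_inverse: "Ck m f \<Longrightarrow> (\<And>x. f x \<noteq> 0) \<Longrightarrow> Ck m (\<lambda>x. inverse (f x))"
proof (induction m arbitrary: f)
  case 0
  then show ?case by (auto intro!: continuous_intros)
next
  case (Suc m)
  from Suc.prems obtain D where D: "\<And>x. GDERIV f x :> D x"
    "\<And>i. i \<in> Basis \<Longrightarrow> Ck m (\<lambda>x. D x \<bullet> i)" by auto
  have I: "Ck m (\<lambda>x. inverse (f x))" using Suc Ck_Suc_imp_Ck by blast
  show ?case
  proof (rule Ck_SucI[OF GDERIV_inverse[OF D(1) Suc.prems(2)]])
    fix i :: 'a assume "i \<in> Basis"
    then have "Ck m (\<lambda>x. (-1) * (inverse (f x) * inverse (f x)) * (D x \<bullet> i))"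
      by (intro Ck_mult Ck_const I D)
    then show "Ck m (\<lambda>x. (- (inverse (f x))\<^sup>2 *\<^sub>R D x) \<bullet> i)"
      by (simp add: power2_eq_square)
  qed
qed

lemma Ck_compose: "Ck m h \<Longrightarrow> Ck m f \<Longrightarrow> Ck m (\<lambda>x. h (f x :: real))"
proof (induction m arbitrary: h)
  case 0
  then show ?case by (auto intro: continuous_on_compose2)
next
  case (Suc m)
  obtain D where D: "\<And>x. GDERIV f x :> D x" "\<And>i. i \<in> Basis \<Longrightarrow> Ck m (\<lambda>x. D x \<bullet> i)"
    using Ck_SucE[OF Suc.prems(2)] by blast
  obtain d where d: "\<And>x. GDERIV h x :> d x" "\<And>i. i \<in> Basis \<Longrightarrow> Ck m (\<lambda>x. d x \<bullet> i)"
    using Ck_SucE[OF Suc.prems(1)] by blast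
  have "DERIV h x :> d x" for x using d(1) by simp
  then have *: "GDERIV (\<lambda>x. h (f x)) x :> d (f x) *\<^sub>R D x" for x
    using GDERIV_DERIV_compose[OF D(1)] by blast
  have "Ck m d" using d(2)[of 1] by simp
  then have "Ck m (\<lambda>x. d (f x))" using Suc Ck_Suc_imp_Ck by blast
  then show ?case by (intro Ck_SucI[OF *]) (simp add: D Ck_mult)
qed

text \<open>The gradient in the product space is (0, D), so each of its coordinates is either 0 or
  again a function of the second variable.\<close>

lemma Ck_snd: "Ck m f \<Longrightarrow> Ck m (\<lambda>z :: 'b::euclidean_space \<times> 'a::euclidean_space. f (snd z))"
proof (induction m arbitrary: f)
  case 0
  then show ?case by (auto intro!: continuous_on_compose2[of UNIV f] continuous_intros)
next
  case (Suc m)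
  from Suc.prems obtain D where D: "\<And>x. GDERIV f x :> D x"
    "\<And>i. i \<in> Basis \<Longrightarrow> Ck m (\<lambda>x. D x \<bullet> i)" by auto
  have *: "GDERIV (\<lambda>z :: 'b \<times> 'a. f (snd z)) z :> (0, D (snd z))" for z
    unfolding gderiv_def
    by (rule has_derivative_eq_rhs[OF has_derivative_compose[OF _ D(1)[unfolded gderiv_def]]])
      (auto intro!: derivative_eq_intros simp: inner_prod_def)
  show ?case
  proof (rule Ck_SucI[OF *])
    fix i :: "'b \<times> 'a" assume i: "i \<in> Basis"
    then have "snd i = 0 \<or> snd i \<in> Basis" by (auto simp: Basis_prod_def)
    then show "Ck m (\<lambda>z :: 'b \<times> 'a. (0, D (snd z)) \<bullet> i)"
      using Ck_const[of m 0] Suc.IH[OF D(2), of "snd i"] by (auto simp: inner_prod_def)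
  qed
qed

text \<open>Membership in \<open>S\<close> is what the induction carries. Families closed under
  differentiation, such as all \<open>flat_poly P\<close> or all multiples of all
  \<open>radial_eig l\<close>, thus consist of smooth functions, and no formula for higher
  derivatives is needed.\<close>

lemma Ck_deriv_closed:
  fixes S :: "(real \<Rightarrow> real) set"
  assumes "\<And>h. h \<in> S \<Longrightarrow> \<exists>d\<in>S. \<forall>x. DERIV h x :> d x"
  shows "h \<in> S \<Longrightarrow> Ck m h"
proof (induction m arbitrary: h)
  case 0
  then obtain d where "\<forall>x. DERIV h x :> d x" using assms by blast
  then show ?case by (auto intro: DERIV_continuous_on)
next
  case (Suc m)
  then obtain d where "d \<in> S" "\<forall>x. DERIV h x :> d x" using assms by blast
  then show ?case by (intro Ck_SucI[of h d]) (auto simp: Suc.IH)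
qed

lemma smooth_const: "smooth (\<lambda>x. c)" by (simp add: smooth_def Ck_const)

lemma smooth_mult: "smooth f \<Longrightarrow> smooth g \<Longrightarrow> smooth (\<lambda>x. f x * g x)"
  by (simp add: smooth_def Ck_mult)

lemma smooth_compose: "smooth h \<Longrightarrow> smooth f \<Longrightarrow> smooth (\<lambda>x. h (f x :: real))"
  by (simp add: smooth_def Ck_compose)

lemma smooth_norm_square: "smooth (\<lambda>x. (norm x)\<^sup>2)"
proof -
  have "Ck m (\<lambda>x::'a. \<Sum>i\<in>Basis. (x \<bullet> i) * (x \<bullet> i))" for m
    by (intro Ck_sum Ck_mult Ck_inner)
  then show ?thesis
    unfolding smooth_def by (simp add: power2_norm_eq_inner euclidean_inner[symmetric])
qed

lemma smooth_real_deriv: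
  assumes "smooth h"
  obtains d where "\<And>x. DERIV h x :> d x" "smooth d"
proof -
  from assms have "Ck (Suc 0) h" unfolding smooth_def by blast
  then obtain d where d: "\<And>x. GDERIV h x :> d x" by auto
  have "Ck m d" for m
  proof -
    from assms have "Ck (Suc m) h" unfolding smooth_def by blast
    then obtain e where e: "\<And>x. GDERIV h x :> e x" "\<And>i. i \<in> Basis \<Longrightarrow> Ck m (\<lambda>x. e x \<bullet> i)" by auto
    \<comment> \<open>Each order of \<open>Ck\<close> provides its own derivative; uniqueness makes
      them one function.\<close>
    have "e = d" using GDERIV_unique[OF e(1) d] by blast
    then show ?thesis using e(2)[of 1] by simp
  qed
  then show ?thesis using that[of d] d by (simp add: smooth_def)
qed

lemma smooth_imp_continuous_on: "smooth f \<Longrightarrow> continuous_on A f"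
  unfolding smooth_def using Ck_imp_continuous_on continuous_on_subset by blast

section \<open>Flat functions, smooth cutoffs and truncated powers\<close>

definition flat_poly :: "real poly \<Rightarrow> real \<Rightarrow> real" where
  "flat_poly P x = (if 0 < x then poly P (1 / x) * exp (- 1 / x) else 0)"

lemma poly_exp_decay: "((\<lambda>y. poly P y * exp (- y)) \<longlongrightarrow> (0::real)) at_top"
proof (induction P)
  case (pCons a P)
  have "((\<lambda>y. poly Q y * exp (- y)) \<longlongrightarrow> (0::real)) at_top" for Q :: "real poly"
  proof -
    have "((\<lambda>y. \<Sum>i\<le>degree Q. coeff Q i * (y ^ i * exp (- y))) \<longlongrightarrow>
        (\<Sum>i\<le>degree Q. coeff Q i * 0)) at_top"
      by (intro tendsto_sum tendsto_mult tendsto_const) (simp add: exp_minus field_class.field_divide_inverse[symmetric] tendsto_power_div_exp_0)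
    then show ?thesis by (simp add: poly_altdef sum_distrib_right mult.assoc)
  qed
  then show ?case by blast
qed simp

text \<open>In terms of y = 1/x, differentiation replaces P by P - P' and multiplies by y^2, which
  is the factor \<open>[:0, 0, 1:]\<close>. At 0 the difference quotient from the right has the same
  form with the polynomial y P, so exponential decay settles that case too.\<close>

lemma flat_poly_deriv: "DERIV (flat_poly P) x :> flat_poly ([:0, 0, 1:] * (P - pderiv P)) x"
proof (cases x "0::real" rule: linorder_cases)
  case less
  have "DERIV (\<lambda>x. 0) x :> (0::real)" by simp
  from has_field_derivative_transform_within_open[OF this, of "{..<0}" "flat_poly P"]
  show ?thesis using less by (simp add: flat_poly_def)
next
  case greater
  have 1: "DERIV (\<lambda>x. 1 / x) x :> - (1 / x)\<^sup>2" "DERIV (\<lambda>x. - 1 / x) x :> (1 / x)\<^sup>2"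
    using greater by (auto intro!: derivative_eq_intros simp: power2_eq_square)
  have "DERIV (\<lambda>x. poly P (1 / x) * exp (- 1 / x)) x :>
      (poly (pderiv P) (1 / x) * - (1 / x)\<^sup>2) * exp (- 1 / x) +
      (exp (- 1 / x) * (1 / x)\<^sup>2) * poly P (1 / x)"
    by (intro DERIV_mult DERIV_chain2[OF poly_DERIV] DERIV_chain2[OF DERIV_exp] 1)
  then have "DERIV (\<lambda>x. poly P (1 / x) * exp (- 1 / x)) x :>
      poly ([:0, 0, 1:] * (P - pderiv P)) (1 / x) * exp (- 1 / x)"
    by (rule back_subst[of "\<lambda>D. DERIV _ x :> D"]) (simp add: power2_eq_square algebra_simps)
  from has_field_derivative_transform_within_open[OF this, of "{0<..}" "flat_poly P"]
  show ?thesis using greater by (simp add: flat_poly_def)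
next
  case equal
  have "((\<lambda>y. flat_poly P y / y) \<longlongrightarrow> 0) (at_left 0)"
    by (rule Lim_transform_eventually[of "\<lambda>_. 0"])
      (auto simp: flat_poly_def eventually_at_filter)
  moreover have "((\<lambda>y. flat_poly P y / y) \<longlongrightarrow> 0) (at_right 0)"
  proof -
    have "((\<lambda>y::real. poly ([:0, 1:] * P) (inverse y) * exp (- inverse y)) \<longlongrightarrow> 0) (at_right 0)"
      using filterlim_compose[OF poly_exp_decay filterlim_inverse_at_top_right] by blast
    then show ?thesis
      by (rule Lim_transform_eventually)
        (auto simp: flat_poly_def eventually_at_filter field_simps)
  qed
  ultimately have "((\<lambda>y. flat_poly P y / y) \<longlongrightarrow> 0) (at 0)"
    by (simp add: filterlim_at_split)
  then show ?thesis unfolding equal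
    by (simp add: has_field_derivative_iff flat_poly_def)
qed

lemma smooth_flat_poly: "smooth (flat_poly P)"
  unfolding smooth_def
  using Ck_deriv_closed[of "range flat_poly" "flat_poly P"] flat_poly_deriv by blast

text \<open>The usual quotient of flat functions. Its denominator cannot vanish, because b - x and x
  - a are never both nonpositive when a < b.\<close>

lemma smooth_cutoff_exists:
  fixes a b :: real
  assumes "a < b"
  shows "\<exists>h. smooth h \<and> (\<forall>x\<le>a. h x = 1) \<and> (\<forall>x\<ge>b. h x = 0) \<and> (\<forall>x. 0 \<le> h x \<and> h x \<le> 1)"
proof -
  define e where "e = flat_poly 1"
  have e: "0 \<le> e x" "e x = 0 \<longleftrightarrow> x \<le> 0" for x by (auto simp: e_def flat_poly_def)
  have pos: "0 < e (b - x) + e (x - a)" for x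
    using e(1)[of "b - x"] e(1)[of "x - a"] e(2)[of "b - x"] e(2)[of "x - a"] assms by linarith
  have A: "Ck m (\<lambda>x::real. e (b - x))" "Ck m (\<lambda>x::real. e (x - a))" for m
  proof -
    have E: "Ck m e" using smooth_flat_poly unfolding e_def smooth_def by blast
    have "Ck m (\<lambda>x::real. b + x \<bullet> (- 1))" "Ck m (\<lambda>x::real. x \<bullet> 1 + (- a))"
      by (intro Ck_add Ck_const Ck_inner)+
    then show "Ck m (\<lambda>x::real. e (b - x))" "Ck m (\<lambda>x::real. e (x - a))"
      using Ck_compose[OF E] by auto
  qed
  define h where "h x = e (b - x) * inverse (e (b - x) + e (x - a))" for x
  have "smooth h"
    unfolding smooth_def h_def using pos
    by (intro allI Ck_mult Ck_inverse Ck_add A) (metis less_irrefl)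
  moreover have "h x = 1" if "x \<le> a" for x
    using that pos[of x] e(2)[of "x - a"] by (simp add: h_def)
  moreover have "h x = 0" if "b \<le> x" for x
    using that e(2)[of "b - x"] by (simp add: h_def)
  moreover have "0 \<le> h x" "h x \<le> 1" for x
    using e(1)[of "b - x"] e(1)[of "x - a"] pos[of x] by (auto simp: h_def field_simps)
  ultimately show ?thesis by blast
qed

text \<open>The power is singular at 0 only, and h vanishes on a neighbourhood of the half-line x
  \<le> 0. Both h and a vary in the induction, since the derivative is a combination of two products
  of the same kind.\<close>

lemma Ck_mult_powr:
  fixes h :: "real \<Rightarrow> real"
  assumes "0 < c"
  shows "smooth h \<Longrightarrow> (\<And>x. x < c \<Longrightarrow> h x = 0) \<Longrightarrow> Ck m (\<lambda>x. h x * x powr a)"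
proof (induction m arbitrary: h a)
  have D: "DERIV (\<lambda>x. h x * x powr a) x :> d x * x powr a + a * (h x * x powr (a - 1))"
    if h: "\<And>x. DERIV h x :> d x" "\<And>x. x < c \<Longrightarrow> h x = 0" "\<And>x. x < c \<Longrightarrow> d x = 0"
    for h d :: "real \<Rightarrow> real" and a x :: real
  proof (cases "0 < x")
    case True
    then show ?thesis by (auto intro!: derivative_eq_intros h simp: field_simps)
  next
    case False
    have "DERIV (\<lambda>y. h y * y powr a) x :> 0"
      by (rule has_field_derivative_transform_within_open[of "\<lambda>_. 0" _ _ "{..<c}"])
        (use False assms h(2) in auto)
    then show ?thesis using False h assms by simp
  qed
  have z: "d x = 0" if h: "\<And>x. DERIV h x :> d x" "\<And>x. x < c \<Longrightarrow> h x = 0" "x < c"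
    for h d :: "real \<Rightarrow> real" and x :: real
  proof -
    have "DERIV h x :> 0"
      by (rule has_field_derivative_transform_within_open[of "\<lambda>_. 0" _ _ "{..<c}"])
        (use h in auto)
    then show ?thesis using h(1) DERIV_unique by blast
  qed
  {
    case 0
    then obtain d where d: "\<And>x. DERIV h x :> d x" "smooth d" using smooth_real_deriv by blast
    from D[OF d(1) 0(2) z[OF d(1) 0(2)]] show ?case
      by (auto intro!: DERIV_continuous_on)
  next
    case (Suc m)
    then obtain d where d: "\<And>x. DERIV h x :> d x" "smooth d" using smooth_real_deriv by blast
    note zd = z[OF d(1) Suc.prems(2)]
    have "Ck m (\<lambda>x. d x * x powr a + a * (h x * x powr (a - 1)))"
      by (intro Ck_add Ck_mult[OF Ck_const] Suc.IH d Suc.prems zd) auto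
    then show ?case
      using D[OF d(1) Suc.prems(2) zd] by (intro Ck_SucI) auto
  }
qed

text \<open>Supplies the time factor of the test functions. The derivative is wanted at the end
  points 1 and s as well, so the power must be left intact on a neighbourhood of [1, s].\<close>

lemma smooth_powr_cutoff_exists:
  fixes a s t :: real
  assumes "1 < s" "s < t"
  shows "\<exists>h. smooth h \<and> (\<forall>x. x < 1/2 \<or> t < x \<longrightarrow> h x = 0) \<and>
    (\<forall>x\<in>{1..s}. h x = x powr a \<and> DERIV h x :> a * x powr (a - 1))"
proof -
  define s' where "s' = (s + t) / 2"
  have s': "s < s'" "s' < t" using assms by (auto simp: s'_def)
  obtain h1 where h1: "smooth h1" "\<forall>x\<le>s'. h1 x = 1" "\<forall>x\<ge>t. h1 x = 0"
    using smooth_cutoff_exists[OF s'(2)] by blast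
  \<comment> \<open>\<open>h2\<close> is used at - x: the factor vanishes for x \<le> 1/2, which
    hides the singularity of the power, and is 1 from 3/4 on, hence around time 1.\<close>
  have "- 3 / 4 < (- 1 / 2 :: real)" by simp
  then obtain h2 :: "real \<Rightarrow> real" where h2: "smooth h2" "\<forall>x\<le>- 3 / 4. h2 x = 1" "\<forall>x\<ge>- 1 / 2. h2 x = (0::real)"
    using smooth_cutoff_exists by blast
  define h where "h x = (h1 x * h2 (x * (- 1))) * x powr a" for x
  have "Ck m (\<lambda>x::real. h2 (x \<bullet> (-1)))" for m
    using Ck_compose[OF _ Ck_inner] h2(1) unfolding smooth_def by blast
  then have "smooth (\<lambda>x. h2 (x * (-1)))" unfolding smooth_def by simp
  then have P: "smooth (\<lambda>x. h1 x * h2 (x * (-1)))" by (rule smooth_mult[OF h1(1)])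
  have "Ck m h" for m
    unfolding h_def by (rule Ck_mult_powr[of "1/2", OF _ P]) (use h2(3) in auto)
  then have sm: "smooth h" unfolding smooth_def by blast
  have eq: "h x = x powr a" if "3/4 < x" "x < s'" for x
    using that s' h1(2) h2(2) by (simp add: h_def)
  have h0: "h x = 0" if "x < 1/2" for x using that h2(3) by (simp add: h_def)
  have ht: "h x = 0" if "t < x" for x using that h1(3) by (simp add: h_def)
  have hD: "DERIV h x :> a * x powr (a - 1)" if "1 \<le> x" "x \<le> s" for x
  proof -
    have "DERIV (\<lambda>x. x powr a) x :> a * x powr (a - 1)"
      using that by (auto intro!: derivative_eq_intros)
    then show ?thesis
      by (rule has_field_derivative_transform_within_open[of _ _ _ "{3/4<..<s'}"])
        (use that s' eq in auto)
  qed
  have "h x = x powr a" if "1 \<le> x" "x \<le> s" for x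
    using eq[of x] that s'(1) by simp
  with sm h0 ht hD show ?thesis by (intro exI[of _ h]) auto
qed

section \<open>Ordinary differential inequalities\<close>

text \<open>Once f has reached \<open>2 ^ n * m\<close>, a waiting time h q^n doubles it: the square
  of q^n is \<open>2 powr (- (p - 1) * n)\<close>, which is exactly what the superlinear power
  gains. The waiting times have the finite sum h / (1 - q), so on a longer interval f b would exceed
  every \<open>2 ^ n * m\<close>.\<close>

lemma quadratic_growth_interval_bound:
  fixes f :: "real \<Rightarrow> real"
  assumes "1 < p" "0 < c" "0 < m" "a \<le> b" "m \<le> f a"
    and mono: "\<And>s t. a \<le> s \<Longrightarrow> s \<le> t \<Longrightarrow> t \<le> b \<Longrightarrow> f s \<le> f t"
    and grow: "\<And>s t. a \<le> s \<Longrightarrow> s \<le> t \<Longrightarrow> t \<le> b \<Longrightarrow> c * (t - s)\<^sup>2 * f s powr p \<le> f t"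
  shows "(b - a)\<^sup>2 * c * m powr (p - 1) \<le> 2 / (1 - 2 powr (- (p - 1) / 2))\<^sup>2"
proof -
  define q where "q = 2 powr (- (p - 1) / 2)"
  \<comment> \<open>This makes \<open>c * h\<^sup>2 * m powr (p - 1)\<close> equal to 2, which is
    the first doubling.\<close>
  define h where "h = sqrt (2 / (c * m powr (p - 1)))"
  have q: "0 < q" "q < 1" using assms(1) by (auto simp: q_def powr_less_one)
  have h: "0 < h" and h2: "h\<^sup>2 = 2 / (c * m powr (p - 1))"
    using assms by (auto simp: h_def)
  have "b - a \<le> h / (1 - q)"
  proof (rule ccontr)
    assume long: "\<not> b - a \<le> h / (1 - q)"
    define s where "s n = a + (\<Sum>j<n. h * q ^ j)" for n
    have s: "s n \<le> b" "a \<le> s n" "s n \<le> s (Suc n)" for n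
    proof -
      have "(\<Sum>j<n. h * q ^ j) = h * ((1 - q ^ n) / (1 - q))"
        using q by (simp add: sum_distrib_left[symmetric] sum_gp_strict)
      also have "\<dots> \<le> h / (1 - q)" using q h by (simp add: field_simps)
      finally show "s n \<le> b" using long by (simp add: s_def)
      show "a \<le> s n" "s n \<le> s (Suc n)" using q h by (auto simp: s_def intro!: sum_nonneg)
    qed
    have "2 ^ n * m \<le> f (s n)" for n
    proof (induction n)
      case 0
      then show ?case using assms by (simp add: s_def)
    next
      case (Suc n)
      have q2: "(q ^ n)\<^sup>2 = 2 powr (- (p - 1) * n)"
        unfolding q_def
        by (simp add: powr_realpow[symmetric] powr_powr power2_eq_square powr_add[symmetric] powr_power mult.commute)
      have "2 ^ Suc n * m = 2 * m * (2 powr (- (p - 1) * n) * 2 powr (n * p))"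
        by (simp add: powr_add[symmetric] powr_realpow[symmetric] algebra_simps)
      also have "\<dots> = c * (h * q ^ n)\<^sup>2 * ((2 ^ n) powr p * (m powr (p - 1) * m))"
        using assms by (simp add: power_mult_distrib h2 q2 powr_powr flip: powr_realpow)
      also have "(2 ^ n) powr p * (m powr (p - 1) * m) = (2 ^ n * m) powr p"
        using assms by (simp add: powr_mult powr_mult_base powr_diff)
      also have "c * (h * q ^ n)\<^sup>2 * (2 ^ n * m) powr p \<le> c * (h * q ^ n)\<^sup>2 * f (s n) powr p"
        using Suc assms by (intro mult_left_mono powr_mono2) auto
      also have "\<dots> = c * (s (Suc n) - s n)\<^sup>2 * f (s n) powr p" by (simp add: s_def)
      also have "\<dots> \<le> f (s (Suc n))" using s by (intro grow) auto
      finally show ?case .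
    qed
    moreover have "f (s n) \<le> f b" for n using s by (intro mono) auto
    ultimately have le: "2 ^ n * m \<le> f b" for n by (meson order.trans)
    obtain n where "f b / m < 2 ^ n" using real_arch_pow[of 2] by auto
    then show False using le[of n] assms by (simp add: field_simps)
  qed
  then have "(b - a)\<^sup>2 \<le> (h / (1 - q))\<^sup>2" using assms by (intro power_mono) auto
  also have "\<dots> = 2 / (1 - q)\<^sup>2 / (c * m powr (p - 1))" by (simp add: power_divide h2)
  finally show ?thesis using assms unfolding q_def by (simp add: field_simps)
qed

text \<open>The hypothesis \<open>step\<close> may use the whole past because in the applications H'
  contains an integral of H. At the first time where H is not positive, the infimum of
  \<open>S\<close>, the past is positive, so H has not decreased and is still at least H a > 0, a
  contradiction.\<close>

lemma ge_initial_if_nonneg_imp_deriv_nonneg: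
  fixes H :: "real \<Rightarrow> real"
  assumes cont: "continuous_on {a..b} H" and "0 < H a"
    and deriv: "\<And>t. a < t \<Longrightarrow> t < b \<Longrightarrow> DERIV H t :> H' t"
    and step: "\<And>t. a < t \<Longrightarrow> t < b \<Longrightarrow> (\<And>r. a \<le> r \<Longrightarrow> r \<le> t \<Longrightarrow> 0 \<le> H r) \<Longrightarrow> 0 \<le> H' t"
    and "a \<le> t" "t \<le> b"
  shows "H a \<le> H t"
proof -
  have mono: "H a \<le> H s" if "a \<le> s" "s \<le> b" "\<And>r. a \<le> r \<Longrightarrow> r < s \<Longrightarrow> 0 < H r" for s
  proof (rule DERIV_nonneg_imp_increasing_open[OF that(1)])
    fix x assume x: "a < x" "x < s"
    have "0 \<le> H' x" by (rule step) (use x that in \<open>auto intro: less_imp_le\<close>)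
    then show "\<exists>y. DERIV H x :> y \<and> 0 \<le> y" using deriv[of x] x that by auto
  qed (use cont that in \<open>auto intro: continuous_on_subset\<close>)
  have "0 < H s" if "s \<in> {a..b}" for s
  proof (rule ccontr)
    assume n: "\<not> 0 < H s"
    define S where "S = {a..b} \<inter> H -` {..0}"
    have S: "closed S" "bdd_below S" "S \<noteq> {}"
      unfolding S_def using cont n that
      by (auto intro!: continuous_closed_preimage bdd_belowI[of _ a])
    then have "Inf S \<in> S" by (intro closed_contains_Inf)
    moreover have "0 < H r" if "a \<le> r" "r < Inf S" for r
    proof (rule ccontr)
      assume "\<not> 0 < H r"
      then have "r \<in> S" using that \<open>Inf S \<in> S\<close> by (auto simp: S_def)
      then show False using cInf_lower[OF _ S(2)] that by force
    qed
    ultimately have "H a \<le> H (Inf S)" by (intro mono) (auto simp: S_def)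
    then show False using \<open>Inf S \<in> S\<close> \<open>0 < H a\<close> by (auto simp: S_def)
  qed
  then show ?thesis using assms(5,6) by (intro mono) auto
qed

text \<open>
  The weight \<open>t powr ((k - \<mu>) / 2) * exp (t powr (1 - k) / (1 - k))\<close> is the WKB approximation of the
  growing solution of \<open>F'' + \<mu> / t F' = t powr (- 2 * k) F\<close>; the correction \<open>D\<close> turns it into a
  subsolution which is nonincreasing at \<open>t0\<close>.
\<close>

lemma WKB_subsolution_exists:
  fixes k \<mu> :: real
  assumes "0 \<le> k" "k < 1"
  shows "\<exists>t0 G Q Q'. 1 \<le> t0 \<and> Q t0 \<le> 0 \<and>
    (\<forall>t\<ge>t0. t powr ((k - \<mu>) / 2) * exp ((t powr (1 - k) - 1) / (1 - k)) \<le> G t \<and>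
       DERIV G t :> Q t / t powr \<mu> \<and> DERIV Q t :> Q' t \<and> Q' t \<le> t powr (\<mu> - 2 * k) * G t)"
proof -
  define \<kappa> where "\<kappa> = (k - \<mu>) / 2"
  \<comment> \<open>Without the correction D the weight solves the equation up to e / t^2. In the
    variable x = t powr (k - 1), which decreases from x0, the choice D x0^2 = 3/2 serves two ends: Z
    t0 \<le> 0 becomes 1 / x0 + \<kappa> \<le> 3 / (2 x0), and the remainder e - 2 D + D (2 - 2 k) x
    + D^2 x^2 is at most D/4 - 2 D + D/4 + 3 D/2 = 0.\<close>
  define e where "e = \<kappa>\<^sup>2 - \<kappa> + \<mu> * \<kappa>"
  define x0 where "x0 = 1 / (8 + 2 * \<bar>\<kappa>\<bar> + 4 * \<bar>e\<bar>)"
  define t0 where "t0 = x0 powr (1 / (k - 1))"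
  define D where "D = 3 / (2 * x0\<^sup>2)"
  have x0: "0 < x0" "x0 \<le> 1 / 8" "\<bar>\<kappa>\<bar> \<le> 1 / (2 * x0)" "\<bar>e\<bar> \<le> 1 / (4 * x0)"
    by (auto simp: x0_def divide_simps)
  have D: "0 < D" "D * x0\<^sup>2 = 3 / 2" using x0 by (auto simp: D_def field_simps)
  have "e \<le> D / 4"
  proof -
    have "1 / (4 * x0) \<le> 3 / (8 * x0\<^sup>2)" using x0 by (simp add: divide_simps power2_eq_square)
    then show ?thesis using x0 by (simp add: D_def)
  qed
  have t0: "1 \<le> t0" "t0 powr (k - 1) = x0"
  proof -
    have "1 powr (1 / (k - 1)) \<le> x0 powr (1 / (k - 1))"
      using x0 assms by (intro powr_mono2') (auto simp: divide_simps)
    then show "1 \<le> t0" by (simp add: t0_def)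
    show "t0 powr (k - 1) = x0" using assms x0 by (simp add: t0_def powr_powr)
  qed
  define Z where "Z t = t powr (- k) + \<kappa> / t - D * t powr (k - 2)" for t
  define Z' where "Z' t = - k * t powr (- k - 1) - \<kappa> / t\<^sup>2 - D * ((k - 2) * t powr (k - 3))" for t
  define G where "G t = t powr \<kappa> * exp ((t powr (1 - k) + D * t powr (k - 1)) / (1 - k))" for t
  define Q where "Q t = t powr \<mu> * (G t * Z t)" for t
  define Q' where "Q' t = t powr \<mu> * G t * (\<mu> / t * Z t + (Z t)\<^sup>2 + Z' t)" for t
  have dZ: "DERIV Z t :> Z' t" if "1 \<le> t" for t
    unfolding Z_def Z'_def using that
    by (auto intro!: derivative_eq_intros simp: power2_eq_square)
  have dG: "DERIV G t :> G t * Z t" if t: "1 \<le> t" for t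
  proof -
    have k: "1 - k \<noteq> 0" using assms by simp
    have "DERIV (\<lambda>t. (t powr (1 - k) + D * t powr (k - 1)) / (1 - k)) t :>
        ((1 - k) * t powr (1 - k - 1) + D * ((k - 1) * t powr (k - 1 - 1))) / (1 - k)"
      using t k by (auto intro!: derivative_eq_intros)
    also have "((1 - k) * t powr (1 - k - 1) + D * ((k - 1) * t powr (k - 1 - 1))) / (1 - k) =
        t powr (- k) - D * t powr (k - 2)"
      using k by (simp add: divide_simps) (simp add: algebra_simps)
    finally have "DERIV G t :> \<kappa> * t powr (\<kappa> - 1) * exp ((t powr (1 - k) + D * t powr (k - 1)) / (1 - k))
        + (exp ((t powr (1 - k) + D * t powr (k - 1)) / (1 - k)) * (t powr (- k) - D * t powr (k - 2))) * t powr \<kappa>"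
      unfolding G_def using t
      by (intro DERIV_mult DERIV_chain2[OF DERIV_exp] has_real_derivative_powr) auto
    moreover have "t powr (\<kappa> - 1) = t powr \<kappa> / t" using t by (simp add: powr_diff)
    ultimately show ?thesis unfolding G_def Z_def by (simp add: algebra_simps)
  qed
  have dQ: "DERIV Q t :> Q' t" if t: "1 \<le> t" for t
  proof -
    have p: "DERIV (\<lambda>t. t powr \<mu>) t :> \<mu> * t powr (\<mu> - 1)"
      using t by (intro has_real_derivative_powr) auto
    have "DERIV Q t :> \<mu> * t powr (\<mu> - 1) * (G t * Z t) +
        ((G t * Z t) * Z t + Z' t * G t) * t powr \<mu>"
      unfolding Q_def by (intro DERIV_mult p dG dZ t)
    moreover have "t powr (\<mu> - 1) = t powr \<mu> / t" using t by (simp add: powr_diff)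
    ultimately show ?thesis unfolding Q'_def by (simp add: algebra_simps power2_eq_square)
  qed
  have sub: "\<mu> / t * Z t + (Z t)\<^sup>2 + Z' t \<le> t powr (- 2 * k)" if t: "t0 \<le> t" for t
  proof -
    define x where "x = t powr (k - 1)"
    have t1: "1 \<le> t" using t t0 by simp
    have x: "0 < x" "x \<le> x0"
      unfolding x_def t0(2)[symmetric] using t t1 t0 assms by (auto intro!: powr_mono2')
    have tk: "t powr k = x * t" using t1 by (simp add: x_def powr_diff)
    have pw: "t powr (- k) = 1 / (x * t)" "t powr (k - 2) = x / t" "t powr (- k - 1) = 1 / (x * t\<^sup>2)"
      "t powr (k - 3) = x / t\<^sup>2"
      using t1 x
      by (auto simp: powr_minus powr_diff tk field_simps power2_eq_square power3_eq_cube)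
    have "t powr (2 * k) = t powr k * t powr k" by (simp add: powr_add[symmetric])
    then have pw2: "t powr (- 2 * k) = 1 / (x * t)\<^sup>2"
      using powr_minus[of t "2 * k"] by (simp add: tk power2_eq_square inverse_eq_divide)
    have "D * x\<^sup>2 \<le> 3 / 2" unfolding D(2)[symmetric] using x D by (intro mult_left_mono power_mono) auto
    then have "D * (D * x\<^sup>2) \<le> D * (3 / 2)" using D by (intro mult_left_mono) auto
    moreover have "D * ((2 - 2 * k) * x) \<le> D * (2 * (1 / 8))"
      using x x0 D assms by (intro mult_left_mono mult_mono) auto
    ultimately have le: "e - 2 * D + D * ((2 - 2 * k) * x) + D * (D * x\<^sup>2) \<le> 0"
      using \<open>e \<le> D / 4\<close> by simp
    \<comment> \<open>This relation cancels the terms of order t powr (- k - 1). The helpful - 2 D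
      in the remainder is the product of the leading term of Z with the correction.\<close>
    have mu: "\<mu> = k - 2 * \<kappa>" by (simp add: \<kappa>_def field_simps)
    have "\<mu> / t * Z t + (Z t)\<^sup>2 + Z' t - t powr (- 2 * k) =
        (e - 2 * D + D * ((2 - 2 * k) * x) + D * (D * x\<^sup>2)) / t\<^sup>2"
      unfolding Z_def Z'_def pw pw2 e_def mu using t1 x
      by (simp add: divide_simps) (simp add: algebra_simps power2_eq_square)
    also have "\<dots> \<le> 0" using le by (simp add: divide_nonpos_nonneg)
    finally show ?thesis by simp
  qed
  have G0: "0 < G t" if "1 \<le> t" for t using that by (simp add: G_def)
  have "Z t0 \<le> 0"
  proof -
    have tk: "t0 powr k = x0 * t0" using t0 by (simp add: t0(2)[symmetric] powr_diff)
    have "Z t0 = (1 / x0 + \<kappa> - D * x0) / t0"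
      unfolding Z_def using t0 x0 by (simp add: powr_minus powr_diff tk divide_simps power2_eq_square)
    moreover have "D * x0 = 3 / (2 * x0)" using x0 by (simp add: D_def divide_simps power2_eq_square)
    moreover have "1 / x0 = 2 * (1 / (2 * x0))" "3 / (2 * x0) = 3 * (1 / (2 * x0))" by auto
    then have "1 / x0 + \<kappa> - 3 / (2 * x0) \<le> 0" using x0(3) by linarith
    ultimately show ?thesis using t0 by (simp add: divide_nonpos_pos)
  qed
  then have "Q t0 \<le> 0" using G0[of t0] t0 by (simp add: Q_def mult_le_0_iff)
  moreover have "DERIV G t :> Q t / t powr \<mu>" if "t0 \<le> t" for t
    using dG[of t] that t0 by (simp add: Q_def)
  moreover have "Q' t \<le> t powr (\<mu> - 2 * k) * G t" if t: "t0 \<le> t" for t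
  proof -
    have "Q' t \<le> t powr \<mu> * G t * t powr (- 2 * k)"
      unfolding Q'_def using sub[OF t] G0[of t] t t0 by (intro mult_left_mono) auto
    also have "\<dots> = t powr (\<mu> + - 2 * k) * G t" by (simp only: powr_add ac_simps)
    finally show ?thesis by simp
  qed
  moreover have "t powr \<kappa> * exp ((t powr (1 - k) - 1) / (1 - k)) \<le> G t" if "t0 \<le> t" for t
  proof -
    have "0 \<le> D * t powr (k - 1)" using D by simp
    then show ?thesis unfolding G_def using assms
      by (intro mult_left_mono) (auto simp: divide_right_mono)
  qed
  ultimately show ?thesis using t0(1) dQ
    by (intro exI[of _ t0] exI[of _ G] exI[of _ Q] exI[of _ Q'])
      (auto simp: \<kappa>_def)
qed

text \<open>Isolates constants that work for all solutions at once, so that they can be fixed before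
  \<epsilon>, T and u. The second order inequality appears once integrated: V stands for the
  velocity moment at time 1, J for the integral of the linear term, and N for the accumulated
  source, of which only monotonicity and sign matter.\<close>

definition growth_constants :: "real \<Rightarrow> real \<Rightarrow> real \<Rightarrow> real \<Rightarrow> bool" where
  "growth_constants k \<mu> t0 c \<longleftrightarrow> 1 \<le> t0 \<and> 0 < c \<and> (\<forall>b F F' J N V.
    continuous_on {1..b} F \<and> 0 < F 1 \<and> 0 \<le> (V::real) \<and>
    (\<forall>t. 1 < t \<and> t < b \<longrightarrow> DERIV F t :> F' t \<and> t powr \<mu> * F' t = V + J t + N t \<and>
       DERIV J t :> t powr (\<mu> - 2 * k) * F t) \<and>
    continuous_on {1..b} J \<and> J 1 = 0 \<and> mono_on {1..b} N \<and> 0 \<le> N 1 \<longrightarrow>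
    (\<forall>t. t0 \<le> t \<and> t \<le> b \<longrightarrow>
      c * F 1 * (t powr ((k - \<mu>) / 2) * exp ((t powr (1 - k) - 1) / (1 - k))) \<le> F t))"

text \<open>F is compared with d G, where d is half of F t1 / G t1, so that H = F - d G starts
  positive. A first comparison gives F \<ge> F 1, which turns F t1 into F 1 in the final bound. At
  t1 the derivative of F is known only by its sign, which is why the subsolution was built with Q t1
  \<le> 0.\<close>

lemma growth_constants_exist:
  fixes k \<mu> :: real
  assumes "0 \<le> k" "k < 1"
  shows "\<exists>t0 c. growth_constants k \<mu> t0 c"
proof -
  obtain t1 G Q Q' where t1: "1 \<le> t1" "Q t1 \<le> 0" and
    G: "\<And>t. t1 \<le> t \<Longrightarrow> t powr ((k - \<mu>) / 2) * exp ((t powr (1 - k) - 1) / (1 - k)) \<le> G t"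
    "\<And>t. t1 \<le> t \<Longrightarrow> DERIV G t :> Q t / t powr \<mu>" "\<And>t. t1 \<le> t \<Longrightarrow> DERIV Q t :> Q' t"
    "\<And>t. t1 \<le> t \<Longrightarrow> Q' t \<le> t powr (\<mu> - 2 * k) * G t"
    using WKB_subsolution_exists[OF assms, of \<mu>] by blast
  have Gpos: "0 < G t" if "t1 \<le> t" for t
    by (rule less_le_trans[OF _ G(1)[OF that]]) (use that t1 in auto)
  define c where "c = 1 / (2 * G t1)"
  have c: "0 < c" using Gpos by (simp add: c_def)
  have "c * F 1 * (t powr ((k - \<mu>) / 2) * exp ((t powr (1 - k) - 1) / (1 - k))) \<le> F t"
    if F: "continuous_on {1..b} F" "0 < F 1" "0 \<le> V"
      "\<And>t. 1 < t \<Longrightarrow> t < b \<Longrightarrow> DERIV F t :> F' t"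
      "\<And>t. 1 < t \<Longrightarrow> t < b \<Longrightarrow> t powr \<mu> * F' t = V + J t + N t"
      "\<And>t. 1 < t \<Longrightarrow> t < b \<Longrightarrow> DERIV J t :> t powr (\<mu> - 2 * k) * F t"
      "continuous_on {1..b} J" "J 1 = 0" "mono_on {1..b} N" "0 \<le> N 1" and t: "t1 \<le> t" "t \<le> b"
    for b F F' J N V t
  proof -
    have base: "F 1 \<le> F r" if r: "1 \<le> r" "r \<le> b" for r
    proof (rule ge_initial_if_nonneg_imp_deriv_nonneg[where H = F, OF F(1,2,4) _ r])
      fix r assume r: "1 < r" "r < b" and pos: "\<And>s. 1 \<le> s \<Longrightarrow> s \<le> r \<Longrightarrow> 0 \<le> F s"
      have "J 1 \<le> J r"
      proof (rule DERIV_nonneg_imp_increasing_open[where f = J])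
        fix x assume "1 < x" "x < r"
        then show "\<exists>y. DERIV J x :> y \<and> 0 \<le> y"
          using F(6)[of x] pos[of x] r by (intro exI[of _ "x powr (\<mu> - 2 * k) * F x"]) auto
      qed (use r F(7) in \<open>auto intro: continuous_on_subset\<close>)
      moreover have "N 1 \<le> N r" using F(9) r by (auto simp: mono_on_def)
      ultimately have "0 \<le> r powr \<mu> * F' r" using F(3,5,8,10) r by auto
      then show "0 \<le> F' r" using r by (simp add: zero_le_mult_iff)
    qed
    have N: "N s \<le> N r" if "1 \<le> s" "s \<le> r" "r \<le> b" for r s
      using F(9) that by (auto simp: mono_on_def)
    have J: "J s \<le> J r" if "1 \<le> s" "s \<le> r" "r \<le> b" for r s
    proof (rule DERIV_nonneg_imp_increasing_open[OF that(2)])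
      fix x assume "s < x" "x < r"
      then show "\<exists>y. DERIV J x :> y \<and> 0 \<le> y"
        using F(2) F(6)[of x] base[of x] that
        by (intro exI[of _ "x powr (\<mu> - 2 * k) * F x"]) auto
    qed (use that F(7) in \<open>auto intro: continuous_on_subset\<close>)
    define d where "d = c * F t1"
    have F1: "F 1 \<le> F t1" using t t1 by (intro base) auto
    have d: "0 < d" "d * G t1 = F t1 / 2"
      using F1 F(2) c Gpos[of t1] by (auto simp: d_def c_def)
    define H where "H r = F r - d * G r" for r
    have "H t1 \<le> H t"
    proof (rule ge_initial_if_nonneg_imp_deriv_nonneg[where H = H and b = b and H' = "\<lambda>r. F' r - d * (Q r / r powr \<mu>)"])
      have "continuous_on {t1..b} G"
        by (intro DERIV_continuous_on) (use G(2) in \<open>auto intro: has_field_derivative_at_within\<close>)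
      then show "continuous_on {t1..b} H"
        unfolding H_def using F(1) t1 by (intro continuous_intros) (auto intro: continuous_on_subset)
      show "0 < H t1" using d F1 F(2) by (simp add: H_def)
      show "DERIV H r :> F' r - d * (Q r / r powr \<mu>)" if "t1 < r" "r < b" for r
        unfolding H_def using that t1 by (intro DERIV_diff DERIV_cmult F(4) G(2)) auto
      fix r assume r: "t1 < r" "r < b" and pos: "\<And>s. t1 \<le> s \<Longrightarrow> s \<le> r \<Longrightarrow> 0 \<le> H s"
      \<comment> \<open>The derivative of J - d Q is at least
        \<open>x powr (\<mu> - 2 * k) * H x\<close>, nonnegative as long as H has been so. Together
        with Q t1 \<le> 0 this gives V + J + N \<ge> d Q at r, that is H' r \<ge> 0.\<close>
      have "J t1 - d * Q t1 \<le> J r - d * Q r"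
      proof (rule DERIV_nonneg_imp_increasing_open[where f = "\<lambda>r. J r - d * Q r"])
        fix x assume x: "t1 < x" "x < r"
        have "0 \<le> x powr (\<mu> - 2 * k) * H x" using pos[of x] x by auto
        also have "\<dots> \<le> x powr (\<mu> - 2 * k) * F x - d * Q' x"
          using mult_left_mono[OF G(4)[of x], of d] x d by (simp add: H_def algebra_simps)
        finally show "\<exists>y. DERIV (\<lambda>r. J r - d * Q r) x :> y \<and> 0 \<le> y"
          using x t1 r by (intro exI[of _ "x powr (\<mu> - 2 * k) * F x - d * Q' x"] conjI
              DERIV_diff DERIV_cmult F(6) G(3)) auto
      next
        have "continuous_on {t1..r} Q"
          by (intro DERIV_continuous_on) (use G(3) in \<open>auto intro: has_field_derivative_at_within\<close>)
        then show "continuous_on {t1..r} (\<lambda>r. J r - d * Q r)"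
          using F(7) t1 r by (intro continuous_intros) (auto intro: continuous_on_subset)
      qed (use r in auto)
      moreover have "d * Q t1 \<le> 0" using t1 d by (simp add: mult_le_0_iff)
      moreover have "0 \<le> J t1" using J[of 1 t1] F(8) t1 t by simp
      moreover have "0 \<le> N r" using N[of 1 r] F(10) t1 r by simp
      ultimately have "0 \<le> r powr \<mu> * F' r - d * Q r" using F(3) F(5)[of r] r t1 by simp
      also have "\<dots> = r powr \<mu> * (F' r - d * (Q r / r powr \<mu>))"
        using r t1 by (simp add: algebra_simps)
      finally show "0 \<le> F' r - d * (Q r / r powr \<mu>)" using r t1 by (simp add: zero_le_mult_iff)
    qed (use t in auto)
    then have "d * G t \<le> F t" using d F1 F(2) by (simp add: H_def)
    moreover have "c * F 1 * (t powr ((k - \<mu>) / 2) * exp ((t powr (1 - k) - 1) / (1 - k))) \<le> d * G t"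
      unfolding d_def using F1 c G(1)[OF t(1)] F(2) by (intro mult_mono) auto
    ultimately show ?thesis by simp
  qed
  note main = this
  show ?thesis unfolding growth_constants_def
  proof (rule exI[of _ t1], rule exI[of _ c], rule conjI[OF t1(1)], rule conjI[OF c], intro allI impI)
    fix b F F' J N V t
    assume *: "continuous_on {1..b} F \<and> 0 < F 1 \<and> 0 \<le> (V::real) \<and>
      (\<forall>t. 1 < t \<and> t < b \<longrightarrow> DERIV F t :> F' t \<and> t powr \<mu> * F' t = V + J t + N t \<and>
         DERIV J t :> t powr (\<mu> - 2 * k) * F t) \<and>
      continuous_on {1..b} J \<and> J 1 = 0 \<and> mono_on {1..b} N \<and> 0 \<le> N 1" and "t1 \<le> t \<and> t \<le> b"
    then show "c * F 1 * (t powr ((k - \<mu>) / 2) * exp ((t powr (1 - k) - 1) / (1 - k))) \<le> F t"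
      by (intro main[of b F V F' J N t]) simp_all
  qed
qed

section \<open>The radial eigenfunction of the Laplacian\<close>

text \<open>
  The function \<open>x \<mapsto> radial_eig n (norm x ^ 2)\<close> on \<open>\<real>\<^sup>n\<close> is, up to a factor, the spherical mean of
  \<open>exp (x \<bullet> \<omega>)\<close> over unit vectors \<open>\<omega>\<close>; it equals its own Laplacian.
\<close>

definition radial_coeff :: "nat \<Rightarrow> nat \<Rightarrow> real" where
  "radial_coeff n j = (\<Prod>i<j. 1 / (2 * (real i + 1) * (2 * real i + real n)))"

definition radial_eig :: "nat \<Rightarrow> real \<Rightarrow> real" where
  "radial_eig n z = (\<Sum>j. radial_coeff n j * z ^ j)"

declare add_2_eq_Suc' [simp del]

lemma radial_coeff_0 [simp]: "radial_coeff n 0 = 1"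
  by (simp add: radial_coeff_def)

lemma radial_coeff_Suc:
  "radial_coeff n (Suc j) = radial_coeff n j / (2 * (real j + 1) * (2 * real j + real n))"
  by (simp add: radial_coeff_def)

lemma radial_coeff_pos: "0 < n \<Longrightarrow> 0 < radial_coeff n j"
  unfolding radial_coeff_def by (intro prod_pos) auto

lemma radial_coeff_le: "0 < n \<Longrightarrow> radial_coeff n j \<le> 1 / fact j"
proof (induction j)
  case (Suc j)
  have "(real j + 1) * 1 \<le> (real j + 1) * (2 * (2 * real j + real n))"
    using Suc.prems by (intro mult_left_mono) auto
  then have "real j + 1 \<le> 2 * (real j + 1) * (2 * real j + real n)" by (simp add: algebra_simps)
  then have "radial_coeff n j / (2 * (real j + 1) * (2 * real j + real n)) \<le> (1 / fact j) / (real j + 1)"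
    using Suc radial_coeff_pos[OF Suc.prems, of j] by (intro frac_le) auto
  then show ?case by (simp add: radial_coeff_Suc mult.commute add.commute)
qed simp

lemma summable_radial:
  assumes "0 < n"
  shows "summable (\<lambda>j. radial_coeff n j * z ^ j)"
proof (rule summable_comparison_test)
  show "summable (\<lambda>j. \<bar>z\<bar> ^ j /\<^sub>R fact j)" by (rule summable_exp_generic)
  have "norm (radial_coeff n j * z ^ j) \<le> \<bar>z\<bar> ^ j /\<^sub>R fact j" for j
    using mult_right_mono[OF radial_coeff_le[OF assms, of j], of "\<bar>z\<bar> ^ j"] radial_coeff_pos[OF assms, of j]
    by (simp add: abs_mult power_abs field_simps)
  then show "\<exists>N. \<forall>j\<ge>N. norm (radial_coeff n j * z ^ j) \<le> \<bar>z\<bar> ^ j /\<^sub>R fact j" by blast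
qed

text \<open>The series is the hypergeometric function 0F1(; n/2; z/4), whose derivative is, up to a
  factor, the same function with n raised by 2. This is that rule for the coefficients.\<close>

lemma radial_coeff_shift:
  "0 < n \<Longrightarrow> (real j + 1) * radial_coeff n (Suc j) = radial_coeff (n + 2) j / (2 * real n)"
proof (induction j)
  case 0
  then show ?case by (simp add: radial_coeff_Suc)
next
  case (Suc j)
  have "(real (Suc j) + 1) * radial_coeff n (Suc (Suc j)) =
      ((real j + 1) * radial_coeff n (Suc j)) / ((real j + 1) * (2 * (2 * (real j + 1) + real n)))"
    by (simp add: radial_coeff_Suc[of n "Suc j"] divide_simps) (simp add: algebra_simps)
  also have "\<dots> = radial_coeff (n + 2) (Suc j) / (2 * real n)"
    unfolding Suc.IH[OF Suc.prems] using Suc.prems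
    by (simp add: radial_coeff_Suc[of "n + 2"] field_simps)
  finally show ?case .
qed

lemma radial_eig_deriv:
  assumes "0 < n"
  shows "DERIV (radial_eig n) z :> radial_eig (n + 2) z / (2 * real n)"
proof -
  have d: "diffs (radial_coeff n) = (\<lambda>j. radial_coeff (n + 2) j * (1 / (2 * real n)))"
    using radial_coeff_shift[OF assms] by (auto simp: diffs_def fun_eq_iff add.commute)
  have "DERIV (\<lambda>z. \<Sum>j. radial_coeff n j * z ^ j) z :> (\<Sum>j. diffs (radial_coeff n) j * z ^ j)"
    by (rule termdiffs_strong_converges_everywhere) (rule summable_radial[OF assms])
  also have "(\<Sum>j. diffs (radial_coeff n) j * z ^ j) = radial_eig (n + 2) z / (2 * real n)"
    unfolding d radial_eig_def using suminf_divide[OF summable_radial[of "n + 2" z], of "2 * real n"]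
    by (simp add: mult_ac)
  finally show ?thesis by (simp add: radial_eig_def[abs_def])
qed

text \<open>For g = \<open>radial_eig n\<close> this is 4 z g'' + 2 n g' = g, with both derivatives
  expressed by functions of the dimensions n + 2 and n + 4. After the constant term 1 is split off,
  it is an identity between coefficients.\<close>

lemma radial_eig_recurrence:
  assumes "0 < n"
  shows "z * radial_eig (n + 4) z / (real n * (real n + 2)) + radial_eig (n + 2) z = radial_eig n z"
proof -
  let ?K = "real n * (real n + 2)"
  have c: "radial_coeff (n + 4) i / ?K + radial_coeff (n + 2) (Suc i) = radial_coeff n (Suc i)" for i
  proof -
    have "radial_coeff (n + 4) i = 2 * (real n + 2) * (real i + 1) * radial_coeff (n + 2) (Suc i)"
      using radial_coeff_shift[of "n + 2" i] by (simp add: numeral_eq_Suc field_simps)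
    then have 1: "radial_coeff (n + 4) i / ?K + radial_coeff (n + 2) (Suc i) =
        ((2 * (real i + 1) + real n) / real n) * radial_coeff (n + 2) (Suc i)"
      using assms by (simp add: divide_simps) (simp add: algebra_simps)
    have 2: "radial_coeff (n + 2) (Suc i) = 2 * real n * (real i + 2) * radial_coeff n (Suc (Suc i))"
      using radial_coeff_shift[OF assms, of "Suc i"] assms by (simp add: field_simps)
    show ?thesis
      unfolding 1 unfolding 2 using assms
      by (simp add: radial_coeff_Suc[of n "Suc i"] divide_simps) (simp add: algebra_simps)
  qed
  note s = summable_radial[of _ z]
  have e: "radial_eig m z = 1 + z * (\<Sum>j. radial_coeff m (Suc j) * z ^ j)" if "0 < m" for m
  proof -
    have "radial_eig m z = radial_coeff m 0 * z ^ 0 + (\<Sum>j. radial_coeff m (Suc j) * z ^ Suc j)"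
      unfolding radial_eig_def using suminf_split_head[OF s[OF that]] by simp
    moreover have "summable (\<lambda>j. radial_coeff m (Suc j) * z ^ j)"
    proof -
      have "radial_coeff m (Suc j) \<le> radial_coeff m j" for j
      proof -
        have "1 \<le> 2 * (real j + 1) * (2 * real j + real m)"
          using that mult_mono[of 1 "2 * (real j + 1)" 1 "2 * real j + real m"] by simp
        then show ?thesis
          using radial_coeff_pos[OF that, of j] divide_left_mono[of 1 "2 * (real j + 1) * (2 * real j + real m)" "radial_coeff m j"]
          by (simp add: radial_coeff_Suc)
      qed
      then show ?thesis
        using radial_coeff_pos[OF that]
        by (intro summable_comparison_test[OF _ summable_radial[OF that, of "\<bar>z\<bar>"]])
          (auto simp: abs_mult power_abs less_imp_le intro!: mult_right_mono exI[of _ 0])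
    qed
    ultimately show ?thesis by (simp add: suminf_mult[symmetric] mult_ac)
  qed
  have S: "summable (\<lambda>j. radial_coeff m (Suc j) * z ^ j)" if "0 < m" for m
  proof (cases "z = 0")
    case True
    then show ?thesis by (simp add: summable_0_powser)
  next
    case False
    have "summable (\<lambda>j. radial_coeff m (Suc j) * z ^ Suc j)"
      using s[OF that] summable_Suc_iff[of "\<lambda>j. radial_coeff m j * z ^ j"] by simp
    then have "summable (\<lambda>j. (radial_coeff m (Suc j) * z ^ Suc j) * (1 / z))" by (rule summable_mult2)
    then show ?thesis using False by simp
  qed
  have "radial_eig (n + 4) z / ?K + (\<Sum>j. radial_coeff (n + 2) (Suc j) * z ^ j) =
      (\<Sum>j. radial_coeff n (Suc j) * z ^ j)"
    unfolding radial_eig_def c[symmetric]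
    using suminf_add[OF summable_divide[OF s[of "n + 4"], of ?K] S[of "n + 2"]]
      suminf_divide[OF s[of "n + 4"], of ?K]
    by (simp add: algebra_simps)
  then have "z * (radial_eig (n + 4) z / ?K) + z * (\<Sum>j. radial_coeff (n + 2) (Suc j) * z ^ j) =
      z * (\<Sum>j. radial_coeff n (Suc j) * z ^ j)"
    by (simp only: distrib_left[symmetric])
  then show ?thesis unfolding e[OF assms] e[of "n + 2", simplified] by simp
qed

text \<open>Differentiation leads from dimension l to l + 2, so the multiples of these functions in
  all dimensions together form a family closed under derivatives.\<close>

lemma smooth_radial_eig:
  assumes "0 < n"
  shows "smooth (radial_eig n)"
proof -
  have "Ck m (radial_eig n)" for m
  proof (rule Ck_deriv_closed[of "{\<lambda>z. a * radial_eig l z | a l. 0 < l}"])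
    fix h assume "h \<in> {\<lambda>z. a * radial_eig l z | a l. 0 < l}"
    then obtain a l where h: "h = (\<lambda>z. a * radial_eig l z)" "0 < l" by auto
    have "DERIV h z :> (a / (2 * real l)) * radial_eig (l + 2) z" for z
      unfolding h using DERIV_cmult[OF radial_eig_deriv[OF h(2)], of a z] by simp
    then have D: "\<forall>z. DERIV h z :> (a / (2 * real l)) * radial_eig (l + 2) z" by blast
    have "(\<lambda>z. (a / (2 * real l)) * radial_eig (l + 2) z) \<in>
        {\<lambda>z. a * radial_eig l z | a l. 0 < l}"
      by (rule CollectI, rule exI[of _ "a / (2 * real l)"], rule exI[of _ "l + 2"]) simp
    then show "\<exists>d\<in>{\<lambda>z. a * radial_eig l z | a l. 0 < l}. \<forall>x. DERIV h x :> d x"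
      by (rule rev_bexI) (rule D)
  next
    show "radial_eig n \<in> {\<lambda>z. a * radial_eig l z | a l. 0 < l}"
      using assms by (auto intro!: exI[of _ 1] exI[of _ n])
  qed
  then show ?thesis unfolding smooth_def by blast
qed

lemma radial_eig_ge_1:
  assumes "0 < n" "0 \<le> z"
  shows "1 \<le> radial_eig n z"
proof -
  have "(\<Sum>j\<in>{0}. radial_coeff n j * z ^ j) \<le> radial_eig n z"
    unfolding radial_eig_def using assms radial_coeff_pos[OF assms(1)]
    by (intro sum_le_suminf summable_radial) (auto simp: less_imp_le)
  then show ?thesis by simp
qed

lemma radial_eig_mono:
  assumes "0 < n" "0 \<le> y" "y \<le> z"
  shows "radial_eig n y \<le> radial_eig n z"
  unfolding radial_eig_def using assms radial_coeff_pos[OF assms(1)]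
  by (intro suminf_le summable_radial mult_left_mono power_mono) (auto simp: less_imp_le)

text \<open>
  With \<open>a = (n - 1) / 2\<close>, the function \<open>r powr (- a) * exp (r - C / r)\<close> is a supersolution of the
  radial equation; its logarithmic derivative \<open>Y\<close> bounds that of the eigenfunction.
\<close>

lemma radial_eig_upper_bound:
  assumes n: "0 < n"
  shows "\<exists>C>0. \<forall>r\<ge>0. radial_eig n (r\<^sup>2) \<le> C * (1 + r) powr (- (real n - 1) / 2) * exp r"
proof -
  define a where "a = (real n - 1) / 2"
  define f where "f r = radial_eig n (r\<^sup>2)" for r
  define f' where "f' r = r * radial_eig (n + 2) (r\<^sup>2) / real n" for r
  \<comment> \<open>The second derivative of f, read off the radial equation f'' + (n - 1) / r f' =
    f, as 2 a = n - 1.\<close>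
  define f2 where "f2 r = f r - 2 * a / r * f' r" for r
  have a: "0 \<le> a" using n by (simp add: a_def)
  have df: "DERIV f r :> f' r" for r
    unfolding f_def f'_def
    by (rule DERIV_chain2[OF radial_eig_deriv[OF n], THEN DERIV_cong])
      (use n in \<open>auto intro!: derivative_eq_intros\<close>)
  have df': "DERIV f' r :> f2 r" if "0 < r" for r
  proof -
    have n2: "0 < n + 2" by simp
    have "DERIV (\<lambda>r. radial_eig (n + 2) (r\<^sup>2)) r :>
        radial_eig (n + 2 + 2) (r\<^sup>2) / (2 * real (n + 2)) * (2 * r)"
      by (rule DERIV_chain2[OF radial_eig_deriv[OF n2]]) (auto intro!: derivative_eq_intros)
    from DERIV_cdivide[OF DERIV_mult[OF DERIV_ident this], of "real n"]
    have D: "DERIV f' r :> (1 * radial_eig (n + 2) (r\<^sup>2) +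
        radial_eig (n + 2 + 2) (r\<^sup>2) / (2 * real (n + 2)) * (2 * r) * r) / real n"
      by (simp add: f'_def[abs_def])
    have "r\<^sup>2 * radial_eig (n + 4) (r\<^sup>2) / (real n * (real n + 2)) =
        radial_eig n (r\<^sup>2) - radial_eig (n + 2) (r\<^sup>2)"
      using radial_eig_recurrence[OF n, of "r\<^sup>2"] by simp
    moreover have "(1 * radial_eig (n + 2) (r\<^sup>2) +
        radial_eig (n + 2 + 2) (r\<^sup>2) / (2 * real (n + 2)) * (2 * r) * r) / real n =
        radial_eig (n + 2) (r\<^sup>2) / real n + r\<^sup>2 * radial_eig (n + 4) (r\<^sup>2) / (real n * (real n + 2))"
      using n by (simp add: divide_simps numeral_eq_Suc) (simp add: algebra_simps power2_eq_square)
    moreover have "f2 r = radial_eig n (r\<^sup>2) - radial_eig (n + 2) (r\<^sup>2) + radial_eig (n + 2) (r\<^sup>2) / real n"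
      unfolding f2_def f'_def f_def a_def using n that by (simp add: field_simps)
    ultimately have "(1 * radial_eig (n + 2) (r\<^sup>2) +
        radial_eig (n + 2 + 2) (r\<^sup>2) / (2 * real (n + 2)) * (2 * r) * r) / real n = f2 r" by linarith
    with D show ?thesis by (rule back_subst)
  qed
  have f1: "1 \<le> f r" for r unfolding f_def using n by (simp add: radial_eig_ge_1)
  have f'1: "0 \<le> f' 1" unfolding f'_def using radial_eig_ge_1[of "n + 2" 1] by simp
  \<comment> \<open>Two demands on C: 2 C \<ge> a^2 - a + 1 makes the Riccati inequality hold for
    all r \<ge> 1, and 1 - a + C \<ge> f' 1 starts the comparison at r = 1, because f 1 \<ge>
    1.\<close>
  define C where "C = a\<^sup>2 + 1 + a + f' 1"
  have C1: "a\<^sup>2 - a + 1 \<le> 2 * C" unfolding C_def using a f'1 zero_le_power2[of a] by argo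
  have C2: "0 < C" unfolding C_def using a f'1 zero_le_power2[of a] by linarith
  have C3: "f' 1 \<le> 1 - a + C" "0 \<le> 1 - a + C" using a f'1 by (auto simp: C_def)
  note C = C1 C2 C3
  define Y where "Y r = 1 - a / r + C / r\<^sup>2" for r
  define E where "E r = r powr a * exp (r - C / r)" for r
  have dE: "DERIV E r :> E r * (2 * a / r + Y r)" if "0 < r" for r
    unfolding E_def Y_def using that
    by (auto intro!: derivative_eq_intros simp: powr_diff field_simps power2_eq_square)
  have dY: "DERIV Y r :> a / r\<^sup>2 - 2 * C / r ^ 3" if "0 < r" for r
    unfolding Y_def using that
    by (auto intro!: derivative_eq_intros simp: field_simps power2_eq_square power3_eq_cube)
  have le: "f' r \<le> Y r * f r" if r: "1 \<le> r" for r
  proof -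
    \<comment> \<open>E is an integrating factor, E' = E (2 a / r + Y). It removes f' from the
      derivative of f' - Y f and leaves E f times the Riccati defect 1 - 2 a Y / r - Y^2 - Y', which
      is nonpositive.\<close>
    define P where "P s = E s * (f' s - Y s * f s)" for s
    have "P r \<le> P 1"
    proof (rule DERIV_nonpos_imp_nonincreasing[OF r])
      fix s :: real assume s: "1 \<le> s" "s \<le> r"
      define x where "x = 1 / s"
      define D where "D = E s * (2 * a / s + Y s) * (f' s - Y s * f s) +
          (f2 s - ((a / s\<^sup>2 - 2 * C / s ^ 3) * f s + f' s * Y s)) * E s"
      have "DERIV P s :> D"
        unfolding P_def D_def using s by (intro DERIV_mult DERIV_diff dE dY df df') auto
      moreover have "D = E s * f s * (1 - 2 * a / s * Y s - (Y s)\<^sup>2 - (a / s\<^sup>2 - 2 * C / s ^ 3))"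
      proof -
        define w where "w = 2 * a / s"
        show ?thesis
          unfolding D_def f2_def w_def[symmetric] by (simp add: algebra_simps power2_eq_square)
      qed
      moreover have "1 - 2 * a / s * Y s - (Y s)\<^sup>2 - (a / s\<^sup>2 - 2 * C / s ^ 3) =
          x\<^sup>2 * (a\<^sup>2 - a - 2 * C + 1 - (C * x - 1)\<^sup>2)"
      proof -
        have eqs: "2 * a / s = 2 * a * x" "Y s = 1 - a * x + C * x\<^sup>2" "a / s\<^sup>2 = a * x\<^sup>2"
          "2 * C / s ^ 3 = 2 * C * x ^ 3"
          by (simp_all add: Y_def x_def power_divide)
        show ?thesis unfolding eqs by (simp add: algebra_simps power2_eq_square power3_eq_cube)
      qed
      moreover have "a\<^sup>2 - a - 2 * C + 1 - (C * x - 1)\<^sup>2 \<le> 0"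
        using C(1) zero_le_power2[of "C * x - 1"] by linarith
      then have "x\<^sup>2 * (a\<^sup>2 - a - 2 * C + 1 - (C * x - 1)\<^sup>2) \<le> 0"
        by (intro mult_nonneg_nonpos) auto
      moreover have "0 \<le> E s * f s" using f1[of s] by (simp add: E_def)
      ultimately show "\<exists>y. DERIV P s :> y \<and> y \<le> 0" by (metis mult_nonneg_nonpos)
    qed
    moreover have "P 1 \<le> 0"
    proof -
      have "f' 1 \<le> (1 - a + C) * f 1" using C f1[of 1] mult_left_mono[of 1 "f 1" "1 - a + C"] by simp
      then show ?thesis by (simp add: P_def E_def Y_def mult_le_0_iff)
    qed
    ultimately have "P r \<le> 0" by simp
    moreover have "0 < E r" using r by (simp add: E_def)
    ultimately show ?thesis by (simp add: P_def mult_le_0_iff)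
  qed
  define M where "M r = f r * (r powr a * exp (C / r - r))" for r
  have M: "M r \<le> M 1" if r: "1 \<le> r" for r
  proof (rule DERIV_nonpos_imp_nonincreasing[OF r])
    fix s :: real assume s: "1 \<le> s" "s \<le> r"
    have "DERIV (\<lambda>r. r powr a * exp (C / r - r)) s :> s powr a * exp (C / s - s) * - Y s"
      unfolding Y_def using s
      by (auto intro!: derivative_eq_intros simp: powr_diff field_simps power2_eq_square)
    from DERIV_mult[OF df this] have "DERIV M s :> s powr a * exp (C / s - s) * (f' s - Y s * f s)"
      unfolding M_def by (rule DERIV_cong) (simp add: algebra_simps)
    moreover have "s powr a * exp (C / s - s) * (f' s - Y s * f s) \<le> 0"
      using le[OF s(1)] by (intro mult_nonneg_nonpos) auto
    ultimately show "\<exists>y. DERIV M s :> y \<and> y \<le> 0" by blast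
  qed
  \<comment> \<open>The factor 2 powr a pays for 1 + r in place of r, since r \<ge> (1 + r) / 2 for
    r \<ge> 1; the rest also covers r < 1 by monotonicity of f.\<close>
  define K where "K = f 1 * exp C * 2 powr a"
  have K: "0 < K" using f1[of 1] by (simp add: K_def)
  have "f r \<le> K * (1 + r) powr (- a) * exp r" if r: "0 \<le> r" for r
  proof (cases "1 \<le> r")
    case True
    have "f r * (r powr a * exp (- r)) \<le> M r"
      unfolding M_def using f1[of r] C True by (intro mult_left_mono) auto
    also have "\<dots> \<le> f 1 * exp (C - 1)" using M[OF True] by (simp add: M_def)
    also have "\<dots> \<le> f 1 * exp C" using f1[of 1] by (intro mult_left_mono) auto
    finally have "f r \<le> f 1 * exp C * (r powr (- a)) * exp r"
      using True by (simp add: powr_minus exp_minus divide_simps mult_ac)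
    also have "r powr (- a) \<le> ((1 + r) / 2) powr (- a)" using True a by (intro powr_mono2') auto
    also have "((1 + r) / 2) powr (- a) = 2 powr a * (1 + r) powr (- a)"
      using True by (simp add: powr_divide powr_minus field_simps)
    finally show ?thesis using f1[of 1] by (simp add: K_def mult_ac mult_left_mono)
  next
    case False
    have "f r \<le> f 1" unfolding f_def using n r False by (intro radial_eig_mono) (auto simp: power_le_one)
    moreover have "1 * 1 * 1 \<le> exp C * (2 powr a * (1 + r) powr (- a)) * exp r"
    proof (intro mult_mono)
      have "2 powr (- a) \<le> (1 + r) powr (- a)" using False a r by (intro powr_mono2') auto
      then show "1 \<le> 2 powr a * (1 + r) powr (- a)" by (simp add: powr_minus field_simps)
    qed (use C r in auto)
    then have "f 1 * 1 \<le> f 1 * (exp C * (2 powr a * (1 + r) powr (- a)) * exp r)"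
      using f1[of 1] by (intro mult_left_mono) auto
    ultimately show ?thesis unfolding K_def by (simp add: mult_ac)
  qed
  moreover have "- (real n - 1) / 2 = - a" unfolding a_def by (rule minus_divide_left[symmetric])
  ultimately show ?thesis unfolding f_def using K by auto
qed

declare add_2_eq_Suc' [simp]

section \<open>Integration\<close>

text \<open>Lets comparable positive numbers replace each other under an exponent of unknown sign;
  the two inequalities between x and y serve the two signs.\<close>

lemma powr_le_ratio:
  fixes x y K \<gamma> :: real
  assumes "0 < x" "0 < y" "x \<le> K * y" "y \<le> K * x"
  shows "x powr \<gamma> \<le> K powr \<bar>\<gamma>\<bar> * y powr \<gamma>"
proof -
  have K: "0 < K" using assms by (smt (verit) mult_nonpos_nonneg)
  show ?thesis
  proof (cases "0 \<le> \<gamma>")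
    case True
    then have "x powr \<gamma> \<le> (K * y) powr \<gamma>" using assms by (intro powr_mono2) auto
    then show ?thesis using True K assms by (simp add: powr_mult)
  next
    case False
    then have "x powr \<gamma> \<le> (y / K) powr \<gamma>"
      using assms K by (intro powr_mono2') (auto simp: field_simps)
    then show ?thesis using False K assms by (simp add: powr_divide powr_minus field_simps)
  qed
qed

text \<open>The exponential absorbs m + 2 powers with m \<ge> s, which leaves a multiple of 1 / (i +
  1)^2.\<close>

lemma summable_powr_exp:
  fixes s q :: real
  assumes "0 < q"
  shows "summable (\<lambda>i. (1 + real i) powr s * exp (- q * real i))"
proof -
  define m where "m = nat \<lceil>s\<rceil>"
  have "((\<lambda>y::real. y ^ (m + 2) / exp y) \<longlongrightarrow> 0) at_top" by (rule tendsto_power_div_exp_0)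
  moreover have "filterlim (\<lambda>i. q * (1 + real i)) at_top sequentially"
    using assms by (intro filterlim_tendsto_pos_mult_at_top[OF tendsto_const]
        filterlim_tendsto_add_at_top[OF tendsto_const] filterlim_real_sequentially) auto
  ultimately have "(\<lambda>i. (q * (1 + real i)) ^ (m + 2) / exp (q * (1 + real i))) \<longlonglongrightarrow> 0"
    by (rule filterlim_compose)
  then have ev: "\<forall>\<^sub>F i in sequentially. (q * (1 + real i)) ^ (m + 2) / exp (q * (1 + real i)) < 1"
    by (rule order_tendstoD) simp
  define K where "K = exp q / q ^ (m + 2)"
  have "summable (\<lambda>i. K * (1 / (real (Suc i))\<^sup>2))"
    using inverse_power_summable[of 2, where ?'a = real]
    by (intro summable_mult) (subst summable_Suc_iff, simp add: inverse_eq_divide)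
  moreover have "\<forall>\<^sub>F i in sequentially.
      norm ((1 + real i) powr s * exp (- q * real i)) \<le> K * (1 / (real (Suc i))\<^sup>2)"
    using ev
  proof eventually_elim
    case (elim i)
    have "(1 + real i) powr s \<le> (1 + real i) powr (real m)"
      by (intro powr_mono) (auto simp: m_def, linarith)
    also have "\<dots> = (1 + real i) ^ m" by (simp add: powr_realpow)
    finally have "(1 + real i) powr s * exp (- q * real i) \<le> (1 + real i) ^ m * exp (- q * real i)"
      by (intro mult_right_mono) auto
    also have e: "exp (- q * real i) = exp q / exp (q * (1 + real i))"
      by (simp add: exp_diff[symmetric] algebra_simps)
    also have "(1 + real i) ^ m * \<dots> = (K * (1 / (real (Suc i))\<^sup>2)) *
        ((q * (1 + real i)) ^ (m + 2) / exp (q * (1 + real i)))"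
    proof -
      have "(1 + real i) ^ m * (exp q / E) = exp q / (q ^ (m + 2)) * (1 / (1 + real i)\<^sup>2) *
          (q ^ (m + 2) * ((1 + real i) ^ m * (1 + real i)\<^sup>2) / E)" for E :: real
        using assms by simp
      then show ?thesis by (simp only: K_def power_mult_distrib power_add[of _ m 2, symmetric] of_nat_Suc add.commute)
    qed
    also have "\<dots> \<le> K * (1 / (real (Suc i))\<^sup>2)"
    proof -
      have "0 \<le> K * (1 / (real (Suc i))\<^sup>2)" using assms by (simp add: K_def)
      from mult_left_mono[OF less_imp_le[OF elim] this] show ?thesis by (simp only: mult_1_right)
    qed
    finally show ?case using e by simp
  qed
  ultimately show ?thesis by (rule summable_comparison_test_ev[rotated])
qed

lemma integrable_lebesgue_compact:
  fixes f :: "'a::euclidean_space \<Rightarrow> real"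
  assumes "compact S" "continuous_on S f"
  shows "integrable lebesgue (\<lambda>x. indicator S x * f x)"
proof -
  have "integrable lborel (\<lambda>x. indicator S x *\<^sub>R f x)" by (rule borel_integrable_compact[OF assms])
  then show ?thesis
    by (subst integrable_completion) (auto dest: borel_measurable_integrable)
qed

text \<open>The ball is cut into unit shells. Shell j has volume of order (1 + j)^(n - 1) and the
  weight is comparable on it to its value at j, so a sum of (1 + j) powr \<gamma> * exp (q j)
  remains, which is dominated by its last terms.\<close>

lemma integral_cball_weight_bound:
  fixes b q :: real
  assumes q: "0 < q"
  shows "\<exists>C>0. \<forall>\<rho>\<ge>0.
    (LINT x|lebesgue. indicator (cball 0 \<rho>) (x::'a::euclidean_space) *
      ((1 + norm x) powr (- b) * exp (q * norm x)))
    \<le> C * (1 + \<rho>) powr (real DIM('a) - 1 - b) * exp (q * \<rho>)"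
proof -
  define n where "n = DIM('a)"
  have n: "0 < n" by (simp add: n_def)
  define \<gamma> where "\<gamma> = real n - 1 - b"
  define S where "S = (\<Sum>i. (1 + real i) powr \<bar>\<gamma>\<bar> * exp (- q * real i))"
  define B where "B = 2 powr \<bar>b\<bar> * exp q * (unit_ball_vol n * real n)"
  define C where "C = (B + 1) * (S + 1) * 2 powr \<bar>\<gamma>\<bar>"
  note sm = summable_powr_exp[OF q, of "\<bar>\<gamma>\<bar>"]
  have S: "0 \<le> S" unfolding S_def by (intro suminf_nonneg sm) auto
  have B: "0 \<le> B" by (simp add: B_def)
  have "(LINT x|lebesgue. indicator (cball 0 \<rho>) (x::'a) * ((1 + norm x) powr (- b) * exp (q * norm x)))
      \<le> C * (1 + \<rho>) powr \<gamma> * exp (q * \<rho>)" if \<rho>: "0 \<le> \<rho>" for \<rho>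
  proof -
    define L where "L = nat \<lfloor>\<rho>\<rfloor>"
    have L: "real L \<le> \<rho>" "\<rho> < real L + 1"
      using \<rho> floor_correct[of \<rho>] by (auto simp: L_def)
    define M where "M j = 2 powr \<bar>b\<bar> * (1 + real j) powr (- b) * exp (q * (real j + 1))" for j :: nat
    define A where "A j = cball (0::'a) (real j + 1) - ball 0 (real j)" for j
    have Am: "A j \<in> sets lebesgue" "emeasure lebesgue (A j) < \<infinity>"
      "measure lebesgue (A j) = unit_ball_vol n * ((real j + 1) ^ n - real j ^ n)" for j
    proof -
      have fin: "emeasure lborel (cball (0::'a) r) < \<infinity>" for r by (rule emeasure_lborel_cball_finite)
      have s: "ball (0::'a) (real j) \<subseteq> cball 0 (real j + 1)" by auto
      show "A j \<in> sets lebesgue" by (simp add: A_def)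
      show "emeasure lebesgue (A j) < \<infinity>"
        by (rule le_less_trans[OF emeasure_mono[of _ "cball 0 (real j + 1)"]])
          (use fin in \<open>auto simp: A_def\<close>)
      have "measure lborel (A j) = measure lborel (cball (0::'a) (real j + 1)) - measure lborel (ball (0::'a) (real j))"
        unfolding A_def using s fin[of "real j + 1"] by (intro measure_Diff) auto
      then show "measure lebesgue (A j) = unit_ball_vol n * ((real j + 1) ^ n - real j ^ n)"
        using content_cball[of "real j + 1" "0::'a"] content_ball[of "real j" "0::'a"]
        by (simp add: n_def algebra_simps A_def)
    qed
    have pw: "(real j + 1) ^ n - real j ^ n \<le> real n * (1 + real j) powr (real n - 1)" for j
    proof -
      have "(real j + 1) ^ n - real j ^ n = (\<Sum>i<n. real j ^ (n - Suc i) * (real j + 1) ^ i)"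
        using power_diff_sumr2[of "real j + 1" n "real j"] by simp
      also have "\<dots> \<le> (\<Sum>i<n. (real j + 1) ^ (n - 1))"
      proof (rule sum_mono)
        fix i assume "i \<in> {..<n}"
        then have "n - Suc i + i = n - 1" by auto
        moreover have "real j ^ (n - Suc i) * (real j + 1) ^ i \<le> (real j + 1) ^ (n - Suc i) * (real j + 1) ^ i"
          by (intro mult_right_mono power_mono) auto
        ultimately show "real j ^ (n - Suc i) * (real j + 1) ^ i \<le> (real j + 1) ^ (n - 1)"
          by (metis power_add)
      qed
      also have "\<dots> = real n * (1 + real j) powr (real n - 1)"
        using n powr_realpow[of "1 + real j" "n - 1"] by (simp add: of_nat_diff add.commute)
      finally show ?thesis .
    qed
    have int: "integrable lebesgue (\<lambda>x. \<Sum>j\<le>L. M j * indicator (A j) x)"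
      using Am by (intro Bochner_Integration.integrable_sum integrable_mult_right) (auto simp: integrable_indicator_iff)
    have "(LINT x|lebesgue. indicator (cball 0 \<rho>) (x::'a) * ((1 + norm x) powr (- b) * exp (q * norm x)))
        \<le> (LINT x|lebesgue. (\<Sum>j\<le>L. M j * indicator (A j) x))"
    proof (rule integral_mono[OF _ int])
      show "integrable lebesgue (\<lambda>x. indicator (cball 0 \<rho>) (x::'a) * ((1 + norm x) powr (- b) * exp (q * norm x)))"
        by (intro integrable_lebesgue_compact continuous_intros) (auto simp: add_nonneg_eq_0_iff)
      fix x :: 'a
      have M0: "0 \<le> M j" for j by (simp add: M_def)
      show "indicator (cball 0 \<rho>) x * ((1 + norm x) powr (- b) * exp (q * norm x)) \<le> (\<Sum>j\<le>L. M j * indicator (A j) x)"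
      proof (cases "norm x \<le> \<rho>")
        case True
        define j where "j = nat \<lfloor>norm x\<rfloor>"
        have j: "real j \<le> norm x" "norm x < real j + 1"
          using floor_correct[of "norm x"] by (auto simp: j_def)
        have "j \<le> L" unfolding j_def L_def using True by (intro nat_mono floor_mono)
        have "(1 + norm x) powr (- b) \<le> 2 powr \<bar>- b\<bar> * (1 + real j) powr (- b)"
          using j by (intro powr_le_ratio) auto
        then have "(1 + norm x) powr (- b) * exp (q * norm x) \<le> M j"
          unfolding M_def using j q by (intro mult_mono) auto
        also have "\<dots> = M j * indicator (A j) x" using j by (simp add: A_def)
        also have "\<dots> \<le> (\<Sum>j\<le>L. M j * indicator (A j) x)"
          using \<open>j \<le> L\<close> M0 by (intro member_le_sum[of j "{..L}"]) auto
        finally show ?thesis using True by simp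
      next
        case False
        then show ?thesis using M0 by (auto intro!: sum_nonneg)
      qed
    qed
    also have "\<dots> = (\<Sum>j\<le>L. M j * measure lebesgue (A j))"
      using Am by (subst Bochner_Integration.integral_sum) (auto simp: integrable_indicator_iff)
    also have "\<dots> \<le> (\<Sum>j\<le>L. B * ((1 + real j) powr \<gamma> * exp (q * real j)))"
    proof (rule sum_mono)
      fix j
      have "M j * measure lebesgue (A j) \<le> M j * (unit_ball_vol n * (real n * (1 + real j) powr (real n - 1)))"
        unfolding Am(3) using pw[of j] by (intro mult_left_mono) (auto simp: M_def)
      also have "\<dots> = B * (((1 + real j) powr (- b) * (1 + real j) powr (real n - 1)) * exp (q * real j))"
        by (simp add: M_def B_def distrib_left exp_add mult_ac)
      also have "(1 + real j) powr (- b) * (1 + real j) powr (real n - 1) = (1 + real j) powr \<gamma>"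
        by (simp add: powr_add[symmetric] \<gamma>_def)
      finally show "M j * measure lebesgue (A j) \<le> B * ((1 + real j) powr \<gamma> * exp (q * real j))" .
    qed
    \<comment> \<open>Shells are counted from the outside: from 1 + L \<le> (1 + (L - j)) (1 + j),
      replacing j by L in the power costs only a power of 1 + (L - j), and exp (- q (L - j)) makes
      the sum bounded uniformly in L.\<close>
    also have "\<dots> \<le> (\<Sum>j\<le>L. B * ((1 + real L) powr \<gamma> * exp (q * real L) *
        ((1 + real (L - j)) powr \<bar>\<gamma>\<bar> * exp (- q * real (L - j)))))"
    proof (intro sum_mono mult_left_mono B)
      fix j assume "j \<in> {..L}"
      then have j: "j \<le> L" by simp
      have "0 \<le> real j * real (L - j)" by simp
      then have "1 + real L \<le> (1 + real (L - j)) * (1 + real j)" using j by (simp add: of_nat_diff algebra_simps)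
      moreover have "1 * (1 + real j) \<le> (1 + real (L - j)) * (1 + real L)" using j by (intro mult_mono) auto
      ultimately have "(1 + real j) powr \<gamma> \<le> (1 + real (L - j)) powr \<bar>\<gamma>\<bar> * (1 + real L) powr \<gamma>"
        by (intro powr_le_ratio) auto
      moreover have "exp (q * real j) = exp (q * real L) * exp (- q * real (L - j))"
        using j by (simp add: exp_add[symmetric] of_nat_diff algebra_simps)
      ultimately show "(1 + real j) powr \<gamma> * exp (q * real j) \<le> (1 + real L) powr \<gamma> * exp (q * real L) *
          ((1 + real (L - j)) powr \<bar>\<gamma>\<bar> * exp (- q * real (L - j)))"
        using mult_right_mono[of "(1 + real j) powr \<gamma>" _ "exp (q * real j)"] by (simp add: mult_ac)
    qed
    also have "\<dots> = B * ((1 + real L) powr \<gamma> * exp (q * real L)) *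
        (\<Sum>j\<le>L. (1 + real (L - j)) powr \<bar>\<gamma>\<bar> * exp (- q * real (L - j)))"
      by (simp add: sum_distrib_left mult_ac)
    also have "(\<Sum>j\<le>L. (1 + real (L - j)) powr \<bar>\<gamma>\<bar> * exp (- q * real (L - j))) =
        (\<Sum>i\<le>L. (1 + real i) powr \<bar>\<gamma>\<bar> * exp (- q * real i))"
      by (rule sum.reindex_bij_witness[of _ "\<lambda>i. L - i" "\<lambda>i. L - i"]) auto
    also have "\<dots> \<le> S" unfolding S_def by (intro sum_le_suminf sm) auto
    also have "(1 + real L) powr \<gamma> \<le> 2 powr \<bar>\<gamma>\<bar> * (1 + \<rho>) powr \<gamma>"
      using L \<rho> by (intro powr_le_ratio) auto
    also have "exp (q * real L) \<le> exp (q * \<rho>)" using L q by simp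
    finally have "(LINT x|lebesgue. indicator (cball 0 \<rho>) (x::'a) * ((1 + norm x) powr (- b) * exp (q * norm x)))
        \<le> B * (2 powr \<bar>\<gamma>\<bar> * (1 + \<rho>) powr \<gamma> * exp (q * \<rho>)) * S"
      using B S by (simp add: mult_left_mono mult_right_mono)
    also have "\<dots> = B * S * (2 powr \<bar>\<gamma>\<bar> * (1 + \<rho>) powr \<gamma> * exp (q * \<rho>))" by (simp add: mult_ac)
    also have "\<dots> \<le> ((B + 1) * (S + 1)) * (2 powr \<bar>\<gamma>\<bar> * (1 + \<rho>) powr \<gamma> * exp (q * \<rho>))"
      using B S by (intro mult_right_mono mult_mono) auto
    finally show ?thesis by (simp add: C_def mult_ac)
  qed
  moreover have "0 < C" using B S by (simp add: C_def)
  ultimately show ?thesis unfolding \<gamma>_def n_def by blast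
qed

text \<open>The decay of the eigenfunction enters as b = (n - 1) q / 2, which turns the exponent n -
  1 - b into (n - 1) (1 - q / 2).\<close>

lemma integral_cball_radial_eig_bound:
  fixes q :: real
  assumes q: "0 < q"
  shows "\<exists>C>0. \<forall>\<rho>\<ge>0.
    (LINT x|lebesgue. indicator (cball 0 \<rho>) (x::'a::euclidean_space) *
      radial_eig DIM('a) ((norm x)\<^sup>2) powr q)
    \<le> C * (1 + \<rho>) powr ((real DIM('a) - 1) * (1 - q / 2)) * exp (q * \<rho>)"
proof -
  define n where "n = DIM('a)"
  have n: "0 < n" by (simp add: n_def)
  define a where "a = - (real n - 1) / 2"
  obtain C1 where C1: "0 < C1"
    "\<And>r. 0 \<le> r \<Longrightarrow> radial_eig n (r\<^sup>2) \<le> C1 * (1 + r) powr a * exp r"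
    using radial_eig_upper_bound[OF n] unfolding a_def by blast
  define b where "b = - a * q"
  obtain C2 where C2: "0 < C2" "\<And>\<rho>. 0 \<le> \<rho> \<Longrightarrow>
    (LINT x|lebesgue. indicator (cball 0 \<rho>) (x::'a) * ((1 + norm x) powr (- b) * exp (q * norm x)))
    \<le> C2 * (1 + \<rho>) powr (real n - 1 - b) * exp (q * \<rho>)"
    using integral_cball_weight_bound[OF q, of b, where ?'a = 'a] unfolding n_def by blast
  have cont: "continuous_on S (\<lambda>x::'a. radial_eig n ((norm x)\<^sup>2) powr q)" for S
  proof -
    have c: "continuous_on S (\<lambda>x::'a. radial_eig n ((norm x)\<^sup>2))"
      by (rule continuous_on_compose2[OF smooth_imp_continuous_on[OF smooth_radial_eig[OF n], of UNIV]])
        (auto intro!: continuous_intros)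
    have "radial_eig n ((norm x)\<^sup>2) \<noteq> 0" for x :: 'a
      using radial_eig_ge_1[OF n, of "(norm x)\<^sup>2"] by auto
    then show ?thesis by (intro continuous_on_powr c continuous_on_const) auto
  qed
  have "(LINT x|lebesgue. indicator (cball 0 \<rho>) (x::'a) * radial_eig n ((norm x)\<^sup>2) powr q)
    \<le> (C1 powr q * C2) * (1 + \<rho>) powr ((real n - 1) * (1 - q / 2)) * exp (q * \<rho>)" if \<rho>: "0 \<le> \<rho>" for \<rho>
  proof -
    have "(LINT x|lebesgue. indicator (cball 0 \<rho>) (x::'a) * radial_eig n ((norm x)\<^sup>2) powr q) \<le>
      (LINT x|lebesgue. C1 powr q * (indicator (cball 0 \<rho>) (x::'a) * ((1 + norm x) powr (- b) * exp (q * norm x))))"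
    proof (rule integral_mono)
      show "integrable lebesgue (\<lambda>x. indicator (cball 0 \<rho>) (x::'a) * radial_eig n ((norm x)\<^sup>2) powr q)"
        by (intro integrable_lebesgue_compact cont) auto
      show "integrable lebesgue (\<lambda>x. C1 powr q * (indicator (cball 0 \<rho>) (x::'a) * ((1 + norm x) powr (- b) * exp (q * norm x))))"
        by (intro integrable_mult_right integrable_lebesgue_compact continuous_intros) (auto simp: add_nonneg_eq_0_iff)
      fix x :: 'a
      have "radial_eig n ((norm x)\<^sup>2) powr q \<le> (C1 * (1 + norm x) powr a * exp (norm x)) powr q"
        using C1(2)[of "norm x"] radial_eig_ge_1[OF n, of "(norm x)\<^sup>2"] q by (intro powr_mono2) auto
      also have "\<dots> = C1 powr q * ((1 + norm x) powr (- b) * exp (q * norm x))"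
        using C1(1) by (simp add: powr_mult powr_powr b_def exp_powr_real mult_ac)
      finally show "indicator (cball 0 \<rho>) x * radial_eig n ((norm x)\<^sup>2) powr q
          \<le> C1 powr q * (indicator (cball 0 \<rho>) x * ((1 + norm x) powr (- b) * exp (q * norm x)))"
        by (simp add: indicator_def)
    qed
    also have "\<dots> = C1 powr q * (LINT x|lebesgue. indicator (cball 0 \<rho>) (x::'a) * ((1 + norm x) powr (- b) * exp (q * norm x)))"
      by simp
    also have "\<dots> \<le> C1 powr q * (C2 * (1 + \<rho>) powr (real n - 1 - b) * exp (q * \<rho>))"
      by (intro mult_left_mono C2(2) \<rho>) simp
    also have "real n - 1 - b = (real n - 1) * (1 - q / 2)" by (simp add: b_def a_def field_simps)
    finally show ?thesis by (simp add: mult_ac)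
  qed
  moreover have "0 < C1 powr q * C2" using C1 C2 by simp
  ultimately show ?thesis unfolding n_def by blast
qed

text \<open>The Hoelder inequality up to the factor 2 powr (- p), from a weighted Young inequality:
  f g is at most l |f|^p or at most l^(- 1 / (p - 1)) |g|^q, according to whether |g| or l |f|^(p -
  1) is the larger. The weight l is chosen so that the g term contributes at most F / 2.\<close>

lemma power_integral_lower_bound:
  fixes f g :: "'a \<Rightarrow> real"
  assumes p: "1 < p" and f: "integrable M (\<lambda>x. \<bar>f x\<bar> powr p)"
    and g: "integrable M (\<lambda>x. \<bar>g x\<bar> powr (p / (p - 1)))" "(LINT x|M. \<bar>g x\<bar> powr (p / (p - 1))) \<le> Y" "0 < Y"
    and fg: "integrable M (\<lambda>x. f x * g x)" "0 < F" "F \<le> (LINT x|M. f x * g x)"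
  shows "(F / 2) powr p * Y powr (1 - p) \<le> (LINT x|M. \<bar>f x\<bar> powr p)"
proof -
  define l where "l = (F / (2 * Y)) powr (1 - p)"
  define q where "q = p / (p - 1)"
  define X where "X = (LINT x|M. \<bar>f x\<bar> powr p)"
  have l: "0 < l" "l powr (- 1 / (p - 1)) = F / (2 * Y)"
  proof -
    show "0 < l" using fg g by (simp add: l_def)
    have "(1 - p) * (- 1 / (p - 1)) = 1" using p by (simp add: field_simps)
    then show "l powr (- 1 / (p - 1)) = F / (2 * Y)" using fg g by (simp add: l_def powr_powr)
  qed
  have pt: "f x * g x \<le> l * \<bar>f x\<bar> powr p + l powr (- 1 / (p - 1)) * \<bar>g x\<bar> powr q" for x
  proof (cases "\<bar>g x\<bar> \<le> l * \<bar>f x\<bar> powr (p - 1)")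
    case True
    have "f x * g x \<le> \<bar>f x\<bar> * \<bar>g x\<bar>" by (simp add: abs_mult[symmetric])
    also have "\<dots> \<le> \<bar>f x\<bar> * (l * \<bar>f x\<bar> powr (p - 1))" using True by (intro mult_left_mono) auto
    also have "\<dots> = l * \<bar>f x\<bar> powr p" by (simp add: powr_mult_base)
    finally show ?thesis by (simp add: add_increasing2)
  next
    case False
    have "\<bar>f x\<bar> = (\<bar>f x\<bar> powr (p - 1)) powr (1 / (p - 1))" using p by (simp add: powr_powr)
    also have "\<dots> \<le> (\<bar>g x\<bar> / l) powr (1 / (p - 1))"
      using False p l(1) by (intro powr_mono2) (auto simp: field_simps)
    also have "\<dots> = l powr (- 1 / (p - 1)) * \<bar>g x\<bar> powr (1 / (p - 1))"
      using l(1) by (simp add: powr_divide powr_minus field_simps)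
    finally have f: "\<bar>f x\<bar> \<le> l powr (- 1 / (p - 1)) * \<bar>g x\<bar> powr (1 / (p - 1))" .
    have "f x * g x \<le> \<bar>f x\<bar> * \<bar>g x\<bar>" by (simp add: abs_mult[symmetric])
    also have "\<dots> \<le> (l powr (- 1 / (p - 1)) * \<bar>g x\<bar> powr (1 / (p - 1))) * \<bar>g x\<bar>"
      by (intro mult_right_mono f) simp
    also have "\<dots> = l powr (- 1 / (p - 1)) * \<bar>g x\<bar> powr (1 + 1 / (p - 1))"
      by (simp add: powr_mult_base[symmetric] mult_ac)
    also have "1 + 1 / (p - 1) = q" using p by (simp add: q_def field_simps)
    finally show ?thesis using l(1) by (simp add: add_increasing)
  qed
  have "F \<le> (LINT x|M. l * \<bar>f x\<bar> powr p + l powr (- 1 / (p - 1)) * \<bar>g x\<bar> powr q)"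
    using f g fg pt unfolding q_def by (intro order.trans[OF fg(3) integral_mono]) auto
  also have "\<dots> = l * X + F / (2 * Y) * (LINT x|M. \<bar>g x\<bar> powr q)"
    using f g unfolding q_def X_def l(2)[symmetric] by (subst Bochner_Integration.integral_add) auto
  also have "\<dots> \<le> l * X + F / (2 * Y) * Y"
    using g fg unfolding q_def by (intro add_left_mono mult_left_mono) auto
  finally have "F / 2 \<le> l * X" using g(3) by simp
  then have "F / 2 / l \<le> X" using l(1) by (simp add: field_simps)
  moreover have "F / 2 / l = (F / 2) powr p * Y powr (1 - p)"
  proof -
    have "l = inverse ((F / 2 / Y) powr (p - 1))"
      using powr_minus[of "F / 2 / Y" "p - 1"] by (simp add: l_def)
    then have "F / 2 / l = F / 2 * (F / 2 / Y) powr (p - 1)"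
      by (metis divide_inverse inverse_inverse_eq)
    also have "(F / 2 / Y) powr (p - 1) = (F / 2) powr (p - 1) * inverse (Y powr (p - 1))"
      unfolding divide_inverse[of "(F / 2) powr (p - 1)", symmetric]
      by (intro powr_divide; use fg(2) g(3) in simp)
    also have "inverse (Y powr (p - 1)) = Y powr (1 - p)"
      using powr_minus[of Y "p - 1"] by simp
    also have "F / 2 * ((F / 2) powr (p - 1) * Y powr (1 - p)) = F / 2 * (F / 2) powr (p - 1) * Y powr (1 - p)"
      by simp
    also have "F / 2 * (F / 2) powr (p - 1) = (F / 2) powr p"
      using fg(2) powr_mult_base[of "F / 2" "p - 1"] by simp
    finally show ?thesis .
  qed
  ultimately show ?thesis by (simp add: X_def)
qed

text \<open>The complement of the support is a union of possibly uncountably many open sets on which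
  f vanishes almost everywhere; the Lindeloef property leaves countably many of them.\<close>

lemma AE_zero_outside_ess_support:
  fixes f :: "'a::euclidean_space \<Rightarrow> real"
  shows "AE x in lebesgue. x \<notin> ess_support f \<longrightarrow> f x = 0"
proof -
  define \<U> where "\<U> = {U. open U \<and> (AE x in lebesgue. x \<in> U \<longrightarrow> f x = 0)}"
  obtain \<V> where \<V>: "\<V> \<subseteq> \<U>" "countable \<V>" "\<Union>\<V> = \<Union>\<U>"
    by (rule Lindelof[of \<U>]) (auto simp: \<U>_def)
  have "AE x in lebesgue. \<forall>U\<in>\<V>. x \<in> U \<longrightarrow> f x = 0"
    using \<V> by (intro AE_ball_countable') (auto simp: \<U>_def)
  then show ?thesis
  proof eventually_elim
    case (elim x)
    then show ?case using \<V>(3) by (auto simp: ess_support_def \<U>_def)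
  qed
qed

lemma AE_zero_outside:
  assumes "ess_support f \<subseteq> S"
  shows "AE x in lebesgue. x \<notin> S \<longrightarrow> f x = 0"
  using AE_zero_outside_ess_support[of f] by eventually_elim (use assms in auto)

section \<open>Pairings of square-integrable functions, and slices of functions on a product\<close>

lemma in_L2_integrable_mult:
  fixes f g :: "'a::euclidean_space \<Rightarrow> real"
  assumes "in_L2 f" "in_L2 g"
  shows "integrable lebesgue (\<lambda>x. f x * g x)"
proof (rule Bochner_Integration.integrable_bound)
  show "integrable lebesgue (\<lambda>x. (norm (f x))\<^sup>2 + (norm (g x))\<^sup>2)"
    using assms by (auto simp: in_L2_def)
  show "(\<lambda>x. f x * g x) \<in> borel_measurable lebesgue" using assms by (auto simp: in_L2_def)
  have "\<bar>a * b\<bar> \<le> a\<^sup>2 + b\<^sup>2" for a b :: real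
  proof -
    have "2 * (\<bar>a\<bar> * \<bar>b\<bar>) \<le> a\<^sup>2 + b\<^sup>2"
      using sum_squares_bound[of "\<bar>a\<bar>" "\<bar>b\<bar>"] by (simp add: mult.assoc)
    moreover have "0 \<le> \<bar>a\<bar> * \<bar>b\<bar>" by simp
    ultimately show ?thesis unfolding abs_mult by linarith
  qed
  then show "AE x in lebesgue. norm (f x * g x) \<le> norm ((norm (f x))\<^sup>2 + (norm (g x))\<^sup>2)" by simp
qed

lemma L2_Cauchy_Schwarz:
  fixes f g :: "'a::euclidean_space \<Rightarrow> real"
  assumes f: "in_L2 f" and g: "in_L2 g"
  shows "\<bar>LINT x|lebesgue. f x * g x\<bar> \<le> L2_norm f * L2_norm g"
proof -
  define A where "A = (LINT x|lebesgue. (f x)\<^sup>2)"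
  define B where "B = (LINT x|lebesgue. (g x)\<^sup>2)"
  define C where "C = (LINT x|lebesgue. f x * g x)"
  have i: "integrable lebesgue (\<lambda>x. (f x)\<^sup>2)" "integrable lebesgue (\<lambda>x. (g x)\<^sup>2)"
    using f g by (auto simp: in_L2_def)
  have AB: "0 \<le> A" "0 \<le> B" by (auto simp: A_def B_def)
  have q: "0 \<le> A + 2 * t * C + t\<^sup>2 * B" for t
  proof -
    have "0 \<le> (LINT x|lebesgue. (f x + t * g x)\<^sup>2)" by simp
    also have "(\<lambda>x. (f x + t * g x)\<^sup>2) = (\<lambda>x. (f x)\<^sup>2 + 2 * t * (f x * g x) + t\<^sup>2 * (g x)\<^sup>2)"
      by (auto simp: power2_eq_square algebra_simps)
    also have "(LINT x|lebesgue. (f x)\<^sup>2 + 2 * t * (f x * g x) + t\<^sup>2 * (g x)\<^sup>2) = A + 2 * t * C + t\<^sup>2 * B"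
      unfolding A_def B_def C_def using i in_L2_integrable_mult[OF f g] by simp
    finally show ?thesis .
  qed
  have "C\<^sup>2 \<le> A * B"
  proof (cases "B = 0")
    case True
    \<comment> \<open>With B = 0 the quadratic is linear in t, and at t = - (A + 1) / (2 C) it would
      have the value - 1.\<close>
    then have "C = 0" using q[of "- (A + 1) / (2 * C)"] by (cases "C = 0") (auto simp: field_simps)
    then show ?thesis using True by simp
  next
    case False
    then show ?thesis using q[of "- C / B"] AB by (simp add: field_simps power2_eq_square)
  qed
  then have "sqrt (C\<^sup>2) \<le> sqrt (A * B)" by (rule real_sqrt_le_mono)
  then show ?thesis by (simp add: C_def A_def B_def L2_norm_def real_sqrt_mult)
qed

text \<open>Lebesgue measure on the product is only the completion of a product measure. So f is
  replaced by a Borel function g equal to it almost everywhere, Fubini is applied to g, and for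
  almost every s the slices of f and g agree almost everywhere.\<close>

lemma integrable_lebesgue_fst:
  fixes f :: "'a::euclidean_space \<times> 'b::euclidean_space \<Rightarrow> real"
  assumes f: "integrable lebesgue f"
  shows "AE s in lebesgue. integrable lebesgue (\<lambda>x. f (s, x))"
    and "integrable lebesgue (\<lambda>s. LINT x|lebesgue. f (s, x))"
proof -
  obtain g where g: "g \<in> borel_measurable lborel" "AE z in lborel. f z = g z"
    using completion_ex_borel_measurable_real[of f lborel] f by blast
  have "g \<in> borel_measurable lebesgue" using g(1) by (rule measurable_completion)
  from integrable_cong_AE_imp[OF f this AE_completion[OF g(2)]]
  have "integrable lebesgue g" .
  then have "integrable lborel g" using g(1) integrable_completion by blast
  then have gi: "integrable (lborel \<Otimes>\<^sub>M lborel) g" by (simp add: lborel_prod)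
  have ae1: "AE s in lborel. integrable lborel (\<lambda>x. g (s, x))"
    by (rule lborel_pair.AE_integrable_fst'[OF gi])
  have "AE z in lborel \<Otimes>\<^sub>M lborel. f z = g z" unfolding lborel_prod by (rule g(2))
  then have "AE s in lborel. AE x in lborel. f (s, x) = g (s, x)"
    by (rule lborel_pair.AE_pair)
  then have ae2: "AE s in lborel. AE x in lebesgue. f (s, x) = g (s, x)"
    by eventually_elim (rule AE_completion)
  have gm: "(\<lambda>x. g (s, x)) \<in> borel_measurable lborel" for s
    using gi by (intro measurable_Pair2[of g lborel lborel]) auto
  have ae: "AE s in lborel. integrable lebesgue (\<lambda>x. f (s, x)) \<and>
      (LINT x|lebesgue. f (s, x)) = (LINT x|lborel. g (s, x))"
    using ae1 ae2
  proof eventually_elim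
    case (elim s)
    have gl: "integrable lebesgue (\<lambda>x. g (s, x))" using elim(1) gm integrable_completion by blast
    have fm: "(\<lambda>x. f (s, x)) \<in> borel_measurable lebesgue"
      by (rule borel_measurable_AE[of "\<lambda>x. g (s, x)"]) (use gl elim(2) in auto)
    have "(LINT x|lebesgue. f (s, x)) = (LINT x|lebesgue. g (s, x))"
      by (rule integral_cong_AE[OF fm _ elim(2)]) (use gl in auto)
    also have "\<dots> = (LINT x|lborel. g (s, x))" by (rule integral_completion[OF gm])
    finally have "(LINT x|lebesgue. f (s, x)) = (LINT x|lborel. g (s, x))" .
    moreover have "AE x in lebesgue. g (s, x) = f (s, x)" using elim(2) by eventually_elim simp
    ultimately show ?case using integrable_cong_AE_imp[OF gl fm] by blast
  qed
  then have "AE s in lborel. integrable lebesgue (\<lambda>x. f (s, x))" by eventually_elim simp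
  then show "AE s in lebesgue. integrable lebesgue (\<lambda>x. f (s, x))" by (rule AE_completion)
  have G: "integrable lborel (\<lambda>s. LINT x|lborel. g (s, x))" by (rule lborel_pair.integrable_fst'[OF gi])
  then have G: "integrable lebesgue (\<lambda>s. LINT x|lborel. g (s, x))"
    using integrable_completion[of "\<lambda>s. LINT x|lborel. g (s, x)" lborel] by auto
  have "AE s in lebesgue. (LINT x|lebesgue. f (s, x)) = (LINT x|lborel. g (s, x))"
    using AE_completion[OF ae] by eventually_elim simp
  then have "AE s in lebesgue. (LINT x|lborel. g (s, x)) = (LINT x|lebesgue. f (s, x))"
    by eventually_elim simp
  then show "integrable lebesgue (\<lambda>s. LINT x|lebesgue. f (s, x))"
    using G by (intro integrable_cong_AE_imp[OF G]
        borel_measurable_AE[OF borel_measurable_integrable[OF G]])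
qed

section \<open>Testing the equation with radial functions\<close>

lemma A_k_eq:
  assumes "k < 1" "1 \<le> t"
  shows "A_k k t = (t powr (1 - k) - 1) / (1 - k)"
proof -
  have "((\<lambda>\<tau>. \<tau> powr (- k)) has_integral t powr (1 - k) / (1 - k) - 1 powr (1 - k) / (1 - k)) {1..t}"
  proof (rule fundamental_theorem_of_calculus)
    fix x assume "x \<in> {1..t}"
    then have "DERIV (\<lambda>\<tau>. \<tau> powr (1 - k) / (1 - k)) x :> x powr (- k)"
      using assms by (auto intro!: derivative_eq_intros)
    then show "((\<lambda>\<tau>. \<tau> powr (1 - k) / (1 - k)) has_vector_derivative x powr (- k)) (at x within {1..t})"
      by (simp add: has_real_derivative_iff_has_vector_derivative has_vector_derivative_at_within)
  qed (use assms in auto)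
  then show ?thesis by (simp add: A_k_def integral_unique diff_divide_distrib)
qed

lemma A_k_mono:
  assumes "k < 1" "1 \<le> s" "s \<le> t"
  shows "0 \<le> A_k k s" "A_k k s \<le> A_k k t"
proof -
  have "1 powr (1 - k) \<le> s powr (1 - k)" using assms by (intro powr_mono2) auto
  then show "0 \<le> A_k k s" using assms by (simp add: A_k_eq)
  have "s powr (1 - k) \<le> t powr (1 - k)" using assms by (intro powr_mono2) auto
  then show "A_k k s \<le> A_k k t" using assms by (simp add: A_k_eq divide_right_mono)
qed

lemma in_L2_continuous:
  fixes w :: "'a::euclidean_space \<Rightarrow> 'b::euclidean_space"
  assumes "continuous_on UNIV w" "\<And>x. r < norm x \<Longrightarrow> w x = 0"
  shows "in_L2 w"
proof -
  have "integrable lebesgue (\<lambda>x. indicator (cball 0 r) x * (norm (w x))\<^sup>2)"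
    by (intro integrable_lebesgue_compact continuous_intros continuous_on_subset[OF assms(1)]) auto
  moreover have "(\<lambda>x. indicator (cball 0 r) x * (norm (w x))\<^sup>2) = (\<lambda>x. (norm (w x))\<^sup>2)"
    using assms(2) by (auto simp: fun_eq_iff indicator_def not_le)
  moreover have "w \<in> borel_measurable lebesgue"
    using borel_measurable_continuous_onI[OF assms(1)] by (simp add: measurable_completion)
  ultimately show ?thesis by (simp add: in_L2_def)
qed

lemma in_L2_norm: "in_L2 f \<Longrightarrow> in_L2 (\<lambda>x. norm (f x))"
  by (auto simp: in_L2_def)

lemma in_L2_cmult: "in_L2 f \<Longrightarrow> in_L2 (\<lambda>x. c * f x :: real)"
  by (auto simp: in_L2_def power_mult_distrib)

lemma in_L2_diff:
  fixes f g :: "'a::euclidean_space \<Rightarrow> real"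
  assumes "in_L2 f" "in_L2 g"
  shows "in_L2 (\<lambda>x. f x - g x)"
proof -
  have "integrable lebesgue (\<lambda>x. (f x)\<^sup>2 - 2 * (f x * g x) + (g x)\<^sup>2)"
    using assms in_L2_integrable_mult[OF assms] by (auto simp: in_L2_def)
  then show ?thesis using assms by (auto simp: in_L2_def power2_diff algebra_simps)
qed

lemma in_L2_integrable_scaleR:
  fixes f :: "'a::euclidean_space \<Rightarrow> real" and g :: "'a \<Rightarrow> 'b::euclidean_space"
  assumes "in_L2 f" "in_L2 g"
  shows "integrable lebesgue (\<lambda>x. f x *\<^sub>R g x)"
proof (rule Bochner_Integration.integrable_bound)
  show "integrable lebesgue (\<lambda>x. norm (f x) * norm (g x))"
    by (intro in_L2_integrable_mult in_L2_norm assms)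
  show "(\<lambda>x. f x *\<^sub>R g x) \<in> borel_measurable lebesgue" using assms by (auto simp: in_L2_def)
qed simp

lemma DERIV_zero_beyond:
  fixes G :: "real \<Rightarrow> real"
  assumes "\<And>z. DERIV G z :> G' z" "\<And>z. c \<le> z \<Longrightarrow> G z = 0" "c < z"
  shows "G' z = 0"
proof -
  have "DERIV G z :> 0"
    by (rule has_field_derivative_transform_within_open[of "\<lambda>_. 0" _ _ "{c<..}"]) (use assms in auto)
  then show ?thesis using assms(1) DERIV_unique by blast
qed

lemma compact_support_cball:
  assumes "\<And>x. r < norm x \<Longrightarrow> f x = 0"
  shows "compact (closure {x::'a::euclidean_space. f x \<noteq> 0})"
proof -
  have "{x. f x \<noteq> 0} \<subseteq> cball 0 r"
  proof
    fix x assume "x \<in> {x. f x \<noteq> 0}"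
    then show "x \<in> cball 0 r" using assms[of x] by (cases "r < norm x") auto
  qed
  then show ?thesis using bounded_subset compact_closure bounded_cball by blast
qed

lemma GDERIV_radial:
  assumes "DERIV G ((norm x)\<^sup>2) :> d"
  shows "GDERIV (\<lambda>x. G ((norm x)\<^sup>2)) x :> (2 * d) *\<^sub>R x"
proof -
  have "GDERIV (\<lambda>x. (norm x)\<^sup>2) x :> 2 *\<^sub>R x"
    unfolding gderiv_def power2_norm_eq_inner
    by (auto intro!: derivative_eq_intros simp: inner_commute)
  from GDERIV_DERIV_compose[OF this assms] show ?thesis by (simp add: mult.commute)
qed

text \<open>The Laplacian of x \<mapsto> G (|x|^2) in dimension n, at a point with |x|^2 =
  z.\<close>

definition radial_laplacian :: "nat \<Rightarrow> (real \<Rightarrow> real) \<Rightarrow> real \<Rightarrow> real" where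
  "radial_laplacian n G z = 2 * real n * deriv G z + 4 * z * deriv (deriv G) z"

text \<open>Integration by parts, coordinate by coordinate: the weak gradient is tested with \<phi>
  i, the i-th partial derivative of G (|x|^2), only the i-th component of the resulting vector
  identity is kept, and the sum over i produces the Laplacian.\<close>

lemma weak_grad_radial:
  fixes v :: "'a::euclidean_space \<Rightarrow> real"
  assumes v: "in_H1 v" and G: "smooth G" "\<And>z. r\<^sup>2 \<le> z \<Longrightarrow> G z = 0" "0 < r"
  shows "(LINT x|lebesgue. weak_grad v x \<bullet> grad (\<lambda>y. G ((norm y)\<^sup>2)) x) =
    - (LINT x|lebesgue. v x * radial_laplacian DIM('a) G ((norm x)\<^sup>2))"
proof -
  obtain G' where G': "\<And>z. DERIV G z :> G' z" "smooth G'" using smooth_real_deriv[OF G(1)] by blast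
  obtain G'' where G'': "\<And>z. DERIV G' z :> G'' z" "smooth G''" using smooth_real_deriv[OF G'(2)] by blast
  have dG1: "deriv G = G'" using DERIV_imp_deriv[OF G'(1)] by (rule ext)
  have dG2: "deriv G' = G''" using DERIV_imp_deriv[OF G''(1)] by (rule ext)
  note dG = dG1 dG2
  define w where "w = weak_grad v"
  have "\<exists>g. in_L2 g \<and> is_weak_gradient v g" using v by (simp add: in_H1_def)
  from someI_ex[OF this] have w: "in_L2 w" "is_weak_gradient v w"
    unfolding w_def weak_grad_def by blast+
  have v2: "in_L2 v" using v by (simp add: in_H1_def)
  define \<phi> where "\<phi> i x = 2 * G' ((norm x)\<^sup>2) * (x \<bullet> i)" for i x :: 'a
  define D where "D i x = (2 * G' ((norm x)\<^sup>2)) *\<^sub>R i + (4 * G'' ((norm x)\<^sup>2) * (x \<bullet> i)) *\<^sub>R x" for i x :: 'a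
  have G'0: "G' ((norm x)\<^sup>2) = 0" if "r < norm x" for x :: 'a
    using that G(3) by (intro DERIV_zero_beyond[OF G'(1) G(2)]) (auto intro: power_strict_mono)
  \<comment> \<open>\<open>DERIV_zero_beyond\<close> yields zeros of a derivative only strictly
    beyond the point from which the function vanishes; the second application therefore starts from
    the larger radius r + 1.\<close>
  have G''0: "G'' ((norm x)\<^sup>2) = 0" if "r + 1 < norm x" for x :: 'a
  proof (rule DERIV_zero_beyond[of G' G'' "(r + 1)\<^sup>2"])
    show "G' z = 0" if "(r + 1)\<^sup>2 \<le> z" for z
    proof (rule DERIV_zero_beyond[OF G'(1) G(2)])
      have "r\<^sup>2 < (r + 1)\<^sup>2" using G(3) by (intro power_strict_mono) auto
      then show "r\<^sup>2 < z" using that by simp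
    qed
    show "(r + 1)\<^sup>2 < (norm x)\<^sup>2" using that G(3) by (intro power_strict_mono) auto
  qed (rule G'')
  have c: "continuous_on UNIV (\<lambda>x::'a. h ((norm x)\<^sup>2))" if "smooth h" for h :: "real \<Rightarrow> real"
    by (rule continuous_on_compose2[OF smooth_imp_continuous_on[OF that, of UNIV]])
      (auto intro!: continuous_intros)
  have gd: "GDERIV (\<phi> i) x :> D i x" for i x
  proof -
    have "GDERIV (\<lambda>x. x \<bullet> i) x :> i" unfolding gderiv_def by (auto intro!: derivative_eq_intros)
    from GDERIV_mult[OF GDERIV_radial[OF DERIV_cmult[OF G''(1), of 2]] this]
    show ?thesis by (simp add: \<phi>_def[abs_def] D_def mult_ac)
  qed
  have test: "test_function UNIV (\<phi> i)" for i
  proof -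
    have "smooth (\<lambda>x::'a. x \<bullet> i)" by (simp add: smooth_def Ck_inner)
    then have "smooth (\<phi> i)"
      unfolding \<phi>_def[abs_def]
      by (intro smooth_mult smooth_const smooth_compose[OF G'(2)] smooth_norm_square)
    moreover have "compact (closure {x. \<phi> i x \<noteq> 0})"
      by (rule compact_support_cball[of r]) (simp add: \<phi>_def G'0)
    ultimately show ?thesis by (simp add: test_function_def)
  qed
  have D2: "in_L2 (D i)" for i
  proof (rule in_L2_continuous[where r = "r + 1"])
    show "continuous_on UNIV (D i)"
      unfolding D_def by (intro continuous_intros c G' G'')
    show "D i x = 0" if "r + 1 < norm x" for x using that by (simp add: D_def G'0 G''0)
  qed
  have \<phi>2: "in_L2 (\<phi> i)" for i
  proof (rule in_L2_continuous[where r = r])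
    show "continuous_on UNIV (\<phi> i)" unfolding \<phi>_def by (intro continuous_intros c G')
  qed (simp add: \<phi>_def G'0)
  have 1: "(LINT x|lebesgue. v x * (D i x \<bullet> i)) = - (LINT x|lebesgue. \<phi> i x * (w x \<bullet> i))" for i
  proof -
    have "(LINT x|lebesgue. v x *\<^sub>R D i x) = - (LINT x|lebesgue. \<phi> i x *\<^sub>R w x)"
    proof -
      have "grad (\<phi> i) = D i" using grad_eq[OF gd] by (rule ext)
      then show ?thesis using w(2) test[of i] unfolding is_weak_gradient_def by auto
    qed
    then have "(LINT x|lebesgue. v x *\<^sub>R D i x) \<bullet> i = - ((LINT x|lebesgue. \<phi> i x *\<^sub>R w x) \<bullet> i)"
      by (simp add: inner_minus_left)
    then show ?thesis
      using integral_inner_left[of i lebesgue "\<lambda>x. v x *\<^sub>R D i x"] integral_inner_left[of i lebesgue "\<lambda>x. \<phi> i x *\<^sub>R w x"]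
        in_L2_integrable_scaleR[OF v2 D2[of i]] in_L2_integrable_scaleR[OF \<phi>2[of i] w(1)] by simp
  qed
  have gradG: "grad (\<lambda>y. G ((norm y)\<^sup>2)) x = (2 * G' ((norm x)\<^sup>2)) *\<^sub>R x" for x :: 'a
    by (intro grad_eq GDERIV_radial G')
  have "(LINT x|lebesgue. w x \<bullet> grad (\<lambda>y. G ((norm y)\<^sup>2)) x) =
      (LINT x|lebesgue. (\<Sum>i\<in>Basis. \<phi> i x * (w x \<bullet> i)))"
  proof (rule Bochner_Integration.integral_cong[OF refl])
    fix x :: 'a
    have "w x \<bullet> grad (\<lambda>y. G ((norm y)\<^sup>2)) x = 2 * G' ((norm x)\<^sup>2) * (\<Sum>i\<in>Basis. (w x \<bullet> i) * (x \<bullet> i))"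
      unfolding gradG euclidean_inner[of "w x" x, symmetric] by simp
    also have "\<dots> = (\<Sum>i\<in>Basis. \<phi> i x * (w x \<bullet> i))"
      unfolding sum_distrib_left by (intro sum.cong) (simp_all add: \<phi>_def)
    finally show "w x \<bullet> grad (\<lambda>y. G ((norm y)\<^sup>2)) x = (\<Sum>i\<in>Basis. \<phi> i x * (w x \<bullet> i))" .
  qed
  also have "\<dots> = (\<Sum>i\<in>Basis. LINT x|lebesgue. \<phi> i x * (w x \<bullet> i))"
  proof (rule Bochner_Integration.integral_sum)
    show "integrable lebesgue (\<lambda>x. \<phi> i x * (w x \<bullet> i))" for i
      using integrable_inner_left[OF in_L2_integrable_scaleR[OF \<phi>2[of i] w(1)], of i] by simp
  qed
  also have "\<dots> = - (\<Sum>i\<in>Basis. LINT x|lebesgue. v x * (D i x \<bullet> i))"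
    unfolding 1 by (simp add: sum_negf)
  also have "(\<Sum>i\<in>Basis. LINT x|lebesgue. v x * (D i x \<bullet> i)) =
      (LINT x|lebesgue. (\<Sum>i\<in>Basis. v x * (D i x \<bullet> i)))"
  proof (rule Bochner_Integration.integral_sum[symmetric])
    show "integrable lebesgue (\<lambda>x. v x * (D i x \<bullet> i))" for i
      using integrable_inner_left[OF in_L2_integrable_scaleR[OF v2 D2[of i]], of i] by simp
  qed
  also have "(\<lambda>x. \<Sum>i\<in>Basis. v x * (D i x \<bullet> i)) =
      (\<lambda>x. v x * radial_laplacian DIM('a) G ((norm x)\<^sup>2))"
  proof
    fix x :: 'a
    have "(\<Sum>i\<in>Basis. D i x \<bullet> i) = (\<Sum>i::'a\<in>Basis. 2 * G' ((norm x)\<^sup>2)) +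
        (\<Sum>i\<in>Basis. 4 * G'' ((norm x)\<^sup>2) * ((x \<bullet> i) * (x \<bullet> i)))"
      unfolding sum.distrib[symmetric] by (intro sum.cong) (auto simp: D_def inner_add_left)
    also have "\<dots> = radial_laplacian DIM('a) G ((norm x)\<^sup>2)"
      unfolding sum_distrib_left[symmetric] euclidean_inner[symmetric] radial_laplacian_def dG
      by (simp add: power2_norm_eq_inner)
    finally show "(\<Sum>i\<in>Basis. v x * (D i x \<bullet> i)) = v x * radial_laplacian DIM('a) G ((norm x)\<^sup>2)"
      by (simp add: sum_distrib_left[symmetric])
  qed
  finally show ?thesis by (simp add: w_def)
qed

section \<open>The weak formulation tested with radial functions\<close>

locale supported_solution =
  fixes k \<mu> p R \<epsilon> :: real and u0 u1 :: "'a::euclidean_space \<Rightarrow> real"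
    and T :: ereal and u :: "real \<Rightarrow> 'a \<Rightarrow> real"
  assumes k: "0 \<le> k" "k < 1" and mu: "0 \<le> \<mu>" and p: "1 < p" and R: "0 < R" and eps: "0 < \<epsilon>"
    and u0_support: "ess_support u0 \<subseteq> cball 0 R" and u1_support: "ess_support u1 \<subseteq> cball 0 R"
    and u0_L2: "in_L2 u0" and u1_L2: "in_L2 u1"
    and u0_nonneg: "AE x in lebesgue. 0 \<le> u0 x" and u1_nonneg: "AE x in lebesgue. 0 \<le> u1 x"
    and sol: "energy_solution k \<mu> p \<epsilon> u0 u1 T u"
    and support: "\<And>t. 1 < t \<Longrightarrow> ereal t < T \<Longrightarrow> ess_support (u t) \<subseteq> cball 0 (A_k k t + R)"
begin

abbreviation "I \<equiv> time_interval T"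
abbreviation "ut \<equiv> dt I u"

lemma H1: "t \<in> I \<Longrightarrow> in_H1 (u t)"
  and L2: "t \<in> I \<Longrightarrow> in_L2 (u t)"
  and L2_deriv: "t \<in> I \<Longrightarrow> has_L2_derivative I u t (ut t)"
  and Lp: "in_Lp_loc p (I \<times> UNIV) (\<lambda>(t, x). u t x)"
  and initial: "AE x in lebesgue. u 1 x = \<epsilon> * u0 x"
  and T_gt_1: "1 < T"
proof -
  note s = sol[unfolded energy_solution_def Let_def]
  show "t \<in> I \<Longrightarrow> in_H1 (u t)" using s by (auto simp: C_H1_def)
  show "t \<in> I \<Longrightarrow> in_L2 (u t)" using s by (auto simp: C1_L2_def)
  show "has_L2_derivative I u t (ut t)" if "t \<in> I"
  proof -
    have "\<exists>w. has_L2_derivative I u t w" using s that by (auto simp: C1_L2_def)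
    then show ?thesis unfolding dt_def by (rule someI_ex)
  qed
  show "in_Lp_loc p (I \<times> UNIV) (\<lambda>(t, x). u t x)" using s by blast
  show "AE x in lebesgue. u 1 x = \<epsilon> * u0 x" using s by blast
  show "1 < T" using s by blast
qed

text \<open>The support assumption of the locale starts after time 1. At time 1 the support of u0
  takes over, as A_k k 1 = 0.\<close>

lemma AE_support:
  assumes "1 \<le> t" "ereal t < T"
  shows "AE x in lebesgue. x \<notin> cball 0 (A_k k t + R) \<longrightarrow> u t x = 0"
proof (cases "t = 1")
  case True
  have "A_k k 1 = 0" using k by (simp add: A_k_eq)
  then show ?thesis using AE_zero_outside[OF u0_support] initial unfolding True
    by (auto elim: AE_mp)
next
  case False
  then show ?thesis using support assms by (intro AE_zero_outside) auto
qed

lemma test_identity: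
  assumes G: "smooth G" "\<And>z. r\<^sup>2 \<le> z \<Longrightarrow> G z = 0" "0 < r" and t: "1 < t" "ereal t < T"
  shows "t powr \<mu> * (LINT x|lebesgue. ut t x * G ((norm x)\<^sup>2)) =
    \<epsilon> * (LINT x|lebesgue. u1 x * G ((norm x)\<^sup>2))
    + (LINT s:{1..t}|lebesgue. s powr (\<mu> - 2 * k) *
        (LINT x|lebesgue. u s x * radial_laplacian DIM('a) G ((norm x)\<^sup>2)))
    + (LINT s:{1..t}|lebesgue. s powr \<mu> * (LINT x|lebesgue. \<bar>u s x\<bar> powr p * G ((norm x)\<^sup>2)))"
proof -
  \<comment> \<open>Room between t and T in which the time factor can go down to 0, so that the test
    function is supported before T; T may be infinite.\<close>
  obtain t2 where t2: "ereal t < ereal t2" "ereal t2 < T"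
  proof -
    obtain z where "ereal t < z" "z < T" using dense[OF t(2)] by blast
    then show ?thesis using that by (cases z) auto
  qed
  then have "t < t2" by simp
  from smooth_powr_cutoff_exists[OF t(1) this, of \<mu>] obtain \<zeta> where \<zeta>: "smooth \<zeta>"
    "\<forall>x. x < 1/2 \<or> t2 < x \<longrightarrow> \<zeta> x = 0"
    "\<forall>x\<in>{1..t}. \<zeta> x = x powr \<mu> \<and> DERIV \<zeta> x :> \<mu> * x powr (\<mu> - 1)" by blast
  define \<phi> where "\<phi> x = G ((norm x)\<^sup>2)" for x :: 'a
  define \<psi> where "\<psi> z = \<zeta> (fst z) * \<phi> (snd z)" for z :: "real \<times> 'a"
  have "test_function {z. ereal (fst z) < T} \<psi>"
  proof -
    have "Ck m (\<lambda>z :: real \<times> 'a. \<zeta> (z \<bullet> (1, 0)))" for m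
      using Ck_compose[OF _ Ck_inner] \<zeta>(1) unfolding smooth_def by blast
    moreover have "Ck m (\<lambda>z :: real \<times> 'a. \<phi> (snd z))" for m
      unfolding \<phi>_def using smooth_compose[OF G(1) smooth_norm_square, where ?'a = 'a]
      by (intro Ck_snd) (simp add: smooth_def)
    ultimately have "smooth \<psi>" unfolding smooth_def \<psi>_def by (auto intro!: Ck_mult simp: inner_prod_def)
    moreover have sub: "{z. \<psi> z \<noteq> 0} \<subseteq> {1/2..t2} \<times> cball 0 r"
    proof
      fix z :: "real \<times> 'a" assume z: "z \<in> {z. \<psi> z \<noteq> 0}"
      then have "norm (snd z) \<le> r"
        using G(2)[of "(norm (snd z))\<^sup>2"] G(3) power_mono[of r "norm (snd z)" 2]
        by (cases "r \<le> norm (snd z)") (auto simp: \<psi>_def \<phi>_def)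
      moreover have "1/2 \<le> fst z" "fst z \<le> t2" using z \<zeta>(2) by (auto simp: \<psi>_def not_less[symmetric])
      ultimately show "z \<in> {1/2..t2} \<times> cball 0 r" by (cases z) auto
    qed
    have cl: "closure {z. \<psi> z \<noteq> 0} \<subseteq> {1/2..t2} \<times> cball 0 r"
      by (rule closure_minimal[OF sub]) (intro closed_Times closed_atLeastAtMost closed_cball)
    moreover have "compact ({1/2..t2} \<times> cball (0::'a) r)" by (intro compact_Times) auto
    ultimately have "compact (closure {z. \<psi> z \<noteq> 0})"
      using compact_Int_closed[of "{1/2..t2} \<times> cball (0::'a) r" "closure {z. \<psi> z \<noteq> 0}"]
      by (simp add: inf.absorb2)
    moreover have "closure {z. \<psi> z \<noteq> 0} \<subseteq> {z. ereal (fst z) < T}"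
    proof
      fix z assume "z \<in> closure {z. \<psi> z \<noteq> 0}"
      then have "ereal (fst z) \<le> ereal t2" using cl by auto
      also have "\<dots> < T" by (rule t2(2))
      finally show "z \<in> {z. ereal (fst z) < T}" by simp
    qed
    ultimately show ?thesis using \<open>smooth \<psi>\<close> by (simp add: test_function_def)
  qed
  with sol[unfolded energy_solution_def Let_def] t have id:
    "(LINT x|lebesgue. ut t x * \<psi> (t, x))
      - \<epsilon> * (LINT x|lebesgue. u1 x * \<psi> (1, x))
      - (LINT s:{1..t}|lebesgue. LINT x|lebesgue. ut s x * deriv (\<lambda>r. \<psi> (r, x)) s)
      + (LINT s:{1..t}|lebesgue. LINT x|lebesgue.
           s powr (- 2 * k) * (weak_grad (u s) x \<bullet> grad (\<lambda>y. \<psi> (s, y)) x))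
      + (LINT s:{1..t}|lebesgue. LINT x|lebesgue. \<mu> / s * ut s x * \<psi> (s, x))
      = (LINT s:{1..t}|lebesgue. LINT x|lebesgue. \<bar>u s x\<bar> powr p * \<psi> (s, x))" by blast
  have \<psi>: "\<psi> (s, x) = s powr \<mu> * \<phi> x" if "s \<in> {1..t}" for s x
    using \<zeta>(3) that by (simp add: \<psi>_def)
  have d\<psi>: "deriv (\<lambda>r. \<psi> (r, x)) s = \<mu> * s powr (\<mu> - 1) * \<phi> x" if "s \<in> {1..t}" for s x
    unfolding \<psi>_def fst_conv snd_conv
    by (intro DERIV_imp_deriv DERIV_cmult_right) (use \<zeta>(3) that in blast)
  have t1: "(LINT x|lebesgue. ut t x * \<psi> (t, x)) = t powr \<mu> * (LINT x|lebesgue. ut t x * \<phi> x)"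
    using t by (simp add: \<psi> mult.left_commute)
  have t2: "(LINT x|lebesgue. u1 x * \<psi> (1, x)) = (LINT x|lebesgue. u1 x * \<phi> x)"
    using t by (simp add: \<psi>)
  have t3: "(LINT s:{1..t}|lebesgue. LINT x|lebesgue. ut s x * deriv (\<lambda>r. \<psi> (r, x)) s) =
      (LINT s:{1..t}|lebesgue. \<mu> * s powr (\<mu> - 1) * (LINT x|lebesgue. ut s x * \<phi> x))"
  proof (intro set_lebesgue_integral_cong allI impI)
    fix s assume s: "s \<in> {1..t}"
    have "(LINT x|lebesgue. ut s x * deriv (\<lambda>r. \<psi> (r, x)) s) =
        (LINT x|lebesgue. (\<mu> * s powr (\<mu> - 1)) * (ut s x * \<phi> x))"
      by (simp add: d\<psi>[OF s] mult_ac)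
    then show "(LINT x|lebesgue. ut s x * deriv (\<lambda>r. \<psi> (r, x)) s) =
        \<mu> * s powr (\<mu> - 1) * (LINT x|lebesgue. ut s x * \<phi> x)" by simp
  qed simp
  \<comment> \<open>The same integral as in \<open>t3\<close>, because
    \<open>\<mu> / s * s powr \<mu>\<close> is the derivative of \<open>s powr \<mu>\<close>; the
    two terms enter with opposite signs and cancel.\<close>
  have t5: "(LINT s:{1..t}|lebesgue. LINT x|lebesgue. \<mu> / s * ut s x * \<psi> (s, x)) =
      (LINT s:{1..t}|lebesgue. \<mu> * s powr (\<mu> - 1) * (LINT x|lebesgue. ut s x * \<phi> x))"
  proof (intro set_lebesgue_integral_cong allI impI)
    fix s assume s: "s \<in> {1..t}"
    have "(LINT x|lebesgue. \<mu> / s * ut s x * \<psi> (s, x)) =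
        (LINT x|lebesgue. (\<mu> / s * s powr \<mu>) * (ut s x * \<phi> x))"
      by (simp add: \<psi>[OF s] mult_ac)
    also have "\<mu> / s * s powr \<mu> = \<mu> * s powr (\<mu> - 1)" using s by (simp add: powr_diff)
    finally show "(LINT x|lebesgue. \<mu> / s * ut s x * \<psi> (s, x)) =
        \<mu> * s powr (\<mu> - 1) * (LINT x|lebesgue. ut s x * \<phi> x)" by simp
  qed simp
  have t4: "(LINT s:{1..t}|lebesgue. LINT x|lebesgue.
           s powr (- 2 * k) * (weak_grad (u s) x \<bullet> grad (\<lambda>y. \<psi> (s, y)) x)) =
      - (LINT s:{1..t}|lebesgue. s powr (\<mu> - 2 * k) *
        (LINT x|lebesgue. u s x * radial_laplacian DIM('a) G ((norm x)\<^sup>2)))"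
  proof -
    have "(LINT x|lebesgue. s powr (- 2 * k) * (weak_grad (u s) x \<bullet> grad (\<lambda>y. \<psi> (s, y)) x)) =
      - (s powr (\<mu> - 2 * k) * (LINT x|lebesgue. u s x * radial_laplacian DIM('a) G ((norm x)\<^sup>2)))"
      if s: "s \<in> {1..t}" for s
    proof -
      have sI: "s \<in> I" using s t by (auto simp: time_interval_def intro: le_less_trans[of _ "ereal t"])
      obtain G' where G': "\<And>z. DERIV G z :> G' z" using smooth_real_deriv[OF G(1)] by blast
      have g\<phi>: "GDERIV \<phi> x :> grad \<phi> x" for x
        unfolding \<phi>_def[abs_def] grad_eq[OF GDERIV_radial[OF G']] by (rule GDERIV_radial[OF G'])
      have "GDERIV (\<lambda>y. s powr \<mu> * \<phi> y) x :> s powr \<mu> *\<^sub>R grad \<phi> x" for x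
        using GDERIV_mult[OF GDERIV_const g\<phi>] by simp
      then have "grad (\<lambda>y. \<psi> (s, y)) x = s powr \<mu> *\<^sub>R grad \<phi> x" for x
        unfolding \<psi>[OF s] by (rule grad_eq)
      then have "(LINT x|lebesgue. s powr (- 2 * k) * (weak_grad (u s) x \<bullet> grad (\<lambda>y. \<psi> (s, y)) x)) =
          (s powr (- 2 * k) * s powr \<mu>) * (LINT x|lebesgue. weak_grad (u s) x \<bullet> grad \<phi> x)"
        by (simp add: mult.assoc)
      also have "s powr (- 2 * k) * s powr \<mu> = s powr (\<mu> - 2 * k)" by (simp add: powr_add[symmetric])
      also have "(LINT x|lebesgue. weak_grad (u s) x \<bullet> grad \<phi> x) =
          - (LINT x|lebesgue. u s x * radial_laplacian DIM('a) G ((norm x)\<^sup>2))"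
        unfolding \<phi>_def[abs_def] by (rule weak_grad_radial[OF H1[OF sI] G])
      finally show ?thesis by simp
    qed
    then have "(LINT s:{1..t}|lebesgue. LINT x|lebesgue.
           s powr (- 2 * k) * (weak_grad (u s) x \<bullet> grad (\<lambda>y. \<psi> (s, y)) x)) =
      (LINT s:{1..t}|lebesgue. - (s powr (\<mu> - 2 * k) *
        (LINT x|lebesgue. u s x * radial_laplacian DIM('a) G ((norm x)\<^sup>2))))"
      by (intro set_lebesgue_integral_cong) auto
    then show ?thesis by (simp add: set_lebesgue_integral_def)
  qed
  have t6: "(LINT s:{1..t}|lebesgue. LINT x|lebesgue. \<bar>u s x\<bar> powr p * \<psi> (s, x)) =
      (LINT s:{1..t}|lebesgue. s powr \<mu> * (LINT x|lebesgue. \<bar>u s x\<bar> powr p * \<phi> x))"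
    by (intro set_lebesgue_integral_cong) (simp_all add: \<psi> mult.left_commute)
  show ?thesis using id unfolding t1 t2 t3 t4 t5 t6 by (simp add: \<phi>_def)
qed

text \<open>The difference quotients converge in the square norm, and the Cauchy-Schwarz inequality
  passes this on to the pairing with h. The derivative is relative to \<open>I\<close>, hence
  one-sided at time 1.\<close>

lemma functional_deriv:
  assumes h: "in_L2 h" and t: "t \<in> I"
  shows "((\<lambda>s. LINT x|lebesgue. u s x * h x) has_real_derivative (LINT x|lebesgue. ut t x * h x)) (at t within I)"
proof -
  let ?F = "\<lambda>s. LINT x|lebesgue. u s x * h x"
  let ?q = "\<lambda>s x. (u s x - u t x) / (s - t) - ut t x"
  have ut2: "in_L2 (ut t)" using L2_deriv[OF t] by (simp add: has_L2_derivative_def)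
  have "((\<lambda>s. L2_norm (?q s) * L2_norm h) \<longlongrightarrow> 0 * L2_norm h) (at t within I)"
    using L2_deriv[OF t] by (intro tendsto_mult tendsto_const) (simp add: has_L2_derivative_def)
  then have lim: "((\<lambda>s. L2_norm (?q s) * L2_norm h) \<longlongrightarrow> 0) (at t within I)" by simp
  have "((\<lambda>s. (?F s - ?F t) / (s - t) - (LINT x|lebesgue. ut t x * h x)) \<longlongrightarrow> 0) (at t within I)"
  proof (rule Lim_null_comparison[OF _ lim])
    show "\<forall>\<^sub>F s in at t within I. norm ((?F s - ?F t) / (s - t) - (LINT x|lebesgue. ut t x * h x))
        \<le> L2_norm (?q s) * L2_norm h"
      unfolding eventually_at_filter
    proof (rule always_eventually, intro allI impI)
      fix s assume s: "s \<noteq> t" "s \<in> I"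
      have q2: "in_L2 (?q s)"
        using in_L2_diff[OF in_L2_cmult[OF in_L2_diff[OF L2[OF s(2)] L2[OF t]], of "1 / (s - t)"] ut2] by simp
      have i: "integrable lebesgue (\<lambda>x. u s x * h x)" "integrable lebesgue (\<lambda>x. u t x * h x)"
        "integrable lebesgue (\<lambda>x. ut t x * h x)"
        by (intro in_L2_integrable_mult h L2 s t ut2)+
      have "(LINT x|lebesgue. ?q s x * h x) =
          (LINT x|lebesgue. (u s x * h x - u t x * h x) / (s - t) - ut t x * h x)"
        by (intro Bochner_Integration.integral_cong) (auto simp: algebra_simps diff_divide_distrib)
      also have "\<dots> = (?F s - ?F t) / (s - t) - (LINT x|lebesgue. ut t x * h x)"
        using i by simp
      finally show "norm ((?F s - ?F t) / (s - t) - (LINT x|lebesgue. ut t x * h x))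
          \<le> L2_norm (?q s) * L2_norm h"
        using L2_Cauchy_Schwarz[OF q2 h] by simp
    qed
  qed
  then show ?thesis by (simp add: has_field_derivative_iff LIM_zero_iff)
qed

text \<open>[1, b] times a ball is compact and W is bounded on it, so local integrability applies.
  Integrability in space-time does not control an individual time slice, and Fubini speaks about
  almost every time only.\<close>

lemma power_integrable:
  fixes W :: "real \<times> 'a \<Rightarrow> real"
  assumes b: "ereal b < T" and W: "continuous_on ({1..b} \<times> cball 0 r) W"
  shows "AE s in lebesgue. s \<in> {1..b} \<longrightarrow>
      integrable lebesgue (\<lambda>x. indicator (cball 0 r) x * (\<bar>u s x\<bar> powr p * W (s, x)))"
    and "set_integrable lebesgue {1..b}
      (\<lambda>s. LINT x|lebesgue. indicator (cball 0 r) x * (\<bar>u s x\<bar> powr p * W (s, x)))"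
proof -
  define K where "K = {1..b} \<times> cball (0::'a) r"
  have K: "compact K" unfolding K_def by (intro compact_Times) auto
  have "K \<subseteq> I \<times> UNIV"
    using b by (auto simp: K_def time_interval_def intro: le_less_trans[of _ "ereal b"])
  then have 1: "set_integrable lebesgue K (\<lambda>z. \<bar>(\<lambda>(t, x). u t x) z\<bar> powr p)"
    using Lp K unfolding in_Lp_loc_def by blast
  have "set_integrable lebesgue K (\<lambda>z. W z * \<bar>(\<lambda>(t, x). u t x) z\<bar> powr p)"
  proof (rule absolutely_integrable_bounded_measurable_product[OF bilinear_times _ _ _ 1])
    have Km: "K \<in> sets borel" using K by (intro borel_compact)
    then show "K \<in> sets lebesgue" by simp
    show "W \<in> borel_measurable (lebesgue_on K)"
      using W Km unfolding K_def[symmetric] by (intro continuous_imp_measurable_on_sets_lebesgue) auto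
    show "bounded (W ` K)"
      using W K unfolding K_def[symmetric] by (intro compact_imp_bounded compact_continuous_image)
  qed
  then have i: "integrable lebesgue (\<lambda>z. indicator K z * (W z * \<bar>(\<lambda>(t, x). u t x) z\<bar> powr p))"
    by (simp add: set_integrable_def)
  have e: "(\<lambda>x. indicator K (s, x) * (W (s, x) * \<bar>(\<lambda>(t, x). u t x) (s, x)\<bar> powr p)) =
      (\<lambda>x. indicator {1..b} s * (indicator (cball 0 r) x * (\<bar>u s x\<bar> powr p * W (s, x))))" for s
    by (auto simp: K_def indicator_def fun_eq_iff)
  note F = integrable_lebesgue_fst[OF i, unfolded e]
  show "AE s in lebesgue. s \<in> {1..b} \<longrightarrow>
      integrable lebesgue (\<lambda>x. indicator (cball 0 r) x * (\<bar>u s x\<bar> powr p * W (s, x)))"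
    using F(1) by eventually_elim (auto simp: indicator_def)
  show "set_integrable lebesgue {1..b}
      (\<lambda>s. LINT x|lebesgue. indicator (cball 0 r) x * (\<bar>u s x\<bar> powr p * W (s, x)))"
    using F(2) by (simp add: set_integrable_def)
qed

end

section \<open>Removal of the cutoff and the equations for radial moments\<close>

lemma radial_laplacian_cong:
  assumes "open S" "z \<in> S" "\<And>z. z \<in> S \<Longrightarrow> G z = g z"
  shows "radial_laplacian n G z = radial_laplacian n g z"
proof -
  have e: "\<forall>\<^sub>F y in nhds z. G y = g y" using assms by (auto simp: eventually_nhds)
  then have "\<forall>\<^sub>F y in nhds z. \<forall>\<^sub>F w in nhds y. G w = g w" by (simp add: eventually_eventually)
  then have "\<forall>\<^sub>F y in nhds z. deriv G y = deriv g y"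
    by eventually_elim (rule deriv_cong_ev, auto)
  then show ?thesis unfolding radial_laplacian_def
    using deriv_cong_ev[OF e refl] deriv_cong_ev[of "deriv G" "deriv g" z z] by simp
qed

lemma continuous_on_radial_laplacian:
  assumes "smooth G"
  shows "continuous_on UNIV (radial_laplacian n G)"
proof -
  obtain G' where G': "\<And>z. DERIV G z :> G' z" "smooth G'" using smooth_real_deriv[OF assms] by blast
  obtain G'' where G'': "\<And>z. DERIV G' z :> G'' z" "smooth G''" using smooth_real_deriv[OF G'(2)] by blast
  have 1: "deriv G = G'" using DERIV_imp_deriv[OF G'(1)] by (rule ext)
  have 2: "deriv G' = G''" using DERIV_imp_deriv[OF G''(1)] by (rule ext)
  show ?thesis unfolding radial_laplacian_def 1 2
    by (intro continuous_intros smooth_imp_continuous_on G' G'')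
qed

lemma radial_laplacian_radial_eig:
  assumes "0 < n"
  shows "radial_laplacian n (radial_eig n) z = radial_eig n z"
proof -
  have 1: "deriv (radial_eig m) = (\<lambda>z. radial_eig (m + 2) z / (2 * real m))" if "0 < m" for m
    using DERIV_imp_deriv[OF radial_eig_deriv[OF that]] by (rule ext)
  have n2: "0 < n + 2" by simp
  have "DERIV (\<lambda>z. radial_eig (n + 2) z / (2 * real n)) z :>
      radial_eig (n + 2 + 2) z / (2 * real (n + 2)) / (2 * real n)"
    by (intro DERIV_cdivide radial_eig_deriv[OF n2])
  then have 2: "deriv (deriv (radial_eig n)) z = radial_eig (n + 4) z / (2 * real (n + 2)) / (2 * real n)"
    unfolding 1[OF assms] by (simp add: DERIV_imp_deriv numeral_eq_Suc)
  have "radial_laplacian n (radial_eig n) z = radial_eig (n + 2) z +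
      z * radial_eig (n + 4) z / (real n * (real n + 2))"
    unfolding radial_laplacian_def 2 unfolding 1[OF assms] using assms
    by (simp add: divide_simps del: add_2_eq_Suc') (simp add: algebra_simps del: add_2_eq_Suc')
  then show ?thesis using radial_eig_recurrence[OF assms, of z] by simp
qed

lemma continuous_on_radial:
  assumes "continuous_on UNIV h"
  shows "continuous_on A (\<lambda>x::'a::euclidean_space. h ((norm x)\<^sup>2) :: real)"
  by (rule continuous_on_compose2[OF assms]) (auto intro!: continuous_intros)

lemma borel_measurable_radial:
  assumes "continuous_on UNIV h"
  shows "(\<lambda>x::'a::euclidean_space. h ((norm x)\<^sup>2) :: real) \<in> borel_measurable lebesgue"
proof (rule measurable_completion)
  show "(\<lambda>x::'a. h ((norm x)\<^sup>2)) \<in> borel_measurable lborel"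
    using borel_measurable_continuous_onI[OF continuous_on_radial[OF assms]] by simp
qed

lemma lebesgue_integral_antideriv:
  fixes h :: "real \<Rightarrow> real"
  assumes h: "continuous_on {1..b} h"
  defines "J \<equiv> \<lambda>t. LINT s:{1..t}|lebesgue. h s"
  shows "\<And>t. 1 < t \<Longrightarrow> t < b \<Longrightarrow> DERIV J t :> h t" "continuous_on {1..b} J" "J 1 = 0"
proof -
  have J: "J t = integral {1..t} h" if "t \<le> b" for t
    unfolding J_def
    by (rule set_lebesgue_integral_eq_integral(2)[OF absolutely_integrable_continuous_real])
      (use that in \<open>auto intro: continuous_on_subset[OF h]\<close>)
  have D: "(J has_real_derivative h t) (at t within {1..b})" if "t \<in> {1..b}" for t
  proof (rule has_field_derivative_transform_within[OF _ zero_less_one that])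
    show "((\<lambda>t. integral {1..t} h) has_real_derivative h t) (at t within {1..b})"
      by (rule integral_has_real_derivative[OF h that])
  qed (simp add: J)
  then show "continuous_on {1..b} J" by (rule DERIV_continuous_on)
  show "DERIV J t :> h t" if t: "1 < t" "t < b" for t
    using D[of t] t at_within_interior[of t "{1..b}"] by simp
  have "J 1 = (LINT s|lebesgue. indicator {1} s *\<^sub>R h s)" by (simp add: J_def set_lebesgue_integral_def)
  also have "\<dots> = 0"
  proof (rule integral_eq_zero_AE)
    have "AE s in lebesgue. s \<noteq> (1::real)" by (rule AE_completion) (rule AE_lborel_singleton)
    then show "AE s in lebesgue. indicator {1} s *\<^sub>R h s = 0" by eventually_elim simp
  qed
  finally show "J 1 = 0" .
qed

lemma set_integral_increment_ge:
  fixes f :: "real \<Rightarrow> real"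
  assumes f: "set_integrable lebesgue {1..b} f" and st: "1 \<le> s" "s \<le> t" "t \<le> b"
    and m: "AE x in lebesgue. x \<in> {s..t} \<longrightarrow> m \<le> f x"
  shows "(t - s) * m \<le> (LINT x:{1..t}|lebesgue. f x) - (LINT x:{1..s}|lebesgue. f x)"
proof -
  have i: "set_integrable lebesgue {1..s} f" "set_integrable lebesgue {s<..t} f"
    by (rule set_integrable_subset[OF f]; use st in auto)+
  have c: "set_integrable lebesgue {s<..t} (\<lambda>x. m)"
    using st by (auto simp: set_integrable_def intro!: integrable_mult_left)
  have "(LINT x:{1..t}|lebesgue. f x) = (LINT x:{1..s} \<union> {s<..t}|lebesgue. f x)"
    using st by (intro arg_cong[where f = "\<lambda>A. LINT x:A|lebesgue. f x"]) auto
  also have "\<dots> = (LINT x:{1..s}|lebesgue. f x) + (LINT x:{s<..t}|lebesgue. f x)"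
    by (rule set_integral_Un[OF _ i]) auto
  finally have 1: "(LINT x:{1..t}|lebesgue. f x) - (LINT x:{1..s}|lebesgue. f x) = (LINT x:{s<..t}|lebesgue. f x)"
    by simp
  have "(t - s) * m = (LINT x:{s<..t}|lebesgue. m)"
    using st by (simp add: set_lebesgue_integral_def)
  also have "\<dots> \<le> (LINT x:{s<..t}|lebesgue. f x)"
    using m by (intro set_integral_mono_AE c i) (auto elim: AE_mp)
  finally show ?thesis unfolding 1 .
qed

context supported_solution
begin

text \<open>This removes the cutoffs: u t lives in the ball of radius A_k k t + R \<le> r and u1 in
  the ball of radius R, so the values of a weight at z > r^2 are invisible. Continuity of the
  weights makes the integrands measurable.\<close>

lemma integral_radial_cong:
  assumes b: "1 \<le> t" "t \<le> b" "ereal b < T" and r: "A_k k b + R \<le> r"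
    and h: "continuous_on UNIV h1" "continuous_on UNIV h2" "\<And>z. 0 \<le> z \<Longrightarrow> z \<le> r\<^sup>2 \<Longrightarrow> h1 z = h2 z"
  shows "(LINT x|lebesgue. u t x * h1 ((norm x)\<^sup>2)) = (LINT x|lebesgue. u t x * h2 ((norm x)\<^sup>2))"
    and "(LINT x|lebesgue. \<bar>u t x\<bar> powr p * h1 ((norm x)\<^sup>2)) = (LINT x|lebesgue. \<bar>u t x\<bar> powr p * h2 ((norm x)\<^sup>2))"
    and "(LINT x|lebesgue. u1 x * h1 ((norm x)\<^sup>2)) = (LINT x|lebesgue. u1 x * h2 ((norm x)\<^sup>2))"
proof -
  have tT: "ereal t < T" using b by (auto intro: le_less_trans[of _ "ereal b"])
  have um: "u t \<in> borel_measurable lebesgue"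
    using L2[of t] b tT by (simp add: time_interval_def in_L2_def)
  have u1m: "u1 \<in> borel_measurable lebesgue" using u1_L2 by (simp add: in_L2_def)
  note [measurable] = um u1m borel_measurable_radial[OF h(1)] borel_measurable_radial[OF h(2)]
  have A: "0 \<le> A_k k t" "A_k k t \<le> A_k k b" using A_k_mono[OF k(2) b(1,2)] by auto
  have h12: "h1 ((norm x)\<^sup>2) = h2 ((norm x)\<^sup>2)" if "norm x \<le> r" for x :: 'a
    using that by (intro h(3) power_mono) auto
  have ae: "AE x in lebesgue. u t x = 0 \<or> h1 ((norm x)\<^sup>2) = h2 ((norm x)\<^sup>2)"
    using AE_support[OF b(1) tT]
  proof eventually_elim
    case (elim x)
    then show ?case using h12[of x] A r by (cases "x \<in> cball 0 (A_k k t + R)") auto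
  qed
  have ae1: "AE x in lebesgue. u1 x = 0 \<or> h1 ((norm x)\<^sup>2) = h2 ((norm x)\<^sup>2)"
    using AE_zero_outside[OF u1_support]
  proof eventually_elim
    case (elim x)
    then show ?case using h12[of x] A r by (cases "x \<in> cball 0 R") auto
  qed
  show "(LINT x|lebesgue. u t x * h1 ((norm x)\<^sup>2)) = (LINT x|lebesgue. u t x * h2 ((norm x)\<^sup>2))"
    by (rule integral_cong_AE, measurable) (use ae in \<open>eventually_elim, auto\<close>)
  show "(LINT x|lebesgue. \<bar>u t x\<bar> powr p * h1 ((norm x)\<^sup>2)) = (LINT x|lebesgue. \<bar>u t x\<bar> powr p * h2 ((norm x)\<^sup>2))"
    by (rule integral_cong_AE, measurable) (use ae in \<open>eventually_elim, auto\<close>)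
  show "(LINT x|lebesgue. u1 x * h1 ((norm x)\<^sup>2)) = (LINT x|lebesgue. u1 x * h2 ((norm x)\<^sup>2))"
    by (rule integral_cong_AE, measurable) (use ae1 in \<open>eventually_elim, auto\<close>)
qed

text \<open>The parameter \<open>lam\<close> lets one argument cover both weights: it is 1 for
  \<open>radial_eig\<close> and 0 for the constant 1. The weight g need not have compact support, so
  a truncation G of it is tested.\<close>

lemma radial_moment_ode:
  assumes b: "1 < b" "ereal b < T" and g: "smooth g"
    and eig: "\<And>z. 0 \<le> z \<Longrightarrow> radial_laplacian DIM('a) g z = lam * g z"
  defines "F \<equiv> \<lambda>t. LINT x|lebesgue. u t x * g ((norm x)\<^sup>2)"
    and "N \<equiv> \<lambda>t. t powr \<mu> * (LINT x|lebesgue. \<bar>u t x\<bar> powr p * g ((norm x)\<^sup>2))"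
  shows "\<exists>F'. \<forall>t. 1 < t \<and> t < b \<longrightarrow> DERIV F t :> F' t \<and>
      t powr \<mu> * F' t = \<epsilon> * (LINT x|lebesgue. u1 x * g ((norm x)\<^sup>2))
        + (LINT s:{1..t}|lebesgue. s powr (\<mu> - 2 * k) * (lam * F s)) + (LINT s:{1..t}|lebesgue. N s)"
    and "continuous_on {1..b} F"
    and "set_integrable lebesgue {1..b} N"
proof -
  define r where "r = A_k k b + R"
  have r: "0 < r" using A_k_mono[OF k(2), of b b] b R by (simp add: r_def)
  \<comment> \<open>The cutoff is 1 up to (r + 1)^2 and not merely up to r^2: the Laplacians of G
    and g must agree at z = r^2 too, which requires agreement of G and g on an open set.\<close>
  have "(r + 1)\<^sup>2 < (r + 2)\<^sup>2" using r by (intro power_strict_mono) auto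
  from smooth_cutoff_exists[OF this] obtain \<kappa> where \<kappa>: "smooth \<kappa>"
    "\<forall>x\<le>(r + 1)\<^sup>2. \<kappa> x = 1" "\<forall>x\<ge>(r + 2)\<^sup>2. \<kappa> x = 0" by blast
  define G where "G z = \<kappa> z * g z" for z
  have G: "smooth G" "\<And>z. (r + 2)\<^sup>2 \<le> z \<Longrightarrow> G z = 0" "0 < r + 2"
    using smooth_mult[OF \<kappa>(1) g] \<kappa>(3) r by (auto simp: G_def[abs_def])
  have Gg: "G z = g z" if "z < (r + 1)\<^sup>2" for z using \<kappa>(2) that by (simp add: G_def)
  have rr: "z < (r + 1)\<^sup>2" if "z \<le> r\<^sup>2" for z
    using that r power_strict_mono[of r "r + 1" 2] by simp
  have cG: "continuous_on UNIV G" "continuous_on UNIV g"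
    by (rule smooth_imp_continuous_on[OF G(1)], rule smooth_imp_continuous_on[OF g])
  have cL: "continuous_on UNIV (radial_laplacian DIM('a) G)"
    by (rule continuous_on_radial_laplacian[OF G(1)])
  have Lap: "radial_laplacian DIM('a) G z = lam * g z" if "0 \<le> z" "z \<le> r\<^sup>2" for z
    using radial_laplacian_cong[of "{..<(r + 1)\<^sup>2}" z G g "DIM('a)"] Gg rr[OF that(2)] eig[OF that(1)] by simp
  have G2: "in_L2 (\<lambda>x::'a. G ((norm x)\<^sup>2))"
  proof (rule in_L2_continuous[OF continuous_on_radial[OF cG(1)]])
    show "G ((norm x)\<^sup>2) = 0" if "r + 2 < norm x" for x :: 'a
      using that r by (intro G(2) power_mono) auto
  qed
  define FG where "FG t = (LINT x|lebesgue. u t x * G ((norm x)\<^sup>2))" for t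
  have F: "F t = FG t" if "t \<in> {1..b}" for t
    unfolding F_def FG_def
    by (rule integral_radial_cong(1)[of t b r]) (use that b cG Gg rr in \<open>auto simp: r_def\<close>)
  have sub: "{1..b} \<subseteq> I" using b by (auto simp: time_interval_def intro: le_less_trans[of _ "ereal b"])
  have DFG: "(FG has_real_derivative (LINT x|lebesgue. ut t x * G ((norm x)\<^sup>2))) (at t within I)"
    if "t \<in> {1..b}" for t
    unfolding FG_def using functional_deriv[OF G2] that sub by blast
  have "continuous_on {1..b} FG"
    by (rule DERIV_continuous_on[OF DERIV_subset[OF DFG sub]])
  then show "continuous_on {1..b} F" using F by (subst continuous_on_cong[OF refl F]) auto
  have id: "DERIV F t :> (LINT x|lebesgue. ut t x * G ((norm x)\<^sup>2)) \<and>
      t powr \<mu> * (LINT x|lebesgue. ut t x * G ((norm x)\<^sup>2)) =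
        \<epsilon> * (LINT x|lebesgue. u1 x * g ((norm x)\<^sup>2))
        + (LINT s:{1..t}|lebesgue. s powr (\<mu> - 2 * k) * (lam * F s)) + (LINT s:{1..t}|lebesgue. N s)"
    if t: "1 < t" "t < b" for t
  proof
    have "at t within I = at t"
      by (rule at_within_open_subset[of t "{1<..<b}"]) (use t sub in auto)
    then have "DERIV FG t :> (LINT x|lebesgue. ut t x * G ((norm x)\<^sup>2))" using DFG[of t] t by simp
    then show "DERIV F t :> (LINT x|lebesgue. ut t x * G ((norm x)\<^sup>2))"
      by (rule has_field_derivative_transform_within_open[of _ _ _ "{1<..<b}"]) (use t F in auto)
    have tT: "ereal t < T" using t b by (auto intro: less_trans[of _ "ereal b"])
    have 1: "(LINT x|lebesgue. u1 x * G ((norm x)\<^sup>2)) = (LINT x|lebesgue. u1 x * g ((norm x)\<^sup>2))"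
      by (rule integral_radial_cong(3)[of t b r]) (use t b cG Gg rr in \<open>auto simp: r_def\<close>)
    have 2: "(LINT s:{1..t}|lebesgue. s powr (\<mu> - 2 * k) *
        (LINT x|lebesgue. u s x * radial_laplacian DIM('a) G ((norm x)\<^sup>2))) =
        (LINT s:{1..t}|lebesgue. s powr (\<mu> - 2 * k) * (lam * F s))"
    proof (intro set_lebesgue_integral_cong allI impI)
      fix s assume s: "s \<in> {1..t}"
      have "(LINT x|lebesgue. u s x * radial_laplacian DIM('a) G ((norm x)\<^sup>2)) =
          (LINT x|lebesgue. u s x * (lam * g ((norm x)\<^sup>2)))"
        by (rule integral_radial_cong(1)[of s b r "radial_laplacian DIM('a) G" "\<lambda>z. lam * g z"])
          (use s t b cL cG Lap in \<open>auto simp: r_def intro!: continuous_intros\<close>)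
      also have "\<dots> = lam * F s" by (simp add: F_def mult.left_commute)
      finally show "s powr (\<mu> - 2 * k) * (LINT x|lebesgue. u s x * radial_laplacian DIM('a) G ((norm x)\<^sup>2)) =
          s powr (\<mu> - 2 * k) * (lam * F s)" by simp
    qed simp
    have 3: "(LINT s:{1..t}|lebesgue. s powr \<mu> * (LINT x|lebesgue. \<bar>u s x\<bar> powr p * G ((norm x)\<^sup>2))) =
        (LINT s:{1..t}|lebesgue. N s)"
    proof (intro set_lebesgue_integral_cong allI impI)
      fix s assume s: "s \<in> {1..t}"
      show "s powr \<mu> * (LINT x|lebesgue. \<bar>u s x\<bar> powr p * G ((norm x)\<^sup>2)) = N s"
        unfolding N_def
        by (subst integral_radial_cong(2)[of s b r G g]) (use s t b cG Gg rr in \<open>auto simp: r_def\<close>)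
    qed simp
    show "t powr \<mu> * (LINT x|lebesgue. ut t x * G ((norm x)\<^sup>2)) =
        \<epsilon> * (LINT x|lebesgue. u1 x * g ((norm x)\<^sup>2))
        + (LINT s:{1..t}|lebesgue. s powr (\<mu> - 2 * k) * (lam * F s)) + (LINT s:{1..t}|lebesgue. N s)"
      using test_identity[OF G t(1) tT] unfolding 1 2 3 .
  qed
  show "\<exists>F'. \<forall>t. 1 < t \<and> t < b \<longrightarrow> DERIV F t :> F' t \<and>
      t powr \<mu> * F' t = \<epsilon> * (LINT x|lebesgue. u1 x * g ((norm x)\<^sup>2))
        + (LINT s:{1..t}|lebesgue. s powr (\<mu> - 2 * k) * (lam * F s)) + (LINT s:{1..t}|lebesgue. N s)"
    by (rule exI[of _ "\<lambda>t. LINT x|lebesgue. ut t x * G ((norm x)\<^sup>2)"], intro allI impI, elim conjE)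
      (rule id)
  \<comment> \<open>The factor s powr \<mu> goes into the space-time weight, so that Fubini yields
    the integrability of N in time at once.\<close>
  define W where "W z = fst z powr \<mu> * G ((norm (snd z))\<^sup>2)" for z :: "real \<times> 'a"
  have "continuous_on ({1..b} \<times> cball 0 (r + 2)) W"
    unfolding W_def
    by (intro continuous_intros continuous_on_compose2[OF cG(1)]) auto
  from power_integrable(2)[OF b(2) this]
  have i: "set_integrable lebesgue {1..b}
      (\<lambda>s. LINT x|lebesgue. indicator (cball 0 (r + 2)) x * (\<bar>u s x\<bar> powr p * W (s, x)))" .
  have N: "(LINT x|lebesgue. indicator (cball 0 (r + 2)) x * (\<bar>u s x\<bar> powr p * W (s, x))) = N s"
    if s: "s \<in> {1..b}" for s
  proof -
    have e: "indicator (cball 0 (r + 2)) x * (\<bar>u s x\<bar> powr p * W (s, x)) =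
        s powr \<mu> * (\<bar>u s x\<bar> powr p * G ((norm x)\<^sup>2))" for x
    proof (cases "norm x \<le> r + 2")
      case False
      then have "G ((norm x)\<^sup>2) = 0" using r by (intro G(2) power_mono) auto
      then show ?thesis by (simp add: W_def)
    qed (simp add: W_def)
    have "(LINT x|lebesgue. indicator (cball 0 (r + 2)) x * (\<bar>u s x\<bar> powr p * W (s, x))) =
        s powr \<mu> * (LINT x|lebesgue. \<bar>u s x\<bar> powr p * G ((norm x)\<^sup>2))"
      unfolding e by (rule integral_mult_right_zero)
    also have "\<dots> = N s" unfolding N_def
      by (subst integral_radial_cong(2)[of s b r G g]) (use s b cG Gg rr in \<open>auto simp: r_def\<close>)
    finally show ?thesis .
  qed
  show "set_integrable lebesgue {1..b} N"
    by (rule iffD1[OF set_integrable_cong[OF refl refl] i]) (rule N)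
qed

lemma AE_power_integrable:
  assumes b: "1 \<le> b" "ereal b < T"
  shows "AE s in lebesgue. s \<in> {1..b} \<longrightarrow> integrable lebesgue (\<lambda>x. \<bar>u s x\<bar> powr p)"
proof -
  define r where "r = A_k k b + R"
  have "AE s in lebesgue. s \<in> {1..b} \<longrightarrow>
      integrable lebesgue (\<lambda>x. indicator (cball 0 r) x * (\<bar>u s x\<bar> powr p * 1))"
    using power_integrable(1)[OF b(2), of r "\<lambda>_. 1"] by simp
  then show ?thesis
  proof eventually_elim
    case (elim s)
    show ?case
    proof
      assume s: "s \<in> {1..b}"
      then have sT: "ereal s < T" using b by (auto intro: le_less_trans[of _ "ereal b"])
      have um: "u s \<in> borel_measurable lebesgue"
        using L2[of s] s sT by (simp add: time_interval_def in_L2_def)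
      have A: "A_k k s \<le> A_k k b" using A_k_mono[OF k(2), of s b] s by auto
      have s1: "1 \<le> s" using s by simp
      have "AE x in lebesgue. indicator (cball 0 r) x * (\<bar>u s x\<bar> powr p * 1) = \<bar>u s x\<bar> powr p"
        using AE_support[OF s1 sT] by eventually_elim (use A in \<open>auto simp: r_def indicator_def\<close>)
      moreover have "(\<lambda>x. \<bar>u s x\<bar> powr p) \<in> borel_measurable lebesgue" using um by measurable
      ultimately show "integrable lebesgue (\<lambda>x. \<bar>u s x\<bar> powr p)"
        using integrable_cong_AE_imp elim s by blast
    qed
  qed
qed

end

section \<open>Lower bounds for the mean and the lifespan\<close>

lemma in_L2_indicator_cball:
  fixes w :: "'a::euclidean_space \<Rightarrow> real"
  assumes "continuous_on UNIV w"
  shows "in_L2 (\<lambda>x. indicator (cball 0 r) x * w x)"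
proof -
  have "integrable lebesgue (\<lambda>x. indicator (cball 0 r) x * (w x)\<^sup>2)"
    by (intro integrable_lebesgue_compact continuous_intros continuous_on_subset[OF assms]) auto
  moreover have "(\<lambda>x. indicator (cball 0 r) x * (w x)\<^sup>2) = (\<lambda>x. (norm (indicator (cball 0 r) x * w x))\<^sup>2)"
    by (auto simp: fun_eq_iff indicator_def)
  moreover have "w \<in> borel_measurable lebesgue"
    by (rule measurable_completion) (use borel_measurable_continuous_onI[OF assms] in simp)
  then have "(\<lambda>x. indicator (cball 0 r) x * w x) \<in> borel_measurable lebesgue"
    by (intro borel_measurable_times borel_measurable_indicator) auto
  ultimately show ?thesis by (simp add: in_L2_def)
qed

lemma ereal_between_real:
  assumes "ereal t < T"
  obtains b where "t < b" "ereal b < T"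
proof -
  obtain z where "ereal t < z" "z < T" using dense[OF assms] by blast
  then show ?thesis using that by (cases z) auto
qed

context supported_solution
begin

definition mean :: "real \<Rightarrow> real" where
  "mean t = (LINT x|lebesgue. u t x)"

text \<open>At a time at which the integrand is not integrable this is 0, the default value of the
  integral. Lower bounds for it therefore assume integrability and are available for almost every
  time.\<close>

definition power_mean :: "real \<Rightarrow> real" where
  "power_mean t = (LINT x|lebesgue. \<bar>u t x\<bar> powr p)"

lemma initial_moment:
  assumes "continuous_on UNIV h"
  shows "(LINT x|lebesgue. u 1 x * h ((norm x)\<^sup>2)) = \<epsilon> * (LINT x|lebesgue. u0 x * h ((norm x)\<^sup>2))"
proof -
  have "1 \<in> I" using T_gt_1 by (simp add: time_interval_def one_ereal_def)
  then have [measurable]: "u 1 \<in> borel_measurable lebesgue" "u0 \<in> borel_measurable lebesgue"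
    using L2 u0_L2 by (auto simp: in_L2_def)
  note [measurable] = borel_measurable_radial[OF assms]
  have "(LINT x|lebesgue. u 1 x * h ((norm x)\<^sup>2)) = (LINT x|lebesgue. \<epsilon> * (u0 x * h ((norm x)\<^sup>2)))"
    by (rule integral_cong_AE, measurable) (use initial in \<open>eventually_elim, simp\<close>)
  then show ?thesis by simp
qed

lemma velocity_moment_nonneg:
  assumes "\<And>z. 0 \<le> z \<Longrightarrow> 0 \<le> h z"
  shows "0 \<le> \<epsilon> * (LINT x|lebesgue. u1 x * h ((norm x)\<^sup>2))"
proof -
  have "AE x in lebesgue. 0 \<le> u1 x * h ((norm x)\<^sup>2)"
    using u1_nonneg by eventually_elim (use assms in auto)
  then show ?thesis using eps by (simp add: integral_nonneg_AE)
qed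

text \<open>The constant weight has Laplacian 0, so beside the source only the velocity term is
  left, which is nonnegative and is dropped.\<close>

lemma mean_ode:
  assumes b: "1 < b" "ereal b < T"
  shows "\<exists>U'. \<forall>t. 1 < t \<and> t < b \<longrightarrow> DERIV mean t :> U' t \<and>
      (LINT s:{1..t}|lebesgue. s powr \<mu> * power_mean s) \<le> t powr \<mu> * U' t"
    and "continuous_on {1..b} mean"
    and "set_integrable lebesgue {1..b} (\<lambda>s. s powr \<mu> * power_mean s)"
proof -
  have 1: "radial_laplacian DIM('a) (\<lambda>_. 1) z = 0 * 1" for z
    by (simp add: radial_laplacian_def)
  note ode = radial_moment_ode[OF b smooth_const[of 1] 1, simplified, folded mean_def power_mean_def]
  show "continuous_on {1..b} mean" using ode(2) by (simp add: mean_def[abs_def])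
  show "set_integrable lebesgue {1..b} (\<lambda>s. s powr \<mu> * power_mean s)"
    using ode(3) by (simp add: power_mean_def)
  have V: "0 \<le> \<epsilon> * (LINT x|lebesgue. u1 x)" using velocity_moment_nonneg[of "\<lambda>_. 1"] by simp
  obtain U' where U': "\<forall>t. 1 < t \<and> t < b \<longrightarrow> ((\<lambda>t. LINT x|lebesgue. u t x) has_real_derivative U' t) (at t) \<and>
      t powr \<mu> * U' t = \<epsilon> * (LINT x|lebesgue. u1 x)
        + (LINT s:{1..t}|lebesgue. s powr \<mu> * power_mean s)"
    using ode(1) by (auto simp: power_mean_def mean_def set_lebesgue_integral_def)
  show "\<exists>U'. \<forall>t. 1 < t \<and> t < b \<longrightarrow> DERIV mean t :> U' t \<and>
      (LINT s:{1..t}|lebesgue. s powr \<mu> * power_mean s) \<le> t powr \<mu> * U' t"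
  proof (rule exI[of _ U'], intro allI impI)
    fix t assume "1 < t \<and> t < b"
    with U' have D: "((\<lambda>t. LINT x|lebesgue. u t x) has_real_derivative U' t) (at t)"
      and e: "t powr \<mu> * U' t = \<epsilon> * (LINT x|lebesgue. u1 x)
        + (LINT s:{1..t}|lebesgue. s powr \<mu> * power_mean s)" by auto
    show "DERIV mean t :> U' t \<and> (LINT s:{1..t}|lebesgue. s powr \<mu> * power_mean s) \<le> t powr \<mu> * U' t"
      using D e V by (simp add: mean_def[abs_def])
  qed
qed

lemma power_mean_nonneg: "0 \<le> power_mean s"
  by (simp add: power_mean_def)

text \<open>On a window [S, 2 S] the factor s powr \<mu> varies by at most 2 powr \<mu>. One
  integration of the source from s to r bounds the derivative of the mean below by 2 powr (- \<mu>)
  m (r - s), and a second one gives the square.\<close>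

lemma mean_window_growth:
  assumes S: "1 \<le> S" "S \<le> s" "s \<le> t" "t \<le> 2 * S" "ereal t < T" and m: "0 \<le> m"
    and X: "AE \<sigma> in lebesgue. \<sigma> \<in> {s..t} \<longrightarrow> m \<le> power_mean \<sigma>"
  shows "mean s + 2 powr (- \<mu>) * m * (t - s)\<^sup>2 / 2 \<le> mean t"
proof -
  obtain b where b: "t < b" "ereal b < T" using ereal_between_real[OF S(5)] by blast
  have b1: "1 < b" using b S by simp
  obtain U' where U': "\<And>r. 1 < r \<Longrightarrow> r < b \<Longrightarrow> DERIV mean r :> U' r"
    "\<And>r. 1 < r \<Longrightarrow> r < b \<Longrightarrow> (LINT s:{1..r}|lebesgue. s powr \<mu> * power_mean s) \<le> r powr \<mu> * U' r"
    using mean_ode(1)[OF b1 b(2)] by blast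
  define M where "M = 2 powr (- \<mu>) * m"
  define H where "H r = mean r - M * (r - s)\<^sup>2 / 2" for r
  have "H s \<le> H t"
  proof (rule DERIV_nonneg_imp_increasing_open[where f = H, OF S(3)])
    have "continuous_on {s..t} mean"
      using S b by (intro continuous_on_subset[OF mean_ode(2)[OF b1 b(2)]]) auto
    then show "continuous_on {s..t} H" unfolding H_def by (intro continuous_intros) auto
    fix r assume r: "s < r" "r < t"
    have r1: "1 < r" "r < b" using r S b by auto
    have "DERIV H r :> U' r - M * (r - s)"
      unfolding H_def by (rule derivative_eq_intros U'(1)[OF r1] refl | simp)+
    moreover have "0 \<le> U' r - M * (r - s)"
    proof -
      let ?N = "\<lambda>r. LINT s:{1..r}|lebesgue. s powr \<mu> * power_mean s"
      have "(r - s) * (S powr \<mu> * m) \<le> ?N r - ?N s"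
      proof (rule set_integral_increment_ge[OF mean_ode(3)[OF b1 b(2)]])
        show "AE \<sigma> in lebesgue. \<sigma> \<in> {s..r} \<longrightarrow> S powr \<mu> * m \<le> \<sigma> powr \<mu> * power_mean \<sigma>"
          using X
        proof eventually_elim
          case (elim \<sigma>)
          then show ?case using S r mu m by (auto intro!: mult_mono powr_mono2)
        qed
      qed (use S r b in auto)
      moreover have "0 \<le> ?N s" unfolding set_lebesgue_integral_def
        by (intro Bochner_Integration.integral_nonneg) (simp add: power_mean_nonneg)
      ultimately have "(r - s) * (S powr \<mu> * m) \<le> r powr \<mu> * U' r" using U'(2)[OF r1] by simp
      moreover have "r powr \<mu> * (M * (r - s)) \<le> (2 * S) powr \<mu> * (M * (r - s))"
        using r S mu m by (intro mult_right_mono powr_mono2) (auto simp: M_def)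
      moreover have "(2 * S) powr \<mu> * (M * (r - s)) = (r - s) * (S powr \<mu> * m)"
        by (simp add: M_def powr_mult powr_minus field_simps)
      ultimately have "r powr \<mu> * (M * (r - s)) \<le> r powr \<mu> * U' r" by linarith
      then show ?thesis using r1 by simp
    qed
    ultimately show "\<exists>y. DERIV H r :> y \<and> 0 \<le> y" by blast
  qed
  then show ?thesis by (simp add: H_def M_def)
qed

lemma mean_mono:
  assumes "1 \<le> s" "s \<le> t" "ereal t < T"
  shows "mean s \<le> mean t"
proof (cases "t = 1")
  case False
  obtain b where b: "t < b" "ereal b < T" using ereal_between_real[OF assms(3)] by blast
  have b1: "1 < b" using b assms by simp
  obtain U' where U': "\<And>r. 1 < r \<Longrightarrow> r < b \<Longrightarrow> DERIV mean r :> U' r"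
    "\<And>r. 1 < r \<Longrightarrow> r < b \<Longrightarrow> (LINT s:{1..r}|lebesgue. s powr \<mu> * power_mean s) \<le> r powr \<mu> * U' r"
    using mean_ode(1)[OF b1 b(2)] by blast
  show ?thesis
  proof (rule DERIV_nonneg_imp_increasing_open[where f = mean, OF assms(2)])
    show "continuous_on {s..t} mean"
      using assms b by (intro continuous_on_subset[OF mean_ode(2)[OF b1 b(2)]]) auto
    fix r assume r: "s < r" "r < t"
    have r1: "1 < r" "r < b" using r assms b by auto
    have "0 \<le> (LINT s:{1..r}|lebesgue. s powr \<mu> * power_mean s)" unfolding set_lebesgue_integral_def
      by (intro Bochner_Integration.integral_nonneg) (simp add: power_mean_nonneg)
    then have "0 \<le> r powr \<mu> * U' r" using U'(2)[OF r1] by simp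
    then have "0 \<le> U' r" using r1 by (simp add: zero_le_mult_iff)
    then show "\<exists>y. DERIV mean r :> y \<and> 0 \<le> y" using U'(1)[OF r1] by blast
  qed
qed (use assms in simp)

text \<open>The weight is restricted to the ball that contains the support of u s: its integral
  against u s is unchanged, and its conjugate power becomes integrable.\<close>

lemma power_mean_lower_bound:
  assumes s: "1 \<le> s" "ereal s < T" and i: "integrable lebesgue (\<lambda>x. \<bar>u s x\<bar> powr p)"
    and h: "continuous_on UNIV h" "\<And>z. 0 \<le> z \<Longrightarrow> 0 < h z"
    and F: "0 < F" "F \<le> (LINT x|lebesgue. u s x * h ((norm x)\<^sup>2))"
    and Y: "0 < Y" "(LINT x|lebesgue. indicator (cball 0 (A_k k s + R)) (x::'a) *
      h ((norm x)\<^sup>2) powr (p / (p - 1))) \<le> Y"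
  shows "(F / 2) powr p * Y powr (1 - p) \<le> power_mean s"
proof -
  define r where "r = A_k k s + R"
  define g where "g x = indicator (cball 0 r) x * h ((norm x)\<^sup>2)" for x :: 'a
  have g2: "in_L2 g" unfolding g_def by (rule in_L2_indicator_cball[OF continuous_on_radial[OF h(1)]])
  have us: "in_L2 (u s)" using s by (intro L2) (simp add: time_interval_def)
  have [measurable]: "u s \<in> borel_measurable lebesgue" "g \<in> borel_measurable lebesgue"
    using us g2 by (auto simp: in_L2_def)
  note [measurable] = borel_measurable_radial[OF h(1)]
  have hne: "h ((norm x)\<^sup>2) \<noteq> 0" for x :: 'a using h(2)[of "(norm x)\<^sup>2"] by simp
  have gp: "\<bar>g x\<bar> powr (p / (p - 1)) = indicator (cball 0 r) x * h ((norm x)\<^sup>2) powr (p / (p - 1))" for x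
    using h(2)[of "(norm x)\<^sup>2"] by (auto simp: g_def indicator_def)
  have "(LINT x|lebesgue. u s x * h ((norm x)\<^sup>2)) = (LINT x|lebesgue. u s x * g x)"
    by (rule integral_cong_AE, measurable)
      (use AE_support[OF s] in \<open>eventually_elim, auto simp: g_def r_def indicator_def\<close>)
  then have "F \<le> (LINT x|lebesgue. u s x * g x)" using F by simp
  then show ?thesis
    unfolding power_mean_def
  proof (intro power_integral_lower_bound[OF p i _ _ Y(1) _ F(1)])
    show "integrable lebesgue (\<lambda>x. \<bar>g x\<bar> powr (p / (p - 1)))"
      unfolding gp using hne
      by (intro integrable_lebesgue_compact continuous_on_powr continuous_on_radial[OF h(1)] continuous_on_const) auto
    show "(LINT x|lebesgue. \<bar>g x\<bar> powr (p / (p - 1))) \<le> Y" unfolding gp using Y(2) by (simp add: r_def)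
    show "integrable lebesgue (\<lambda>x. u s x * g x)" by (rule in_L2_integrable_mult[OF us g2])
  qed
qed

end

text \<open>\<open>\<theta>\<close> is (1 - k) (1 + b p - a p^2). For a > 0 let r be the positive
  root of a x^2 - b x - 1. This polynomial is (x - r) (a x + (a r - b)), where a r - b = 1 / r > 0;
  hence r is the only positive root, as the description in \<open>p0\<close> requires, and the
  polynomial is negative on (0, r).\<close>

lemma less_p0_imp_theta_pos:
  assumes "0 < n" "0 \<le> k" "k < 1" "0 \<le> \<mu>" "1 < p" "ereal p < p0 k n \<mu>"
  shows "0 < \<theta> n k \<mu> p"
proof -
  define a where "a = (real n - 1) / 2 + (\<mu> - k) / (2 * (1 - k))"
  define b where "b = (real n + 1) / 2 + (\<mu> + 3 * k) / (2 * (1 - k))"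
  have b: "0 < b" unfolding b_def using assms by (intro add_pos_nonneg) auto
  have "0 < 1 + b * p - a * p\<^sup>2"
  proof (cases "a \<le> 0")
    case True
    then have "a * p\<^sup>2 \<le> 0" by (simp add: mult_le_0_iff)
    moreover have "0 < b * p" using b assms by simp
    ultimately show ?thesis by linarith
  next
    case False
    then have a: "0 < a" by simp
    define D where "D = sqrt (b\<^sup>2 + 4 * a)"
    define r where "r = (b + D) / (2 * a)"
    have D: "D\<^sup>2 = b\<^sup>2 + 4 * a" "0 \<le> D" using a by (auto simp: D_def)
    have r: "0 < r" using a b D by (auto simp: r_def intro!: divide_pos_pos add_pos_nonneg)
    have ra: "2 * a * r - b = D" using a by (simp add: r_def)
    have "(2 * a * r - b)\<^sup>2 = b\<^sup>2 + 4 * a" unfolding ra by (rule D)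
    then have "4 * a * (a * r\<^sup>2 - b * r - 1) = 0" by (simp add: power2_eq_square algebra_simps)
    then have r0: "a * r\<^sup>2 - b * r - 1 = 0" using a by simp
    then have rb: "r * (a * r - b) = 1" by (simp add: power2_eq_square algebra_simps)
    then have arb: "0 < a * r - b" using r zero_less_mult_pos[of r "a * r - b"] by simp
    have less: "a * x\<^sup>2 - b * x - 1 = (x - r) * (a * x + (a * r - b))" for x
      using r0 by (simp add: power2_eq_square algebra_simps)
    have "(THE p. 0 < p \<and> a * p\<^sup>2 - b * p - 1 = 0) = r"
    proof (rule the_equality)
      fix x assume x: "0 < x \<and> a * x\<^sup>2 - b * x - 1 = 0"
      then have "0 < a * x + (a * r - b)" using a arb by (intro add_pos_pos) auto
      then show "x = r" using x less[of x] by simp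
    qed (use r r0 in auto)
    then have "p < r"
      using assms(6) False unfolding p0_def Let_def a_def[symmetric] b_def[symmetric] by simp
    moreover have "0 < a * p + (a * r - b)" using a arb assms by (intro add_pos_pos) auto
    ultimately have "(p - r) * (a * p + (a * r - b)) < 0" by (simp add: mult_less_0_iff)
    then show ?thesis using less[of p] by simp
  qed
  then have "0 < (1 - k) * (1 + b * p - a * p\<^sup>2)" using assms by simp
  also have "(1 - k) * (1 + b * p - a * p\<^sup>2) = (1 - k) + ((1 - k) * b) * p - ((1 - k) * a) * p\<^sup>2"
    by (simp add: algebra_simps)
  finally have pos: "0 < (1 - k) + ((1 - k) * b) * p - ((1 - k) * a) * p\<^sup>2" .
  have ne: "1 - k \<noteq> 0" using assms by simp
  have h: "(1 - k) * (x / (2 * (1 - k))) = x / 2" for x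
    using mult_divide_mult_cancel_left[OF ne, of x 2] by (simp only: times_divide_eq_right mult.commute[of 2])
  show ?thesis using pos unfolding \<theta>_def a_def b_def distrib_left h .
qed

section \<open>From window bounds to a bound for the time of existence\<close>

lemma powr_bound_solve:
  fixes S \<beta> c K \<epsilon> e :: real
  assumes "0 < \<beta>" "0 < S" "0 < c" "0 < \<epsilon>" "S powr \<beta> * (\<epsilon> powr e * c) \<le> K"
  shows "S \<le> (K / c) powr (1 / \<beta>) * \<epsilon> powr (- (e / \<beta>))"
proof -
  have "S powr \<beta> \<le> (K / c) * \<epsilon> powr (- e)"
    using assms by (simp add: powr_minus field_simps)
  then have "(S powr \<beta>) powr (1 / \<beta>) \<le> ((K / c) * \<epsilon> powr (- e)) powr (1 / \<beta>)"
    using assms by (intro powr_mono2) auto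
  moreover have "(S powr \<beta>) powr (1 / \<beta>) = S" using assms by (simp add: powr_powr)
  moreover have "((K / c) * \<epsilon> powr (- e)) powr (1 / \<beta>) = (K / c) powr (1 / \<beta>) * \<epsilon> powr (- (e / \<beta>))"
    unfolding powr_mult[of "K / c"] powr_powr by simp
  ultimately show ?thesis by simp
qed

text \<open>The factor 4 leaves room for two consecutive windows, [S, 2 S] and [2 S, 4 S], inside
  the interval of existence.\<close>

lemma lifespan_le:
  fixes T :: ereal
  assumes "0 \<le> t0" "0 \<le> B" and S: "\<And>S. t0 \<le> S \<Longrightarrow> ereal (4 * S) < T \<Longrightarrow> S \<le> B"
  shows "T \<le> ereal (4 * (t0 + B))"
proof (rule ccontr)
  assume "\<not> T \<le> ereal (4 * (t0 + B))"
  then have "ereal (4 * (t0 + B)) < T" by simp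
  then obtain z where z: "4 * (t0 + B) < z" "ereal z < T" using ereal_between_real by blast
  have "z / 4 \<le> B" by (rule S) (use z assms in auto)
  then show False using z assms by simp
qed

text \<open>The radius A_k k s + R is at most (1 / (1 - k) + R) * s powr (1 - k), and the ball of
  that radius bounds the conjugate integral of the weight 1. The factor 2 powr (- p) is the loss in
  \<open>power_integral_lower_bound\<close>.\<close>

definition volume_const :: "real \<Rightarrow> real \<Rightarrow> real \<Rightarrow> nat \<Rightarrow> real" where
  "volume_const k p R n = 2 powr (- p) * (unit_ball_vol n * (1 / (1 - k) + R) ^ n) powr (1 - p)"

text \<open>The factor 2 powr (- \<mu>) and the final 1/2 come from
  \<open>mean_window_growth\<close>; the remaining power of 2 comes from replacing every time in
  [S, 2 S] by 2 S in the negative power of time.\<close>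

definition window_const :: "real \<Rightarrow> real \<Rightarrow> real \<Rightarrow> real \<Rightarrow> nat \<Rightarrow> real" where
  "window_const k \<mu> p R n =
    2 powr (- \<mu>) * volume_const k p R n * 2 powr (- ((1 - k) * real n * (p - 1))) / 2"

lemma volume_const_pos:
  assumes "k < 1" "0 < R"
  shows "0 < volume_const k p R n"
proof -
  have "0 < 1 / (1 - k) + R" using assms by (intro add_pos_pos) auto
  then have "0 < unit_ball_vol (real n) * (1 / (1 - k) + R) ^ n" by (intro mult_pos_pos) auto
  then have "0 < (unit_ball_vol (real n) * (1 / (1 - k) + R) ^ n) powr (1 - p)"
    by (metis powr_gt_zero less_irrefl)
  then show ?thesis unfolding volume_const_def by (intro mult_pos_pos) auto
qed

lemma window_const_pos: "k < 1 \<Longrightarrow> 0 < R \<Longrightarrow> 0 < window_const k \<mu> p R n"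
  by (simp add: window_const_def volume_const_pos)

context supported_solution
begin

lemma power_mean_ge_mean:
  assumes s: "1 \<le> s" "ereal s < T" and i: "integrable lebesgue (\<lambda>x. \<bar>u s x\<bar> powr p)"
    and F: "0 < mean s"
  shows "volume_const k p R DIM('a) * (s powr (- ((1 - k) * real DIM('a) * (p - 1))) * mean s powr p)
    \<le> power_mean s"
proof -
  define r where "r = A_k k s + R"
  define c where "c = 1 / (1 - k) + R"
  define V where "V = unit_ball_vol (real DIM('a))"
  have r: "0 < r" using A_k_mono[OF k(2) s(1) order_refl] R by (simp add: r_def)
  have c: "0 < c" using k R by (simp add: c_def add_pos_pos)
  have y: "1 \<le> s powr (1 - k)" using s k by (simp add: ge_one_powr_ge_zero)
  have "r \<le> c * s powr (1 - k)"
  proof -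
    have "r = s powr (1 - k) / (1 - k) + (R - 1 / (1 - k))"
      using k s by (simp add: r_def A_k_eq diff_divide_distrib)
    also have "\<dots> \<le> s powr (1 - k) / (1 - k) + R * s powr (1 - k)"
      using R y k mult_left_mono[of 1 "s powr (1 - k)" R] by (intro add_left_mono) (auto intro: order_trans[of _ R])
    finally show ?thesis by (simp add: c_def algebra_simps)
  qed
  have V: "0 < V" by (simp add: V_def)
  define Y where "Y = V * (c * s powr (1 - k)) ^ DIM('a)"
  have Y: "0 < Y" using V c s by (simp add: Y_def)
  have "(LINT x|lebesgue. indicator (cball 0 r) (x::'a) * 1 powr (p / (p - 1))) = V * r ^ DIM('a)"
    using content_cball[of r "0::'a"] r by (simp add: V_def)
  also have "\<dots> \<le> Y" unfolding Y_def using V r \<open>r \<le> _\<close> by (intro mult_left_mono power_mono) auto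
  finally have 1: "(LINT x|lebesgue. indicator (cball 0 r) (x::'a) * 1 powr (p / (p - 1))) \<le> Y" .
  have "(mean s / 2) powr p * Y powr (1 - p) \<le> power_mean s"
    using power_mean_lower_bound[OF s i, of "\<lambda>_. 1" "mean s" Y] F Y 1 by (simp add: mean_def r_def)
  moreover have "Y powr (1 - p) = (V * c ^ DIM('a)) powr (1 - p) * s powr (- ((1 - k) * real DIM('a) * (p - 1)))"
  proof -
    have "(s powr (1 - k)) ^ DIM('a) = s powr ((1 - k) * real DIM('a))"
      using s by (simp add: powr_powr flip: powr_realpow)
    then have "Y = (V * c ^ DIM('a)) * s powr ((1 - k) * real DIM('a))"
      by (simp add: Y_def power_mult_distrib)
    moreover have "(1 - k) * real DIM('a) * (1 - p) = - ((1 - k) * real DIM('a) * (p - 1))"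
      by (simp add: algebra_simps)
    ultimately show ?thesis by (simp only: powr_mult powr_powr)
  qed
  moreover have "(mean s / 2) powr p = 2 powr (- p) * mean s powr p"
    by (simp add: powr_divide powr_minus field_simps)
  ultimately show ?thesis by (simp add: volume_const_def V_def c_def mult_ac)
qed

text \<open>On [s, t] the mean is at least mean s, and the negative power of time is at least its
  value at 2 S. With both frozen, the source has a constant lower bound and
  \<open>mean_window_growth\<close> applies.\<close>

lemma mean_quadratic_growth:
  assumes S: "1 \<le> S" "S \<le> s" "s \<le> t" "t \<le> 2 * S" "ereal t < T" and pos: "0 < mean 1"
  shows "window_const k \<mu> p R DIM('a) * S powr (- ((1 - k) * real DIM('a) * (p - 1))) * (t - s)\<^sup>2 * mean s powr p
    \<le> mean t"
proof -
  define \<alpha> where "\<alpha> = (1 - k) * real DIM('a) * (p - 1)"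
  define m where "m = volume_const k p R DIM('a) * ((2 * S) powr (- \<alpha>) * mean s powr p)"
  have vc: "0 < volume_const k p R DIM('a)" by (rule volume_const_pos[OF k(2) R])
  have \<alpha>: "0 \<le> \<alpha>" using k p by (simp add: \<alpha>_def)
  have pos': "0 < mean r" if "1 \<le> r" "r \<le> t" for r
  proof -
    have "ereal r < T" using that S by (auto intro: le_less_trans[of _ "ereal t"])
    then show ?thesis using mean_mono[of 1 r] that pos by simp
  qed
  have "AE \<sigma> in lebesgue. \<sigma> \<in> {s..t} \<longrightarrow> m \<le> power_mean \<sigma>"
    using AE_power_integrable[OF _ S(5)]
  proof (rule AE_mp)
    show "1 \<le> t" using S by simp
    show "AE \<sigma> in lebesgue. (\<sigma> \<in> {1..t} \<longrightarrow> integrable lebesgue (\<lambda>x. \<bar>u \<sigma> x\<bar> powr p)) \<longrightarrow>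
        (\<sigma> \<in> {s..t} \<longrightarrow> m \<le> power_mean \<sigma>)"
    proof (rule AE_I2, intro impI)
      fix \<sigma> assume i: "\<sigma> \<in> {1..t} \<longrightarrow> integrable lebesgue (\<lambda>x. \<bar>u \<sigma> x\<bar> powr p)" and \<sigma>: "\<sigma> \<in> {s..t}"
      have \<sigma>T: "ereal \<sigma> < T" using \<sigma> S by (auto intro: le_less_trans[of _ "ereal t"])
      have \<sigma>1: "1 \<le> \<sigma>" using \<sigma> S by auto
      have le: "mean s \<le> mean \<sigma>" using \<sigma> S \<sigma>T by (intro mean_mono) auto
      have "m \<le> volume_const k p R DIM('a) * (\<sigma> powr (- \<alpha>) * mean \<sigma> powr p)"
        unfolding m_def using vc S \<sigma> \<alpha> p le pos'[of s]
        by (intro mult_left_mono mult_mono powr_mono2 powr_mono2') auto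
      also have "\<dots> \<le> power_mean \<sigma>"
        unfolding \<alpha>_def using i \<sigma> \<sigma>1 by (intro power_mean_ge_mean \<sigma>T pos') auto
      finally show "m \<le> power_mean \<sigma>" .
    qed
  qed
  moreover have "0 \<le> m" using vc by (simp add: m_def)
  ultimately have "mean s + 2 powr (- \<mu>) * m * (t - s)\<^sup>2 / 2 \<le> mean t"
    using S by (intro mean_window_growth[of S]) auto
  moreover have "0 < mean s" using S by (intro pos') auto
  moreover have "2 powr (- \<mu>) * m * (t - s)\<^sup>2 / 2 =
      window_const k \<mu> p R DIM('a) * S powr (- \<alpha>) * (t - s)\<^sup>2 * mean s powr p"
    by (simp add: m_def window_const_def powr_mult \<alpha>_def)
  ultimately show ?thesis unfolding \<alpha>_def by linarith
qed

lemma mean_window_bound: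
  assumes S: "1 \<le> S" "ereal (2 * S) < T" and pos: "0 < mean 1" and m: "0 < m" "m \<le> mean S"
  shows "S powr (2 - (1 - k) * real DIM('a) * (p - 1)) * m powr (p - 1)
    \<le> 2 / (1 - 2 powr (- (p - 1) / 2))\<^sup>2 / window_const k \<mu> p R DIM('a)"
proof -
  define \<alpha> where "\<alpha> = (1 - k) * real DIM('a) * (p - 1)"
  define w where "w = window_const k \<mu> p R DIM('a)"
  have w: "0 < w" unfolding w_def by (rule window_const_pos[OF k(2) R])
  have tT: "ereal t < T" if "t \<le> 2 * S" for t
    using that S by (auto intro: le_less_trans[of _ "ereal (2 * S)"])
  have "(2 * S - S)\<^sup>2 * (w * S powr (- \<alpha>)) * m powr (p - 1) \<le> 2 / (1 - 2 powr (- (p - 1) / 2))\<^sup>2"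
  proof (rule quadratic_growth_interval_bound[where f = mean, OF p])
    show "0 < w * S powr (- \<alpha>)" using w S by simp
    show "mean s \<le> mean t" if "S \<le> s" "s \<le> t" "t \<le> 2 * S" for s t
      using that S tT by (intro mean_mono) auto
    show "w * S powr (- \<alpha>) * (t - s)\<^sup>2 * mean s powr p \<le> mean t" if "S \<le> s" "s \<le> t" "t \<le> 2 * S" for s t
      unfolding w_def \<alpha>_def using that S tT pos by (intro mean_quadratic_growth) auto
  qed (use S m in auto)
  note 1 = this
  have "S powr (2 - \<alpha>) = S\<^sup>2 * S powr (- \<alpha>)"
    using powr_add[of S 2 "- \<alpha>"] S by simp
  then have 2: "(2 * S - S)\<^sup>2 * (w * S powr (- \<alpha>)) * m powr (p - 1) = (S powr (2 - \<alpha>) * m powr (p - 1)) * w"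
    by simp
  from 1 have "(S powr (2 - \<alpha>) * m powr (p - 1)) * w \<le> 2 / (1 - 2 powr (- (p - 1) / 2))\<^sup>2" unfolding 2 .
  then show ?thesis unfolding \<alpha>_def[symmetric] w_def[symmetric] using w by (subst pos_le_divide_eq)
qed

end

text \<open>\<open>exp (- p * R)\<close> is what remains when the exponentials of A_k and of A_k + R
  meet. The last factor pays for replacing 1 + A_k + R by s powr (1 - k) under an exponent of
  unknown sign.\<close>

definition eig_moment_const :: "real \<Rightarrow> real \<Rightarrow> real \<Rightarrow> real \<Rightarrow> nat \<Rightarrow> real \<Rightarrow> real \<Rightarrow> real \<Rightarrow> real" where
  "eig_moment_const k \<mu> p R n c Cq m =
    (c * m / 2) powr p * (Cq powr (1 - p) * exp (- p * R) *
      (1 + R + 1 / (1 - k)) powr (- \<bar>(real n - 1) * (1 - p / 2)\<bar>))"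

text \<open>The power of time in the lower bound for the source. The first summand is the amplitude
  of the growing solution raised to the power p; the second is the Hoelder factor, where (1 - q / 2)
  (1 - p) = 1 - p / 2 for q = p / (p - 1) and the radius grows like s powr (1 - k).\<close>

definition source_exponent :: "real \<Rightarrow> real \<Rightarrow> real \<Rightarrow> nat \<Rightarrow> real" where
  "source_exponent k \<mu> p n = (k - \<mu>) / 2 * p + (1 - k) * ((real n - 1) * (1 - p / 2))"

lemma eig_moment_const_pos:
  assumes "0 < c" "0 < Cq" "0 < m" "k < 1" "0 < R"
  shows "0 < eig_moment_const k \<mu> p R n c Cq m"
proof -
  have "0 < 1 + R + 1 / (1 - k)" using assms by (intro add_pos_pos) auto
  then show ?thesis using assms by (simp add: eig_moment_const_def)
qed

text \<open>This is the origin of \<open>\<theta>\<close>: when m is of order S powr (e + 2), e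
  being the source exponent, the left side of \<open>mean_window_bound\<close> is of order S to this
  power.\<close>

lemma theta_eq_source_exponent:
  "\<theta> n k \<mu> p = (source_exponent k \<mu> p n + 2) * (p - 1) + (2 - (1 - k) * real n * (p - 1))"
  by (simp add: \<theta>_def source_exponent_def field_simps power2_eq_square)

lemma growth_constantsD:
  assumes "growth_constants k \<mu> t0 c" "continuous_on {1..b} F" "0 < F 1" "0 \<le> V"
    and "\<And>t. 1 < t \<Longrightarrow> t < b \<Longrightarrow> DERIV F t :> F' t"
    and "\<And>t. 1 < t \<Longrightarrow> t < b \<Longrightarrow> t powr \<mu> * F' t = V + J t + N t"
    and "\<And>t. 1 < t \<Longrightarrow> t < b \<Longrightarrow> DERIV J t :> t powr (\<mu> - 2 * k) * F t"
    and "continuous_on {1..b} J" "J 1 = 0" "mono_on {1..b} N" "0 \<le> N 1" "t0 \<le> t" "t \<le> b"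
  shows "c * F 1 * (t powr ((k - \<mu>) / 2) * exp ((t powr (1 - k) - 1) / (1 - k))) \<le> F t"
proof -
  note G = assms(1)[unfolded growth_constants_def, THEN conjunct2, THEN conjunct2, THEN spec[of _ b],
      THEN spec[of _ F], THEN spec[of _ F'], THEN spec[of _ J], THEN spec[of _ N], THEN spec[of _ V], THEN mp]
  show ?thesis by (rule mp[OF spec[of _ t, OF G]]) (use assms in simp_all)
qed

section \<open>Growth of the eigenfunction moment and the source that it forces\<close>

context supported_solution
begin

definition eig_moment :: "real \<Rightarrow> real" where
  "eig_moment t = (LINT x|lebesgue. u t x * radial_eig DIM('a) ((norm x)\<^sup>2))"

text \<open>The terms of the tested equation take the parts of V, J and N in
  \<open>growth_constants\<close>: J contains the moment itself because the eigenfunction equals its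
  Laplacian, and N is nondecreasing because the eigenfunction is positive.\<close>

lemma eig_moment_growth:
  assumes gc: "growth_constants k \<mu> t0 c" and m: "0 < (LINT x|lebesgue. u0 x * radial_eig DIM('a) ((norm x)\<^sup>2))"
    and t: "t0 \<le> t" "ereal t < T"
  shows "c * (\<epsilon> * (LINT x|lebesgue. u0 x * radial_eig DIM('a) ((norm x)\<^sup>2))) *
    (t powr ((k - \<mu>) / 2) * exp (A_k k t)) \<le> eig_moment t"
proof -
  let ?g = "radial_eig DIM('a)"
  have t0: "1 \<le> t0" using gc by (simp add: growth_constants_def)
  obtain b where b: "t < b" "ereal b < T" using ereal_between_real[OF t(2)] by blast
  have b1: "1 < b" using b t t0 by simp
  have g: "smooth ?g" by (rule smooth_radial_eig) simp
  have g0: "0 \<le> ?g z" if "0 \<le> z" for z using radial_eig_ge_1[of "DIM('a)" z] that by simp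
  have eig: "radial_laplacian DIM('a) ?g z = 1 * ?g z" for z
    using radial_laplacian_radial_eig[of "DIM('a)" z] by simp
  note ode = radial_moment_ode[OF b1 b(2) g eig, folded eig_moment_def, unfolded mult_1]
  define V where "V = \<epsilon> * (LINT x|lebesgue. u1 x * ?g ((norm x)\<^sup>2))"
  define f where "f s = s powr \<mu> * (LINT x|lebesgue. \<bar>u s x\<bar> powr p * ?g ((norm x)\<^sup>2))" for s
  define N where "N r = (LINT s:{1..r}|lebesgue. f s)" for r
  define J where "J r = (LINT s:{1..r}|lebesgue. s powr (\<mu> - 2 * k) * eig_moment s)" for r
  have e: "(\<lambda>t. LINT x|lebesgue. u t x * ?g ((norm x)\<^sup>2)) = eig_moment"
    by (simp add: eig_moment_def fun_eq_iff)
  have V: "0 \<le> V" unfolding V_def by (rule velocity_moment_nonneg[OF g0])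
  obtain F' where F': "\<And>r. 1 < r \<Longrightarrow> r < b \<Longrightarrow> DERIV eig_moment r :> F' r"
    "\<And>r. 1 < r \<Longrightarrow> r < b \<Longrightarrow> r powr \<mu> * F' r = V + J r + N r"
    using ode(1) unfolding e V_def J_def N_def f_def by blast
  have cont: "continuous_on {1..b} eig_moment" using ode(2) unfolding e .
  have "continuous_on {1..b} (\<lambda>s. s powr (\<mu> - 2 * k) * eig_moment s)"
    by (intro continuous_intros cont) auto
  note J = lebesgue_integral_antideriv[OF this, folded J_def[abs_def]]
  have J1: "J 1 = 0" unfolding J_def by (rule J(3))
  have f0: "0 \<le> f s" for s
    unfolding f_def by (intro mult_nonneg_nonneg Bochner_Integration.integral_nonneg g0) auto
  have fi: "set_integrable lebesgue {1..b} f" using ode(3) unfolding f_def .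
  have N: "mono_on {1..b} N"
  proof (rule mono_onI)
    fix r s assume "r \<in> {1..b}" "s \<in> {1..b}" "r \<le> s"
    then have "(s - r) * 0 \<le> N s - N r"
      unfolding N_def by (intro set_integral_increment_ge[OF fi]) (auto simp: f0)
    then show "N r \<le> N s" by simp
  qed
  have N1: "0 \<le> N 1" unfolding N_def set_lebesgue_integral_def
    by (intro Bochner_Integration.integral_nonneg) (simp add: f0)
  have F1: "eig_moment 1 = \<epsilon> * (LINT x|lebesgue. u0 x * ?g ((norm x)\<^sup>2))"
    unfolding eig_moment_def by (rule initial_moment[OF smooth_imp_continuous_on[OF g]])
  have "0 < eig_moment 1" unfolding F1 using m eps by simp
  then have "c * eig_moment 1 * (t powr ((k - \<mu>) / 2) * exp ((t powr (1 - k) - 1) / (1 - k))) \<le> eig_moment t"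
    using t b by (intro growth_constantsD[OF gc cont _ V F' J(1,2) J1 N N1]) auto
  then show ?thesis using t t0 k by (simp add: A_k_eq F1)
qed

lemma power_mean_ge_source:
  assumes gc: "growth_constants k \<mu> t0 c"
    and m: "0 < m" "m = (LINT x|lebesgue. u0 x * radial_eig DIM('a) ((norm x)\<^sup>2))"
    and Cq: "0 < Cq" "\<And>\<rho>. 0 \<le> \<rho> \<Longrightarrow>
      (LINT x|lebesgue. indicator (cball 0 \<rho>) (x::'a) * radial_eig DIM('a) ((norm x)\<^sup>2) powr (p / (p - 1)))
        \<le> Cq * (1 + \<rho>) powr ((real DIM('a) - 1) * (1 - p / (p - 1) / 2)) * exp (p / (p - 1) * \<rho>)"
    and s: "t0 \<le> s" "ereal s < T" and i: "integrable lebesgue (\<lambda>x. \<bar>u s x\<bar> powr p)"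
  shows "eig_moment_const k \<mu> p R DIM('a) c Cq m * (\<epsilon> powr p * s powr source_exponent k \<mu> p DIM('a))
    \<le> power_mean s"
proof -
  let ?g = "radial_eig DIM('a)"
  define q where "q = p / (p - 1)"
  define n where "n = real DIM('a)"
  define \<kappa> where "\<kappa> = (k - \<mu>) / 2"
  define \<gamma> where "\<gamma> = (n - 1) * (1 - p / 2)"
  define A where "A = A_k k s"
  define \<rho> where "\<rho> = A + R"
  define K where "K = 1 + R + 1 / (1 - k)"
  have c: "0 < c" "1 \<le> t0" using gc by (auto simp: growth_constants_def)
  have s1: "1 \<le> s" using c s by simp
  have \<rho>: "0 \<le> \<rho>" using A_k_mono[OF k(2) s1 order_refl] R by (simp add: \<rho>_def A_def)
  define F where "F = c * (\<epsilon> * m) * (s powr \<kappa> * exp A)"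
  define Y where "Y = Cq * (1 + \<rho>) powr ((n - 1) * (1 - q / 2)) * exp (q * \<rho>)"
  have F: "0 < F" "F \<le> eig_moment s"
    using eig_moment_growth[OF gc _ s] m c eps s1 by (auto simp: F_def \<kappa>_def A_def)
  have Y: "0 < Y" using Cq(1) \<rho> by (simp add: Y_def)
  have g: "continuous_on UNIV ?g" by (intro smooth_imp_continuous_on smooth_radial_eig) simp
  have H: "(F / 2) powr p * Y powr (1 - p) \<le> power_mean s"
  proof (rule power_mean_lower_bound[OF s1 s(2) i g _ F(1) F(2)[unfolded eig_moment_def] Y])
    show "0 < ?g z" if "0 \<le> z" for z using radial_eig_ge_1[of "DIM('a)" z] that by simp
    show "(LINT x|lebesgue. indicator (cball 0 (A_k k s + R)) (x::'a) * ?g ((norm x)\<^sup>2) powr (p / (p - 1))) \<le> Y"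
      using Cq(2)[OF \<rho>] by (simp add: Y_def q_def n_def \<rho>_def A_def)
  qed
  have E1: "(F / 2) powr p = (c * m / 2) powr p * (\<epsilon> powr p * s powr (\<kappa> * p) * exp (p * A))"
  proof -
    have "F / 2 = (c * m / 2) * (\<epsilon> * s powr \<kappa> * exp A)" by (simp add: F_def)
    then show ?thesis by (simp only: powr_mult powr_powr exp_powr_real mult.commute[of A p])
  qed
  \<comment> \<open>Since q (1 - p) = - p, the conjugate integral contributes exp (- p A), the
    inverse of the exponential in \<open>E1\<close>.\<close>
  have E2: "Y powr (1 - p) = Cq powr (1 - p) * (1 + \<rho>) powr \<gamma> * (exp (- p * A) * exp (- p * R))"
  proof -
    have e1: "(n - 1) * (1 - q / 2) * (1 - p) = \<gamma>" "q * \<rho> * (1 - p) = - p * A + - p * R"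
      using p by (auto simp: q_def \<gamma>_def \<rho>_def field_simps)
    show ?thesis unfolding Y_def powr_mult powr_powr exp_powr_real e1 exp_add by simp
  qed
  \<comment> \<open>1 + \<rho> is comparable to s powr (1 - k) with the constant K, where 1 / (1 -
    k) \<ge> 1 gives the lower bound. The sign of \<gamma> depends on p, hence the absolute
    value.\<close>
  have "K powr (- \<bar>\<gamma>\<bar>) * s powr ((1 - k) * \<gamma>) \<le> (1 + \<rho>) powr \<gamma>"
  proof -
    define y where "y = s powr (1 - k)"
    have y: "1 \<le> y" using s1 k by (simp add: y_def ge_one_powr_ge_zero)
    have \<rho>y: "1 + \<rho> = 1 + R + (y - 1) / (1 - k)" using k s1 by (simp add: \<rho>_def A_def A_k_eq y_def)
    have K: "1 \<le> K" using R k by (simp add: K_def)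
    have "(y - 1) * 1 \<le> (y - 1) * (1 / (1 - k))" using y k by (intro mult_left_mono) auto
    then have le1: "y \<le> 1 + \<rho>" using R by (simp add: \<rho>y)
    have "(1 + R) * 1 \<le> (1 + R) * y" using R y by (intro mult_left_mono) auto
    moreover have "(y - 1) / (1 - k) \<le> 1 / (1 - k) * y" using k by (simp add: divide_right_mono)
    ultimately have le2: "1 + \<rho> \<le> K * y" unfolding \<rho>y K_def distrib_right by linarith
    have "y powr \<gamma> \<le> K powr \<bar>\<gamma>\<bar> * (1 + \<rho>) powr \<gamma>"
    proof (rule powr_le_ratio)
      have "1 * (1 + \<rho>) \<le> K * (1 + \<rho>)" using K \<rho> by (intro mult_right_mono) auto
      then show "y \<le> K * (1 + \<rho>)" using le1 by simp
    qed (use y \<rho> le2 in auto)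
    moreover have "y powr \<gamma> = s powr ((1 - k) * \<gamma>)" by (simp add: y_def powr_powr)
    ultimately show ?thesis using K by (simp add: powr_minus field_simps)
  qed
  then have "(c * m / 2) powr p * (\<epsilon> powr p * s powr (\<kappa> * p) * exp (p * A)) *
      (Cq powr (1 - p) * (K powr (- \<bar>\<gamma>\<bar>) * s powr ((1 - k) * \<gamma>)) * (exp (- p * A) * exp (- p * R)))
      \<le> (c * m / 2) powr p * (\<epsilon> powr p * s powr (\<kappa> * p) * exp (p * A)) *
      (Cq powr (1 - p) * (1 + \<rho>) powr \<gamma> * (exp (- p * A) * exp (- p * R)))"
    by (intro mult_left_mono mult_right_mono) auto
  from order.trans[OF this H[unfolded E1 E2]]
  have "(c * m / 2) powr p * (\<epsilon> powr p * s powr (\<kappa> * p) * exp (p * A)) *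
      (Cq powr (1 - p) * (K powr (- \<bar>\<gamma>\<bar>) * s powr ((1 - k) * \<gamma>)) * (exp (- p * A) * exp (- p * R)))
      \<le> power_mean s" .
  moreover have E3: "(c * m / 2) powr p * (\<epsilon> powr p * s powr (\<kappa> * p) * exp (p * A)) *
      (Cq powr (1 - p) * (K powr (- \<bar>\<gamma>\<bar>) * s powr ((1 - k) * \<gamma>)) * (exp (- p * A) * exp (- p * R))) =
      (c * m / 2) powr p * (Cq powr (1 - p) * exp (- p * R) * K powr (- \<bar>\<gamma>\<bar>)) *
      (\<epsilon> powr p * (s powr (\<kappa> * p) * s powr ((1 - k) * \<gamma>))) * (exp (p * A) * exp (- p * A))"
    by (simp only: mult_ac)
  moreover have E4: "exp (p * A) * exp (- p * A) = 1" by (simp add: exp_add[symmetric])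
  moreover have E5: "s powr (\<kappa> * p) * s powr ((1 - k) * \<gamma>) = s powr source_exponent k \<mu> p DIM('a)"
    unfolding powr_add[symmetric] by (simp add: source_exponent_def \<kappa>_def \<gamma>_def n_def)
  ultimately show ?thesis
    unfolding eig_moment_const_def K_def[symmetric] n_def[symmetric] \<gamma>_def[symmetric] E5
    by (simp only: mult_1_right)
qed

text \<open>On [S, 2 S] the source bound is constant up to 2 powr (- |e|), whatever the sign of the
  source exponent e. Two integrations over a window of length S contribute S^2, hence e + 2, and
  mean S \<ge> 0 is discarded.\<close>

lemma mean_ge_source:
  assumes gc: "growth_constants k \<mu> t0 c"
    and m: "0 < m" "m = (LINT x|lebesgue. u0 x * radial_eig DIM('a) ((norm x)\<^sup>2))"
    and Cq: "0 < Cq" "\<And>\<rho>. 0 \<le> \<rho> \<Longrightarrow>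
      (LINT x|lebesgue. indicator (cball 0 \<rho>) (x::'a) * radial_eig DIM('a) ((norm x)\<^sup>2) powr (p / (p - 1)))
        \<le> Cq * (1 + \<rho>) powr ((real DIM('a) - 1) * (1 - p / (p - 1) / 2)) * exp (p / (p - 1) * \<rho>)"
    and S: "t0 \<le> S" "ereal (2 * S) < T" and pos: "0 < mean 1"
  shows "2 powr (- \<mu>) * (eig_moment_const k \<mu> p R DIM('a) c Cq m *
      2 powr (- \<bar>source_exponent k \<mu> p DIM('a)\<bar>)) / 2 *
      (\<epsilon> powr p * S powr (source_exponent k \<mu> p DIM('a) + 2)) \<le> mean (2 * S)"
proof -
  define e where "e = source_exponent k \<mu> p DIM('a)"
  define C where "C = eig_moment_const k \<mu> p R DIM('a) c Cq m"
  have c: "0 < c" "1 \<le> t0" using gc by (auto simp: growth_constants_def)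
  have S1: "1 \<le> S" using c S by simp
  have C: "0 < C" unfolding C_def using c m Cq k R by (intro eig_moment_const_pos)
  define M where "M = C * (\<epsilon> powr p * (2 powr (- \<bar>e\<bar>) * S powr e))"
  have "AE \<sigma> in lebesgue. \<sigma> \<in> {S..2 * S} \<longrightarrow> M \<le> power_mean \<sigma>"
  proof -
    have "1 \<le> 2 * S" using S1 by simp
    from AE_power_integrable[OF this S(2)] show ?thesis
    proof eventually_elim
      case (elim \<sigma>)
      show ?case
      proof
        assume \<sigma>: "\<sigma> \<in> {S..2 * S}"
        have \<sigma>T: "ereal \<sigma> < T" using \<sigma> S by (auto intro: le_less_trans[of _ "ereal (2 * S)"])
        have "S powr e \<le> 2 powr \<bar>e\<bar> * \<sigma> powr e"
          using \<sigma> S1 by (intro powr_le_ratio) auto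
        then have "2 powr (- \<bar>e\<bar>) * S powr e \<le> \<sigma> powr e" by (simp add: powr_minus field_simps)
        then have "M \<le> C * (\<epsilon> powr p * \<sigma> powr e)"
          unfolding M_def using C by (intro mult_left_mono) auto
        also have "\<dots> \<le> power_mean \<sigma>"
          unfolding C_def e_def using elim \<sigma> S S1 \<sigma>T by (intro power_mean_ge_source[OF gc m Cq]) auto
        finally show "M \<le> power_mean \<sigma>" .
      qed
    qed
  qed
  then have "mean S + 2 powr (- \<mu>) * M * (2 * S - S)\<^sup>2 / 2 \<le> mean (2 * S)"
    using S1 S C by (intro mean_window_growth[of S]) (auto simp: M_def)
  moreover have "ereal S < T" using S S1 by (auto intro: le_less_trans[of _ "ereal (2 * S)"])
  then have "0 \<le> mean S" using mean_mono[of 1 S] pos S1 by simp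
  moreover have "2 powr (- \<mu>) * M * (2 * S - S)\<^sup>2 / 2 =
      2 powr (- \<mu>) * (C * 2 powr (- \<bar>e\<bar>)) / 2 * (\<epsilon> powr p * S powr (e + 2))"
    using S1 powr_add[of S e 2] by (simp add: M_def)
  ultimately show ?thesis unfolding C_def e_def by linarith
qed

end

section \<open>Positive initial moments and the two lifespan estimates\<close>

lemma moment_pos:
  fixes v :: "'a::euclidean_space \<Rightarrow> real"
  assumes v: "in_L2 v" "ess_support v \<subseteq> cball 0 R" "AE x in lebesgue. 0 \<le> v x"
    "\<not> (AE x in lebesgue. v x = 0)"
    and h: "continuous_on UNIV h" "\<And>z. 0 \<le> z \<Longrightarrow> 0 < h z"
  shows "0 < (LINT x|lebesgue. v x * h ((norm x)\<^sup>2))"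
proof -
  have [measurable]: "v \<in> borel_measurable lebesgue" using v(1) by (simp add: in_L2_def)
  note [measurable] = borel_measurable_radial[OF h(1)]
  have h0: "0 < h ((norm x)\<^sup>2)" for x :: 'a using h(2) by simp
  have "AE x in lebesgue. v x * (indicator (cball 0 R) x * h ((norm x)\<^sup>2)) = v x * h ((norm x)\<^sup>2)"
    using AE_zero_outside[OF v(2)] by eventually_elim (auto simp: indicator_def)
  then have i: "integrable lebesgue (\<lambda>x. v x * h ((norm x)\<^sup>2))"
    by (intro integrable_cong_AE_imp[OF in_L2_integrable_mult[OF v(1)
        in_L2_indicator_cball[OF continuous_on_radial[OF h(1)], of R]]]) measurable
  have nn: "AE x in lebesgue. 0 \<le> v x * h ((norm x)\<^sup>2)"
    using v(3) by eventually_elim (use h0 in \<open>simp add: less_imp_le\<close>)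
  have "(LINT x|lebesgue. v x * h ((norm x)\<^sup>2)) \<noteq> 0"
  proof
    assume "(LINT x|lebesgue. v x * h ((norm x)\<^sup>2)) = 0"
    then have "AE x in lebesgue. v x * h ((norm x)\<^sup>2) = 0"
      using integral_nonneg_eq_0_iff_AE[OF i nn] by simp
    then have "AE x in lebesgue. v x = 0"
      by eventually_elim (metis h0 less_irrefl mult_eq_0_iff)
    then show False using v(4) by simp
  qed
  then show ?thesis using integral_nonneg_AE[OF nn] by linarith
qed

definition window_bound :: "real \<Rightarrow> real \<Rightarrow> real \<Rightarrow> real \<Rightarrow> nat \<Rightarrow> real" where
  "window_bound k \<mu> p R n = 2 / (1 - 2 powr (- (p - 1) / 2))\<^sup>2 / window_const k \<mu> p R n"

context supported_solution
begin

lemma mean_initial: "mean 1 = \<epsilon> * (LINT x|lebesgue. u0 x)"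
  using initial_moment[of "\<lambda>_. 1"] by (simp add: mean_def)

text \<open>By monotonicity the initial mean, \<epsilon> times the integral of u0, serves as m in
  the window bound at every S. Solving for S requires \<beta> > 0, which is the condition p <
  p1.\<close>

lemma lifespan_le_subFujita:
  assumes m: "0 < (LINT x|lebesgue. u0 x)" and \<beta>: "0 < 2 - (1 - k) * real DIM('a) * (p - 1)"
  defines "\<beta> \<equiv> 2 - (1 - k) * real DIM('a) * (p - 1)"
  shows "T \<le> ereal (4 * (1 + (window_bound k \<mu> p R DIM('a) / (LINT x|lebesgue. u0 x) powr (p - 1)) powr (1 / \<beta>)
    * \<epsilon> powr (- ((p - 1) / \<beta>))))"
proof (rule lifespan_le)
  fix S assume S: "1 \<le> S" "ereal (4 * S) < T"
  have pos: "0 < mean 1" using m eps by (simp add: mean_initial)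
  have T: "ereal (2 * S) < T" "ereal S < T"
    using S by (auto intro: le_less_trans[of _ "ereal (4 * S)"])
  have "S powr \<beta> * mean 1 powr (p - 1) \<le> window_bound k \<mu> p R DIM('a)"
    unfolding \<beta>_def window_bound_def
    using S T pos mean_mono[of 1 S] by (intro mean_window_bound) auto
  then have "S powr \<beta> * (\<epsilon> powr (p - 1) * (LINT x|lebesgue. u0 x) powr (p - 1)) \<le> window_bound k \<mu> p R DIM('a)"
    unfolding mean_initial powr_mult .
  then show "S \<le> (window_bound k \<mu> p R DIM('a) / (LINT x|lebesgue. u0 x) powr (p - 1)) powr (1 / \<beta>)
      * \<epsilon> powr (- ((p - 1) / \<beta>))"
    using \<beta> S m eps by (intro powr_bound_solve) (auto simp: \<beta>_def)
qed auto

text \<open>Two windows: on [S, 2 S] the source raises the mean to order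
  \<open>\<epsilon> powr p * S powr (e + 2)\<close>, and with this m the window bound is applied on
  [2 S, 4 S], whence the factor 2 powr \<beta>. The sign of \<beta> is free here; it is
  \<open>\<theta>\<close> > 0 that permits solving for S.\<close>

lemma lifespan_le_subStrauss:
  assumes gc: "growth_constants k \<mu> t0 c"
    and m: "0 < m" "m = (LINT x|lebesgue. u0 x * radial_eig DIM('a) ((norm x)\<^sup>2))"
    and m0: "0 < (LINT x|lebesgue. u0 x)"
    and Cq: "0 < Cq" "\<And>\<rho>. 0 \<le> \<rho> \<Longrightarrow>
      (LINT x|lebesgue. indicator (cball 0 \<rho>) (x::'a) * radial_eig DIM('a) ((norm x)\<^sup>2) powr (p / (p - 1)))
        \<le> Cq * (1 + \<rho>) powr ((real DIM('a) - 1) * (1 - p / (p - 1) / 2)) * exp (p / (p - 1) * \<rho>)"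
    and \<theta>: "0 < \<theta> DIM('a) k \<mu> p"
  defines "C \<equiv> 2 powr (- \<mu>) * (eig_moment_const k \<mu> p R DIM('a) c Cq m *
      2 powr (- \<bar>source_exponent k \<mu> p DIM('a)\<bar>)) / 2"
    and "\<beta> \<equiv> 2 - (1 - k) * real DIM('a) * (p - 1)"
  shows "T \<le> ereal (4 * (t0 + (window_bound k \<mu> p R DIM('a) / (2 powr \<beta> * C powr (p - 1)))
    powr (1 / \<theta> DIM('a) k \<mu> p) * \<epsilon> powr (- (p * (p - 1) / \<theta> DIM('a) k \<mu> p))))"
proof (rule lifespan_le)
  have c: "0 < c" "1 \<le> t0" using gc by (auto simp: growth_constants_def)
  then show "0 \<le> t0" by simp
  have C: "0 < C" unfolding C_def using eig_moment_const_pos[OF c(1) Cq(1) m(1) k(2) R] by simp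
  fix S assume S: "t0 \<le> S" "ereal (4 * S) < T"
  define e where "e = source_exponent k \<mu> p DIM('a)"
  have S1: "1 \<le> S" using c S by simp
  have pos: "0 < mean 1" using m0 eps by (simp add: mean_initial)
  have T: "ereal (2 * S) < T" "ereal (2 * (2 * S)) < T"
    using S S1 by (auto intro: le_less_trans[of _ "ereal (4 * S)"])
  have "(2 * S) powr \<beta> * (C * (\<epsilon> powr p * S powr (e + 2))) powr (p - 1) \<le> window_bound k \<mu> p R DIM('a)"
    unfolding \<beta>_def window_bound_def
  proof (rule mean_window_bound[OF _ T(2) pos])
    show "C * (\<epsilon> powr p * S powr (e + 2)) \<le> mean (2 * S)"
      unfolding C_def e_def by (rule mean_ge_source[OF gc m Cq S(1) T(1) pos])
  qed (use S1 C eps in auto)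
  also have "(2 * S) powr \<beta> * (C * (\<epsilon> powr p * S powr (e + 2))) powr (p - 1) =
      S powr \<theta> DIM('a) k \<mu> p * (\<epsilon> powr (p * (p - 1)) * (2 powr \<beta> * C powr (p - 1)))"
  proof -
    have t: "\<theta> DIM('a) k \<mu> p = (e + 2) * (p - 1) + \<beta>"
      unfolding e_def \<beta>_def by (rule theta_eq_source_exponent)
    have "S powr ((e + 2) * (p - 1) + \<beta>) = S powr ((e + 2) * (p - 1)) * S powr \<beta>" by (rule powr_add)
    then show ?thesis unfolding t powr_mult powr_powr by (simp only: mult_ac)
  qed
  finally show "S \<le> (window_bound k \<mu> p R DIM('a) / (2 powr \<beta> * C powr (p - 1)))
      powr (1 / \<theta> DIM('a) k \<mu> p) * \<epsilon> powr (- (p * (p - 1) / \<theta> DIM('a) k \<mu> p))"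
    using \<theta> S1 C eps by (intro powr_bound_solve) auto
qed auto

end

text \<open>For \<epsilon> \<le> 1 the factor \<epsilon> powr (- e) is at least 1 and so absorbs the
  additive time t.\<close>

lemma affine_powr_le:
  fixes \<epsilon> e :: real
  assumes "0 < \<epsilon>" "\<epsilon> \<le> 1" "0 \<le> e" "0 \<le> t" "0 \<le> D" "4 * (t + D) \<le> C"
  shows "4 * (t + D * \<epsilon> powr (- e)) \<le> C * \<epsilon> powr (- e)"
proof -
  have "1 \<le> \<epsilon> powr (- e)"
    using assms powr_mono2'[of "- e" \<epsilon> 1] by simp
  then have "t * 1 \<le> t * \<epsilon> powr (- e)" using assms by (intro mult_left_mono) auto
  then have "4 * (t + D * \<epsilon> powr (- e)) \<le> 4 * (t + D) * \<epsilon> powr (- e)" by (simp add: algebra_simps)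
  also have "\<dots> \<le> C * \<epsilon> powr (- e)" using assms by (intro mult_right_mono) auto
  finally show ?thesis .
qed

theorem theorem1p2:
  fixes u0 u1 :: "real ^ 'n \<Rightarrow> real"
    and k \<mu> p R :: real
    and n :: nat
  defines "n \<equiv> CARD('n)"
  assumes "0 \<le> k" "k < 1" "0 \<le> \<mu>"
    and "1 < p" "ereal p < max (p0 k n \<mu>) (ereal (p1 k n))"
    and "0 < R"
    and "in_H1 u0" "in_L2 u1"
    and "AE x in lebesgue. 0 \<le> u0 x" "AE x in lebesgue. 0 \<le> u1 x"
    and "\<not> (AE x in lebesgue. u0 x = 0)" "\<not> (AE x in lebesgue. u1 x = 0)"
    and "compact (ess_support u0)" "compact (ess_support u1)"
    and "ess_support u0 \<subseteq> cball 0 R" "ess_support u1 \<subseteq> cball 0 R"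
  shows "\<exists>\<epsilon>0 > 0. \<exists>C > 0. \<forall>\<epsilon> T u.
    0 < \<epsilon> \<and> \<epsilon> \<le> \<epsilon>0 \<and>
    energy_solution_with_lifespan k \<mu> p \<epsilon> u0 u1 T u \<and>
    (\<forall>t. 1 < t \<and> ereal t < T \<longrightarrow> ess_support (u t) \<subseteq> cball 0 (A_k k t + R)) \<longrightarrow>
      T < \<infinity> \<and>
      (ereal p < p0 k n \<mu> \<longrightarrow>
        T \<le> ereal (C * \<epsilon> powr (- (p * (p - 1) / \<theta> n k \<mu> p)))) \<and>
      (p < p1 k n \<longrightarrow>
        T \<le> ereal (C * \<epsilon> powr (- inverse (2 / (p - 1) - (1 - k) * real n))))"
proof -
  note kk = \<open>0 \<le> k\<close> \<open>k < 1\<close> and p = \<open>1 < p\<close>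
  have n: "n = DIM(real ^ 'n)" by (simp add: n_def)
  have n0: "0 < n" by (simp add: n_def)
  have u0: "in_L2 u0" using \<open>in_H1 u0\<close> by (simp add: in_H1_def)
  define q where "q = p / (p - 1)"
  have q: "0 < q" using p by (simp add: q_def)
  obtain t0 c where gc: "growth_constants k \<mu> t0 c" using growth_constants_exist[OF kk] by blast
  have t0: "1 \<le> t0" using gc by (simp add: growth_constants_def)
  obtain Cq where Cq: "0 < Cq" "\<And>\<rho>. 0 \<le> \<rho> \<Longrightarrow>
      (LINT x|lebesgue. indicator (cball 0 \<rho>) (x::real ^ 'n) * radial_eig DIM(real ^ 'n) ((norm x)\<^sup>2) powr q)
        \<le> Cq * (1 + \<rho>) powr ((real DIM(real ^ 'n) - 1) * (1 - q / 2)) * exp (q * \<rho>)"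
    using integral_cball_radial_eig_bound[OF q, where ?'a = "real ^ 'n"] by blast
  define I0 where "I0 = (LINT x|lebesgue. u0 x)"
  define m where "m = (LINT x|lebesgue. u0 x * radial_eig DIM(real ^ 'n) ((norm x)\<^sup>2))"
  have I0: "0 < I0"
    using moment_pos[OF u0 \<open>ess_support u0 \<subseteq> cball 0 R\<close> \<open>AE x in lebesgue. 0 \<le> u0 x\<close>
        \<open>\<not> (AE x in lebesgue. u0 x = 0)\<close>, of "\<lambda>_. 1"] by (simp add: I0_def)
  have m: "0 < m" unfolding m_def
  proof (rule moment_pos[OF u0 \<open>ess_support u0 \<subseteq> cball 0 R\<close> \<open>AE x in lebesgue. 0 \<le> u0 x\<close>
        \<open>\<not> (AE x in lebesgue. u0 x = 0)\<close>])
    show "continuous_on UNIV (radial_eig DIM(real ^ 'n))"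
      by (intro smooth_imp_continuous_on smooth_radial_eig) simp
    show "0 < radial_eig DIM(real ^ 'n) z" if "0 \<le> z" for z
      using radial_eig_ge_1[of "DIM(real ^ 'n)" z] that by simp
  qed
  define \<beta> where "\<beta> = 2 - (1 - k) * real n * (p - 1)"
  define W where "W = window_bound k \<mu> p R n"
  define D1 where "D1 = (W / I0 powr (p - 1)) powr (1 / \<beta>)"
  define D2 where "D2 = (W / (2 powr \<beta> * (2 powr (- \<mu>) * (eig_moment_const k \<mu> p R n c Cq m *
      2 powr (- \<bar>source_exponent k \<mu> p n\<bar>)) / 2) powr (p - 1))) powr (1 / \<theta> n k \<mu> p)"
  \<comment> \<open>One constant for both cases. D1 and D2 are values of \<open>powr\<close>, hence
    nonnegative also for those p for which the corresponding estimate is not claimed, so the sum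
    dominates each part.\<close>
  define C where "C = 4 * (1 + D1) + 4 * (t0 + D2)"
  have D: "0 \<le> D1" "0 \<le> D2" by (auto simp: D1_def D2_def)
  have C: "4 * (1 + D1) \<le> C" "4 * (t0 + D2) \<le> C" "0 < C" using D t0 by (auto simp: C_def)
  show ?thesis
  \<comment> \<open>The threshold for \<epsilon> is 1: smallness serves to absorb the additive times
    1 and t0 by \<open>affine_powr_le\<close>.\<close>
  proof (rule exI[of _ 1], rule conjI[OF zero_less_one], rule exI[of _ C], rule conjI[OF C(3)], intro allI impI)
    fix \<epsilon> T u
    assume *: "0 < \<epsilon> \<and> \<epsilon> \<le> 1 \<and> energy_solution_with_lifespan k \<mu> p \<epsilon> u0 u1 T u \<and>
      (\<forall>t. 1 < t \<and> ereal t < T \<longrightarrow> ess_support (u t) \<subseteq> cball 0 (A_k k t + R))"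
    interpret supported_solution k \<mu> p R \<epsilon> u0 u1 T u
      using * assms u0 by unfold_locales (auto simp: energy_solution_with_lifespan_def)
    have 1: "T \<le> ereal (C * \<epsilon> powr (- (p * (p - 1) / \<theta> n k \<mu> p)))" if "ereal p < p0 k n \<mu>"
    proof -
      have \<theta>: "0 < \<theta> n k \<mu> p" by (rule less_p0_imp_theta_pos[OF n0 kk \<open>0 \<le> \<mu>\<close> p that])
      have "T \<le> ereal (4 * (t0 + D2 * \<epsilon> powr (- (p * (p - 1) / \<theta> n k \<mu> p))))"
        unfolding D2_def W_def \<beta>_def n
        by (rule lifespan_le_subStrauss[OF gc m m_def I0[unfolded I0_def] Cq(1) Cq(2)[unfolded q_def]
              \<theta>[unfolded n]])
      also have "\<dots> \<le> ereal (C * \<epsilon> powr (- (p * (p - 1) / \<theta> n k \<mu> p)))"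
        unfolding ereal_less_eq using * p \<theta> t0 D C by (intro affine_powr_le) auto
      finally show ?thesis .
    qed
    have 2: "T \<le> ereal (C * \<epsilon> powr (- inverse (2 / (p - 1) - (1 - k) * real n)))" if "p < p1 k n"
    proof -
      have nk: "0 < (1 - k) * real n" using kk n0 by simp
      have "p - 1 < 2 / ((1 - k) * real n)" using that by (simp add: p1_def)
      then have \<beta>: "0 < \<beta>" using nk by (simp add: \<beta>_def pos_less_divide_eq mult.commute)
      have "T \<le> ereal (4 * (1 + D1 * \<epsilon> powr (- ((p - 1) / \<beta>))))"
        unfolding D1_def W_def I0_def \<beta>_def n
        by (rule lifespan_le_subFujita[OF I0[unfolded I0_def] \<beta>[unfolded \<beta>_def n]])
      also have "\<dots> \<le> ereal (C * \<epsilon> powr (- ((p - 1) / \<beta>)))"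
        unfolding ereal_less_eq using * p \<beta> D C by (intro affine_powr_le) auto
      also have "(p - 1) / \<beta> = inverse (2 / (p - 1) - (1 - k) * real n)"
      proof -
        have "2 / (p - 1) - (1 - k) * real n = \<beta> / (p - 1)" using p by (simp add: \<beta>_def field_simps)
        then show ?thesis by simp
      qed
      finally show ?thesis .
    qed
    have "T < \<infinity>" using 1 2 assms(6) by (auto simp: less_max_iff_disj)
    with 1 2 show "T < \<infinity> \<and>
      (ereal p < p0 k n \<mu> \<longrightarrow> T \<le> ereal (C * \<epsilon> powr (- (p * (p - 1) / \<theta> n k \<mu> p)))) \<and>
      (p < p1 k n \<longrightarrow> T \<le> ereal (C * \<epsilon> powr (- inverse (2 / (p - 1) - (1 - k) * real n))))"
      by blast
  qed
qed

end
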